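(* Let $G$ be a median graph with $n$ vertices, dimension $d$ and a fixed basepoint $v_0$. There is a combinatorial algorithm enumerating the sets $\parallel_{\mathrm{Pm}}(L,u)$, for all pairs $(L,u)$ with $u$ a vertex and $L$ a POF incoming into $u$, in time $\tilde{O}(3.5394^d n)$.
   Context: A finite connected simple graph is median if for every triple of distinct vertices $x,y,z$, $I(x,y)\cap I(y,z)\cap I(z,x)$ is a single vertex, where $I(a,b)=\{w: d(a,w)+d(w,b)=d(a,b)\}$; its dimension $d$ is the largest $k$ with $Q_k$ an induced subgraph. Two edges $uv,xy$ are in relation $\Theta_0$ if $u,v,y,x$ form a 4-cycle with $uv,xy$ opposite; $\Theta$ is the reflexive-transitive closure of $\Theta_0$, with classes called $\Theta$-classes. Two $\Theta$-classes $E_i,E_j$ are orthogonal if there is a 4-cycle $uvyx$ with $uv,xy\in E_i$ and $ux,vy\in E_j$. A POF is a set of pairwise orthogonal $\Theta$-classes. Under the $v_0$-orientation each edge $uv$ is oriented $u\to v$ if $d(v_0,u)<d(v_0,v)$. A POF $L$ is incoming into (resp. outgoing from) $u$ if every class of $L$ has an edge incident to $u$ oriented into (resp. out of) $u$. For POFs $L,L^+$, $L^+$ is $L$-parallel if for every $E_j\in L^+$, $L\cup\{E_j\}$ is not a POF. For $L$ incoming into $u$, $L^+$ is $(L,u)$-parallel if it is $L$-parallel and outgoing from $u$; it is minimal $(L,u)$-parallel if it is $(L,u)$-parallel but not $(L',u)$-parallel for any $L'\subsetneq L$. $\parallel_{\mathrm{Pm}}(L,u)$ is the set of minimal $(L,u)$-parallel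 POFs. $\tilde{O}$ suppresses polylogarithmic factors in $n$. *)

theory Defs
  imports Complex_Main "HOL-Library.Log_Nat"
begin

section \<open>Median graphs\<close>

text \<open>A graph is given by its vertex set and its set of edges, an edge being a two-element set
  of vertices. Distances and walks only depend on the edges.\<close>

definition simple_graph :: "'a set \<Rightarrow> 'a set set \<Rightarrow> bool" where
  "simple_graph V E \<longleftrightarrow> finite V \<and> (\<forall>e\<in>E. e \<subseteq> V \<and> card e = 2)"

definition adj_rel :: "'a set set \<Rightarrow> ('a \<times> 'a) set" where
  "adj_rel E = {(u, v). {u, v} \<in> E}"

definition connected_graph :: "'a set \<Rightarrow> 'a set set \<Rightarrow> bool" where
  "connected_graph V E \<longleftrightarrow> V \<noteq> {} \<and> (\<forall>u\<in>V. \<forall>v\<in>V. (u, v) \<in> (adj_rel E)\<^sup>*)"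

text \<open>The length of a shortest walk; only meaningful if the two vertices are connected.\<close>

definition gdist :: "'a set set \<Rightarrow> 'a \<Rightarrow> 'a \<Rightarrow> nat" where
  "gdist E u v = (LEAST k. (u, v) \<in> adj_rel E ^^ k)"

definition interval :: "'a set \<Rightarrow> 'a set set \<Rightarrow> 'a \<Rightarrow> 'a \<Rightarrow> 'a set" where
  "interval V E a b = {w \<in> V. gdist E a w + gdist E w b = gdist E a b}"

definition median_graph :: "'a set \<Rightarrow> 'a set set \<Rightarrow> bool" where
  "median_graph V E \<longleftrightarrow> simple_graph V E \<and> connected_graph V E \<and>
     (\<forall>x\<in>V. \<forall>y\<in>V. \<forall>z\<in>V. x \<noteq> y \<and> y \<noteq> z \<and> z \<noteq> x \<longrightarrow>
        (\<exists>m. interval V E x y \<inter> interval V E y z \<inter> interval V E z x = {m}))"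

text \<open>The vertices of the hypercube \<open>Q\<^sub>k\<close> are the subsets of \<open>{..<k}\<close>, two of them being
  adjacent if they differ in exactly one element.\<close>

definition induced_cube :: "'a set \<Rightarrow> 'a set set \<Rightarrow> nat \<Rightarrow> bool" where
  "induced_cube V E k \<longleftrightarrow> (\<exists>f :: nat set \<Rightarrow> 'a.
     inj_on f (Pow {..<k}) \<and> f ` Pow {..<k} \<subseteq> V \<and>
     (\<forall>S\<in>Pow {..<k}. \<forall>T\<in>Pow {..<k}.
        {f S, f T} \<in> E \<longleftrightarrow> card ((S - T) \<union> (T - S)) = 1))"

definition dimension :: "'a set \<Rightarrow> 'a set set \<Rightarrow> nat" where
  "dimension V E = Max {k. induced_cube V E k}"

section \<open>\<open>\<Theta>\<close>-classes and POFs\<close>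

definition four_cycle :: "'a set set \<Rightarrow> 'a \<Rightarrow> 'a \<Rightarrow> 'a \<Rightarrow> 'a \<Rightarrow> bool" where
  "four_cycle E a b c d \<longleftrightarrow> distinct [a, b, c, d] \<and>
     {a, b} \<in> E \<and> {b, c} \<in> E \<and> {c, d} \<in> E \<and> {d, a} \<in> E"

definition theta0 :: "'a set set \<Rightarrow> ('a set \<times> 'a set) set" where
  "theta0 E = {(e, f). \<exists>u v x y. e = {u, v} \<and> f = {x, y} \<and> four_cycle E u v y x}"

definition theta_classes :: "'a set set \<Rightarrow> 'a set set set" where
  "theta_classes E = E // (theta0 E)\<^sup>*"

definition orthogonal :: "'a set set \<Rightarrow> 'a set set \<Rightarrow> 'a set set \<Rightarrow> bool" where
  "orthogonal E F F' \<longleftrightarrow> (\<exists>u v x y. four_cycle E u v y x \<and>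
     {u, v} \<in> F \<and> {x, y} \<in> F \<and> {u, x} \<in> F' \<and> {v, y} \<in> F')"

definition pof :: "'a set set \<Rightarrow> 'a set set set \<Rightarrow> bool" where
  "pof E L \<longleftrightarrow> L \<subseteq> theta_classes E \<and> pairwise (orthogonal E) L"

definition incoming :: "'a set set \<Rightarrow> 'a \<Rightarrow> 'a set set set \<Rightarrow> 'a \<Rightarrow> bool" where
  "incoming E v0 L u \<longleftrightarrow> (\<forall>F\<in>L. \<exists>w. {w, u} \<in> F \<and> gdist E v0 w < gdist E v0 u)"

definition outgoing :: "'a set set \<Rightarrow> 'a \<Rightarrow> 'a set set set \<Rightarrow> 'a \<Rightarrow> bool" where
  "outgoing E v0 L u \<longleftrightarrow> (\<forall>F\<in>L. \<exists>w. {u, w} \<in> F \<and> gdist E v0 u < gdist E v0 w)"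

definition parallel :: "'a set set \<Rightarrow> 'a set set set \<Rightarrow> 'a set set set \<Rightarrow> bool" where
  "parallel E L M \<longleftrightarrow> (\<forall>F\<in>M. \<not> pof E (L \<union> {F}))"

definition parallel_at ::
    "'a set set \<Rightarrow> 'a \<Rightarrow> 'a set set set \<Rightarrow> 'a \<Rightarrow> 'a set set set \<Rightarrow> bool" where
  "parallel_at E v0 L u M \<longleftrightarrow> parallel E L M \<and> outgoing E v0 M u"

definition min_parallel ::
    "'a set set \<Rightarrow> 'a \<Rightarrow> 'a set set set \<Rightarrow> 'a \<Rightarrow> 'a set set set set" where
  "min_parallel E v0 L u =
     {M. pof E M \<and> parallel_at E v0 L u M \<and> (\<forall>L'. L' \<subset> L \<longrightarrow> \<not> parallel_at E v0 L' u M)}"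

definition incoming_pairs ::
    "'a set \<Rightarrow> 'a set set \<Rightarrow> 'a \<Rightarrow> ('a set set set \<times> 'a) set" where
  "incoming_pairs V E v0 = {(L, u). u \<in> V \<and> pof E L \<and> incoming E v0 L u}"

section \<open>Random access machine with logarithmic cost\<close>

text \<open>Programs manipulate finitely many unbounded arrays of natural numbers, named by strings; a
  scalar variable is cell 0 of an array. As on the Cook--Reckhow machine, the only arithmetic is
  addition and (truncated) subtraction, and every operation is charged the number of bits of the
  numbers and addresses involved, so that no work can be hidden in large numbers. For
  polynomial-time programs, running times agree with those on a word RAM up to factors
  polylogarithmic in the input size.\<close>

type_synonym memory = "string \<Rightarrow> nat \<Rightarrow> nat"

datatype aexp = Const nat | Get string aexp | Add aexp aexp | Sub aexp aexp

datatype bexp = Lt aexp aexp | Neg bexp | Conj bexp bexp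

datatype com = Skip | Put string aexp aexp | Seq com com | Cond bexp com com | While bexp com

definition size_cost :: "nat \<Rightarrow> nat" where
  "size_cost k = 1 + floorlog 2 k"

fun aval :: "aexp \<Rightarrow> memory \<Rightarrow> nat" where
  "aval (Const k) s = k"
| "aval (Get X a) s = s X (aval a s)"
| "aval (Add a b) s = aval a s + aval b s"
| "aval (Sub a b) s = aval a s - aval b s"

text \<open>The cost of an expression includes the size of its value, hence the cost of a compound
  expression includes the sizes of all operands and addresses.\<close>

fun acost :: "aexp \<Rightarrow> memory \<Rightarrow> nat" where
  "acost (Const k) s = size_cost k"
| "acost (Get X a) s = acost a s + size_cost (aval (Get X a) s)"
| "acost (Add a b) s = acost a s + acost b s + size_cost (aval (Add a b) s)"
| "acost (Sub a b) s = acost a s + acost b s + size_cost (aval (Sub a b) s)"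

fun bval :: "bexp \<Rightarrow> memory \<Rightarrow> bool" where
  "bval (Lt a b) s \<longleftrightarrow> aval a s < aval b s"
| "bval (Neg b) s \<longleftrightarrow> \<not> bval b s"
| "bval (Conj b c) s \<longleftrightarrow> bval b s \<and> bval c s"

fun bcost :: "bexp \<Rightarrow> memory \<Rightarrow> nat" where
  "bcost (Lt a b) s = 1 + acost a s + acost b s"
| "bcost (Neg b) s = 1 + bcost b s"
| "bcost (Conj b c) s = 1 + bcost b s + bcost c s"

text \<open>\<open>exec c s t s'\<close>: started in memory \<open>s\<close>, the program \<open>c\<close> halts after time \<open>t\<close> in memory
  \<open>s'\<close>.\<close>

inductive exec :: "com \<Rightarrow> memory \<Rightarrow> nat \<Rightarrow> memory \<Rightarrow> bool" where
  Skip: "exec Skip s 1 s"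
| Put: "exec (Put X a b) s (1 + acost a s + acost b s)
          (s(X := (s X)(aval a s := aval b s)))"
| Seq: "exec c s t s' \<Longrightarrow> exec c' s' t' s'' \<Longrightarrow> exec (Seq c c') s (t + t') s''"
| Cond_True: "bval b s \<Longrightarrow> exec c s t s' \<Longrightarrow> exec (Cond b c c') s (1 + bcost b s + t) s'"
| Cond_False: "\<not> bval b s \<Longrightarrow> exec c' s t s' \<Longrightarrow> exec (Cond b c c') s (1 + bcost b s + t) s'"
| While_False: "\<not> bval b s \<Longrightarrow> exec (While b c) s (1 + bcost b s) s"
| While_True: "bval b s \<Longrightarrow> exec c s t s' \<Longrightarrow> exec (While b c) s' t' s'' \<Longrightarrow>
    exec (While b c) s (1 + bcost b s + t + t') s''"

section \<open>Input and output\<close>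

text \<open>The vertices are numbered \<open>0, \<dots>, n - 1\<close>; the neighbours of each may be listed in any
  order.\<close>

definition adjacency_lists :: "nat set \<Rightarrow> nat set set \<Rightarrow> nat list list \<Rightarrow> bool" where
  "adjacency_lists V E A \<longleftrightarrow> V = {..<length A} \<and>
     (\<forall>u<length A. distinct (A ! u) \<and> set (A ! u) = {v. {u, v} \<in> E})"

definition cells :: "nat list \<Rightarrow> nat \<Rightarrow> nat" where
  "cells xs i = (if i < length xs then xs ! i else 0)"

definition offset :: "nat list list \<Rightarrow> nat \<Rightarrow> nat" where
  "offset A u = length (concat (take u A))"

text \<open>The adjacency lists are stored contiguously in \<open>nbr\<close>, the list of vertex \<open>u\<close> occupying the
  cells from \<open>off[u]\<close> (inclusive) to \<open>off[u + 1]\<close> (exclusive). All other cells are 0.\<close>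

definition input_memory :: "nat list list \<Rightarrow> nat \<Rightarrow> memory" where
  "input_memory A v0 = (\<lambda>_ _. 0)
     (''n'' := cells [length A],
      ''root'' := cells [v0],
      ''off'' := cells (map (offset A) [0..<Suc (length A)]),
      ''nbr'' := cells (concat A))"

text \<open>The list \<open>xs\<close> enumerates the set \<open>S\<close> without repetition, its entries being representations
  (in the sense of \<open>R\<close>) of the elements of \<open>S\<close>.\<close>

definition enumerates :: "('b \<Rightarrow> 'c \<Rightarrow> bool) \<Rightarrow> 'b list \<Rightarrow> 'c set \<Rightarrow> bool" where
  "enumerates R xs S \<longleftrightarrow> (\<exists>ys. distinct ys \<and> set ys = S \<and> list_all2 R xs ys)"

text \<open>Each \<open>\<Theta>\<close>-class \<open>F\<close> is denoted by a number \<open>lab F\<close>, and a set of \<open>\<Theta>\<close>-classes by a list of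
  such numbers.\<close>

definition lists_classes :: "(nat set set \<Rightarrow> nat) \<Rightarrow> nat list \<Rightarrow> nat set set set \<Rightarrow> bool" where
  "lists_classes lab = enumerates (\<lambda>i F. i = lab F)"

text \<open>An output entry for the pair \<open>(L, u)\<close> consists of \<open>u\<close>, of \<open>L\<close>, and of a list of all minimal
  \<open>(L, u)\<close>-parallel POFs.\<close>

type_synonym entry = "nat \<times> nat list \<times> nat list list"

fun entry_for :: "nat set set \<Rightarrow> nat \<Rightarrow> (nat set set \<Rightarrow> nat) \<Rightarrow>
    entry \<Rightarrow> nat set set set \<times> nat \<Rightarrow> bool" where
  "entry_for E v0 lab (u', is, ms) (L, u) \<longleftrightarrow>
     u' = u \<and> lists_classes lab is L \<and>
     enumerates (lists_classes lab) ms (min_parallel E v0 L u)"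

definition encode_list :: "nat list \<Rightarrow> nat list" where
  "encode_list xs = length xs # xs"

fun encode_entry :: "entry \<Rightarrow> nat list" where
  "encode_entry (u, is, ms) = u # encode_list is @ length ms # concat (map encode_list ms)"

definition encode_output :: "entry list \<Rightarrow> nat list" where
  "encode_output es = length es # concat (map encode_entry es)"

text \<open>The memory \<open>s\<close> holds a correct output: the array \<open>cls\<close>, parallel to \<open>nbr\<close>, contains the
  numbers of the \<open>\<Theta>\<close>-classes of all edges, and \<open>out\<close> starts with the code of a list having
  exactly one entry for every pair \<open>(L, u)\<close>, where \<open>L\<close> is a POF incoming into \<open>u\<close> (including the
  pairs for which there are no minimal \<open>(L, u)\<close>-parallel POFs).\<close>

definition correct_output ::
    "nat set \<Rightarrow> nat set set \<Rightarrow> nat list list \<Rightarrow> nat \<Rightarrow> memory \<Rightarrow> bool" where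
  "correct_output V E A v0 s \<longleftrightarrow> (\<exists>lab es.
     inj_on lab (theta_classes E) \<and>
     (\<forall>u<length A. \<forall>i<length (A ! u). \<forall>F\<in>theta_classes E.
        {u, A ! u ! i} \<in> F \<longrightarrow> s ''cls'' (offset A u + i) = lab F) \<and>
     enumerates (entry_for E v0 lab) es (incoming_pairs V E v0) \<and>
     (\<forall>i<length (encode_output es). s ''out'' i = encode_output es ! i))"

end

theory Submission
  imports Defs
begin

text \<open>In a median graph the cubes correspond to the pairs of a vertex \<open>v\<close> and a set \<open>S\<close> of classes
  incoming into \<open>v\<close>. If \<open>u\<close> is the bottom vertex of such a cube, then \<open>S\<close> is a POF outgoing from
  \<open>u\<close>, and all outgoing POFs arise in this way. Now \<open>S\<close> is minimal \<open>(L, u)\<close>-parallel iff \<open>L\<close> is a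
  minimal hitting set of the sets of classes incoming into \<open>u\<close> that are not orthogonal to \<open>F\<close>, for
  \<open>F\<close> in \<open>S\<close>. So for every cube the algorithm enumerates the minimal hitting sets of this family,
  adding its members one after the other; the bound below applies to the intermediate families too.

  A branching argument with weighted elements shows that a family of \<open>k\<close> sets over at most \<open>d\<close>
  elements has at most \<open>(3 / 2) ^ k * 1.415 ^ d\<close> minimal hitting sets. As \<open>v\<close> has at most \<open>d\<close>
  incoming classes, summing over the subsets \<open>S\<close> gives \<open>n * (1.415 * (1 + 3 / 2)) ^ d\<close>, and
  \<open>1.415 * 5 / 2 = 3.5375\<close>.

  A class has a unique edge whose upper end has no other incoming class; this upper end, the gate,
  serves as a label, by which classes are compared in constant time.\<close>

section \<open>A calculus for running times\<close>

text \<open>The delicate case of the counting is an element that hits exactly two members of the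
  family. Branching on it at a price of \<open>3 / 2\<close> per member would cost a factor
  \<open>1 + 4 / 9\<close>, which exceeds 1.415. The remedy is the smaller weight 1.3 for elements
  that hit a single member: in the branch that uses the element, a second element of a member just
  hit loses weight; if there is no second one, the first is forced and nothing branches. The room
  for rounding is given by \<open>3.5394 / 2.5 = 1.41576\<close>. In the program, cubes are
  generated at their top vertex, whereas the output is grouped by the bottom vertex \<open>u\<close>
  and by \<open>L\<close>. Each solution therefore goes into a linked list attached to its pair, and
  the number of records is bounded by a sum over the cubes, not over the pairs. The preprocessing
  takes \<open>n\<close> times a power of \<open>d\<close>; since \<open>2 ^ d \<le> n\<close>, such
  powers are polylogarithmic. Tables with quadratically many cells are affordable because memory
  starts out as zero and only few cells are touched.\<close>

text \<open>Execution at unit cost. Every value written must be at most \<open>B\<close> unless its expression is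
  \<open>safe\<close>, i.e. exceeds the largest number in memory by at most one: after \<open>t\<close> steps no number is
  larger than the initial ones and \<open>B\<close> plus \<open>t\<close>, so the true cost is larger by a logarithmic factor.\<close>

fun safe :: "aexp \<Rightarrow> bool" where
  "safe (Const k) \<longleftrightarrow> k \<le> 1"
| "safe (Get X a) \<longleftrightarrow> True"
| "safe (Add (Get X a) (Const k)) \<longleftrightarrow> k \<le> 1"
| "safe (Sub (Get X a) b) \<longleftrightarrow> True"
| "safe _ \<longleftrightarrow> False"

inductive uexec :: "nat \<Rightarrow> com \<Rightarrow> memory \<Rightarrow> nat \<Rightarrow> memory \<Rightarrow> bool" for B where
  Skip: "uexec B Skip s 1 s"
| Put: "safe b \<or> aval b s \<le> B \<Longrightarrow>
    uexec B (Put X a b) s 1 (s(X := (s X)(aval a s := aval b s)))"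
| Seq: "uexec B c s t s' \<Longrightarrow> uexec B c' s' t' s'' \<Longrightarrow> uexec B (Seq c c') s (t + t') s''"
| Cond_True: "bval b s \<Longrightarrow> uexec B c s t s' \<Longrightarrow> uexec B (Cond b c c') s (1 + t) s'"
| Cond_False: "\<not> bval b s \<Longrightarrow> uexec B c' s t s' \<Longrightarrow> uexec B (Cond b c c') s (1 + t) s'"
| While_False: "\<not> bval b s \<Longrightarrow> uexec B (While b c) s 1 s"
| While_True: "bval b s \<Longrightarrow> uexec B c s t s' \<Longrightarrow> uexec B (While b c) s' t' s'' \<Longrightarrow>
    uexec B (While b c) s (1 + t + t') s''"

text \<open>Constants enter with their value, so that \<open>asize a * Suc K\<close> bounds the
  value of \<open>a\<close> over a memory bounded by \<open>K\<close>. One program size thus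
  controls both the number of operations in a step and the size of their operands.\<close>

fun asize :: "aexp \<Rightarrow> nat" where
  "asize (Const k) = Suc k"
| "asize (Get X a) = Suc (asize a)"
| "asize (Add a b) = Suc (asize a + asize b)"
| "asize (Sub a b) = Suc (asize a + asize b)"

fun bsize :: "bexp \<Rightarrow> nat" where
  "bsize (Lt a b) = Suc (asize a + asize b)"
| "bsize (Neg b) = Suc (bsize b)"
| "bsize (Conj b c) = Suc (bsize b + bsize c)"

fun csize :: "com \<Rightarrow> nat" where
  "csize Skip = 1"
| "csize (Put X a b) = Suc (asize a + asize b)"
| "csize (Seq c c') = csize c + csize c'"
| "csize (Cond b c c') = Suc (bsize b + csize c + csize c')"
| "csize (While b c) = Suc (bsize b + csize c)"

lemma size_cost_mono: "k \<le> l \<Longrightarrow> size_cost k \<le> size_cost l"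
  by (simp add: size_cost_def floorlog_mono)

lemma size_cost_pos: "0 < size_cost k"
  by (simp add: size_cost_def)

lemma aval_le:
  assumes "\<And>X i. s X i \<le> K"
  shows "aval a s \<le> asize a * Suc K"
proof (induction a)
  case (Get X a)
  have "s X (aval a s) \<le> K" by (rule assms)
  then show ?case by simp
qed (auto simp: algebra_simps)

lemma acost_le:
  assumes "\<And>X i. s X i \<le> K" and "asize a \<le> W"
  shows "acost a s \<le> asize a * size_cost (W * Suc K)"
  using assms(2)
proof (induction a)
  case (Const k)
  have "k \<le> W * Suc K"
    using Const by (simp add: trans_le_add1)
  then show ?case by (simp add: size_cost_mono trans_le_add1)
next
  case (Get X a)
  have "aval (Get X a) s \<le> W * Suc K"
    using aval_le[OF assms(1), of "Get X a"] Get.prems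
    by (meson le_trans mult_le_mono1)
  from size_cost_mono[OF this] Get show ?case by simp
next
  case (Add a b)
  have "aval (Add a b) s \<le> W * Suc K"
    using aval_le[OF assms(1), of "Add a b"] Add.prems
    by (meson le_trans mult_le_mono1)
  from size_cost_mono[OF this] Add show ?case
    by (simp add: algebra_simps)
next
  case (Sub a b)
  have "aval (Sub a b) s \<le> W * Suc K"
    using aval_le[OF assms(1), of "Sub a b"] Sub.prems
    by (meson le_trans mult_le_mono1)
  from size_cost_mono[OF this] Sub show ?case
    by (simp add: algebra_simps)
qed

lemma bcost_le:
  assumes "\<And>X i. s X i \<le> K" and "bsize b \<le> W"
  shows "bcost b s \<le> bsize b * size_cost (W * Suc K)"
  using assms(2)
proof (induction b)
  case (Lt a b)
  have "acost a s \<le> asize a * size_cost (W * Suc K)"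
    "acost b s \<le> asize b * size_cost (W * Suc K)"
    using Lt by (simp_all add: acost_le assms(1) del: mult_Suc_right)
  then show ?case using size_cost_pos[of "W * Suc K"] by (simp add: algebra_simps)
next
  case (Neg b)
  then show ?case using size_cost_pos[of "W * Suc K"] by simp
next
  case (Conj b c)
  then show ?case using size_cost_pos[of "W * Suc K"] by (simp add: algebra_simps)
qed

lemma safe_le:
  assumes "\<And>X i. s X i \<le> K" and "safe b"
  shows "aval b s \<le> Suc K"
proof -
  have "s X i \<le> Suc K" "s X i - k \<le> Suc K" for X i k
    using assms(1)[of X i] by simp_all
  moreover have "s X i + j \<le> Suc K" if "j \<le> 1" for X i j
    using assms(1)[of X i] that by simp
  moreover note assms(2)
  ultimately show ?thesis
    by (induction b rule: safe.induct) auto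
qed

text \<open>\<open>K\<close> bounds the memory at the start and grows to \<open>K + t\<close> along
  a sequence, while \<open>R\<close> bounds all memories of the run and stays fixed in the
  induction. So each of the \<open>t\<close> steps costs at most the program size times the bit
  length of \<open>W * Suc R\<close>.\<close>

lemma uexec_exec:
  assumes "uexec B c s t s'" and "\<And>X i. s X i \<le> K" and "B \<le> K"
    and "csize c \<le> W" and "K + t \<le> R"
  shows "\<exists>t'. exec c s t' s' \<and> t' \<le> t * (W * size_cost (W * Suc R)) \<and> (\<forall>X i. s' X i \<le> K + t)"
  using assms
proof (induction arbitrary: K rule: uexec.induct)
  case (Skip s)
  have "Suc 0 \<le> W * size_cost (W * Suc R)"
    using Skip size_cost_pos[of "W * Suc R"] by (simp add: Suc_leI)
  then show ?case using Skip exec.Skip[of s] by (intro exI[of _ 1]) (auto intro: le_SucI)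
next
  case (Put b s X a)
  have R: "s X i \<le> R" for X i
    using Put.prems(1)[of X i] Put.prems(4) by linarith
  have "acost a s \<le> asize a * size_cost (W * Suc R)"
    "acost b s \<le> asize b * size_cost (W * Suc R)"
    using Put.prems by (simp_all add: acost_le R del: mult_Suc_right)
  then have "1 + acost a s + acost b s \<le> csize (Put X a b) * size_cost (W * Suc R)"
    using size_cost_pos[of "W * Suc R"] by (simp add: algebra_simps)
  also have "\<dots> \<le> W * size_cost (W * Suc R)"
    using Put.prems by (intro mult_le_mono1)
  finally have le: "1 + acost a s + acost b s \<le> 1 * (W * size_cost (W * Suc R))" by simp
  have "aval b s \<le> Suc K"
    using Put safe_le[of s K b] by auto
  moreover have "s X i \<le> Suc K" for X i
    using Put.prems(1)[of X i] by simp
  ultimately have "(s(X := (s X)(aval a s := aval b s))) Y i \<le> K + 1" for Y i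
    by auto
  then show ?case using le exec.Put[of X a b s] by blast
next
  case (Seq c s t s' c' t' s'')
  from Seq.prems obtain r where r: "exec c s r s'" "r \<le> t * (W * size_cost (W * Suc R))"
    "\<And>X i. s' X i \<le> K + t"
    using Seq.IH(1)[of K] by auto
  from Seq.prems r(3) obtain r' where r': "exec c' s' r' s''"
    "r' \<le> t' * (W * size_cost (W * Suc R))" "\<And>X i. s'' X i \<le> K + t + t'"
    using Seq.IH(2)[of "K + t"] by auto
  show ?case
    using exec.Seq[OF r(1) r'(1)] r(2) r'(2,3)
    by (intro exI[of _ "r + r'"]) (auto simp: algebra_simps)
next
  case (Cond_True b s c t s' c')
  from Cond_True.prems obtain r where r: "exec c s r s'" "r \<le> t * (W * size_cost (W * Suc R))"
    "\<And>X i. s' X i \<le> K + t"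
    using Cond_True.IH[of K] by auto
  have R: "s X i \<le> R" for X i
    using Cond_True.prems(1)[of X i] Cond_True.prems(4) by linarith
  have "bcost b s \<le> bsize b * size_cost (W * Suc R)"
    using Cond_True.prems by (intro bcost_le R) auto
  then have "1 + bcost b s \<le> Suc (bsize b) * size_cost (W * Suc R)"
    using size_cost_pos[of "W * Suc R"] by simp
  also have "\<dots> \<le> W * size_cost (W * Suc R)"
    using Cond_True.prems by (intro mult_le_mono1) auto
  finally show ?case
    using exec.Cond_True[OF Cond_True.hyps(1) r(1), of c'] r(2,3)
    by (intro exI[of _ "1 + bcost b s + r"]) (auto intro: le_SucI)
next
  case (Cond_False b s c' t s' c)
  from Cond_False.prems obtain r where r: "exec c' s r s'" "r \<le> t * (W * size_cost (W * Suc R))"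
    "\<And>X i. s' X i \<le> K + t"
    using Cond_False.IH[of K] by auto
  have R: "s X i \<le> R" for X i
    using Cond_False.prems(1)[of X i] Cond_False.prems(4) by linarith
  have "bcost b s \<le> bsize b * size_cost (W * Suc R)"
    using Cond_False.prems by (intro bcost_le R) auto
  then have "1 + bcost b s \<le> Suc (bsize b) * size_cost (W * Suc R)"
    using size_cost_pos[of "W * Suc R"] by simp
  also have "\<dots> \<le> W * size_cost (W * Suc R)"
    using Cond_False.prems by (intro mult_le_mono1) auto
  finally show ?case
    using exec.Cond_False[OF Cond_False.hyps(1) r(1), of c] r(2,3)
    by (intro exI[of _ "1 + bcost b s + r"]) (auto intro: le_SucI)
next
  case (While_False b s c)
  have R: "s X i \<le> R" for X i
    using While_False.prems(1)[of X i] While_False.prems(4) by linarith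
  have "bcost b s \<le> bsize b * size_cost (W * Suc R)"
    using While_False.prems by (intro bcost_le R) auto
  then have "1 + bcost b s \<le> Suc (bsize b) * size_cost (W * Suc R)"
    using size_cost_pos[of "W * Suc R"] by simp
  also have "\<dots> \<le> W * size_cost (W * Suc R)"
    using While_False.prems by (intro mult_le_mono1) auto
  finally show ?case
    using exec.While_False[OF While_False.hyps(1), of c] While_False.prems(1)
    by (intro exI[of _ "1 + bcost b s"]) (auto intro: le_SucI)
next
  case (While_True b s c t s' t' s'')
  from While_True.prems obtain r where r: "exec c s r s'"
    "r \<le> t * (W * size_cost (W * Suc R))" "\<And>X i. s' X i \<le> K + t"
    using While_True.IH(1)[of K] by auto
  from While_True.prems r(3) obtain r' where r': "exec (While b c) s' r' s''"
    "r' \<le> t' * (W * size_cost (W * Suc R))" "\<And>X i. s'' X i \<le> K + t + t'"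
    using While_True.IH(2)[of "K + t"] by auto
  have R: "s X i \<le> R" for X i
    using While_True.prems(1)[of X i] While_True.prems(4) by linarith
  have "bcost b s \<le> bsize b * size_cost (W * Suc R)"
    using While_True.prems by (intro bcost_le R) auto
  then have "1 + bcost b s \<le> Suc (bsize b) * size_cost (W * Suc R)"
    using size_cost_pos[of "W * Suc R"] by simp
  also have "\<dots> \<le> W * size_cost (W * Suc R)"
    using While_True.prems by (intro mult_le_mono1) auto
  finally show ?case
    using exec.While_True[OF While_True.hyps(1) r(1) r'(1)] r(2) r'(2,3)
    by (intro exI[of _ "1 + bcost b s + r + r'"]) (auto simp: algebra_simps intro: le_SucI)
qed

text \<open>The postcondition sees the running time, so termination, correctness and cost are proved
  together. Asserting that some run exists is enough, as the final theorem asks for no more.\<close>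

definition wp :: "nat \<Rightarrow> com \<Rightarrow> (nat \<Rightarrow> memory \<Rightarrow> bool) \<Rightarrow> memory \<Rightarrow> bool" where
  "wp B c Q s \<longleftrightarrow> (\<exists>t s'. uexec B c s t s' \<and> Q t s')"

inductive_cases uexec_SkipE: "uexec B Skip s t s'"
inductive_cases uexec_PutE: "uexec B (Put X a b) s t s'"
inductive_cases uexec_SeqE: "uexec B (Seq c c') s t s'"
inductive_cases uexec_CondE: "uexec B (Cond b c c') s t s'"

lemma wp_Skip [simp]: "wp B Skip Q s \<longleftrightarrow> Q 1 s"
  unfolding wp_def using uexec.Skip by (auto elim: uexec_SkipE)

lemma wp_Put [simp]:
  "wp B (Put X a b) Q s \<longleftrightarrow>
     (safe b \<or> aval b s \<le> B) \<and> Q 1 (s(X := (s X)(aval a s := aval b s)))"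
proof
  assume "wp B (Put X a b) Q s"
  then show "(safe b \<or> aval b s \<le> B) \<and> Q 1 (s(X := (s X)(aval a s := aval b s)))"
    unfolding wp_def by (auto elim!: uexec_PutE)
next
  assume "(safe b \<or> aval b s \<le> B) \<and> Q 1 (s(X := (s X)(aval a s := aval b s)))"
  then show "wp B (Put X a b) Q s"
    unfolding wp_def using uexec.Put[of b s B X a] by blast
qed

lemma wp_Seq [simp]:
  "wp B (Seq c c') Q s \<longleftrightarrow> wp B c (\<lambda>t s'. wp B c' (\<lambda>t' s''. Q (t + t') s'') s') s"
  unfolding wp_def using uexec.Seq by (fast elim: uexec_SeqE)

lemma wp_Cond [simp]:
  "wp B (Cond b c c') Q s \<longleftrightarrow>
     (bval b s \<longrightarrow> wp B c (\<lambda>t. Q (1 + t)) s) \<and> (\<not> bval b s \<longrightarrow> wp B c' (\<lambda>t. Q (1 + t)) s)"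
proof
  assume "wp B (Cond b c c') Q s"
  then show "(bval b s \<longrightarrow> wp B c (\<lambda>t. Q (1 + t)) s) \<and> (\<not> bval b s \<longrightarrow> wp B c' (\<lambda>t. Q (1 + t)) s)"
    unfolding wp_def by (fastforce elim: uexec_CondE)
next
  assume "(bval b s \<longrightarrow> wp B c (\<lambda>t. Q (1 + t)) s) \<and> (\<not> bval b s \<longrightarrow> wp B c' (\<lambda>t. Q (1 + t)) s)"
  then show "wp B (Cond b c c') Q s"
    unfolding wp_def by (metis uexec.Cond_True uexec.Cond_False)
qed

section \<open>Frame conditions and loops with their cost\<close>

fun mods :: "com \<Rightarrow> string set" where
  "mods Skip = {}"
| "mods (Put X a b) = {X}"
| "mods (Seq c c') = mods c \<union> mods c'"
| "mods (Cond b c c') = mods c \<union> mods c'"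
| "mods (While b c) = mods c"

lemma uexec_frame: "uexec B c s t s' \<Longrightarrow> X \<notin> mods c \<Longrightarrow> s' X = s X"
  by (induction rule: uexec.induct) auto

text \<open>Lets every specification mention only what a program changes: arrays outside
  \<open>mods\<close> are preserved by syntactic inspection.\<close>

lemma wp_frame:
  assumes "wp B c Q0 s"
    and "\<And>t s'. Q0 t s' \<Longrightarrow> (\<And>X. X \<notin> mods c \<Longrightarrow> s' X = s X) \<Longrightarrow> Q t s'"
  shows "wp B c Q s"
  using assms uexec_frame unfolding wp_def by blast

abbreviation var :: "string \<Rightarrow> aexp" where
  "var X \<equiv> Get X (Const 0)"

abbreviation assign :: "string \<Rightarrow> aexp \<Rightarrow> com" (infix "::=" 61) where
  "X ::= a \<equiv> Put X (Const 0) a"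

abbreviation seq_syntax :: "com \<Rightarrow> com \<Rightarrow> com" (infixr ";;" 60) where
  "c ;; c' \<equiv> Seq c c'"

abbreviation ifonly :: "bexp \<Rightarrow> com \<Rightarrow> com" where
  "ifonly b c \<equiv> Cond b c Skip"

abbreviation incr :: "string \<Rightarrow> com" where
  "incr X \<equiv> X ::= Add (var X) (Const 1)"

definition For :: "string \<Rightarrow> aexp \<Rightarrow> aexp \<Rightarrow> com \<Rightarrow> com" where
  "For i lo hi c = i ::= lo ;; While (Lt (var i) hi) (c ;; incr i)"

lemma mods_For [simp]: "mods (For i lo hi c) = insert i (mods c)"
  by (auto simp: For_def)

text \<open>The second argument of the invariant is the time used so far.\<close>

lemma wp_While:
  assumes "i \<notin> mods c"
    and hi: "\<And>s'. (\<And>X. X \<notin> insert i (mods c) \<Longrightarrow> s' X = s X) \<Longrightarrow> aval hi s' = l + h"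
    and body: "\<And>k T s'. k < h \<Longrightarrow> I k T s' \<Longrightarrow> s' i 0 = l + k \<Longrightarrow>
      (\<And>X. X \<notin> insert i (mods c) \<Longrightarrow> s' X = s X) \<Longrightarrow>
      wp B c (\<lambda>t s''. I (Suc k) (T + t + 2) (s''(i := (s'' i)(0 := Suc (l + k))))) s'"
    and "k \<le> h" and "I k T s'" and "s' i 0 = l + k"
    and "\<And>X. X \<notin> insert i (mods c) \<Longrightarrow> s' X = s X"
  shows "wp B (While (Lt (var i) hi) (c ;; incr i))
    (\<lambda>t s'. s' i 0 = l + h \<and> (\<exists>T'. I h T' s' \<and> T + t = T' + 1)) s'"
  using assms(4-)
proof (induction "h - k" arbitrary: k T s')
  case 0
  have "aval hi s' = l + h" by (rule hi) (fact 0)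
  then have "\<not> bval (Lt (var i) hi) s'" using 0 by simp
  from uexec.While_False[OF this] show ?case
    unfolding wp_def using 0 by fastforce
next
  case (Suc x)
  have k: "k < h" using Suc.hyps(2) by simp
  obtain t s2 where 2: "uexec B c s' t s2"
    "I (Suc k) (T + t + 2) (s2(i := (s2 i)(0 := Suc (l + k))))"
    using body[OF k Suc.prems(2,3,4)] unfolding wp_def by blast
  have fr: "s2 X = s X" if "X \<notin> insert i (mods c)" for X
    using uexec_frame[OF 2(1)] that Suc.prems(4) by simp
  have s2i: "s2 i 0 = l + k"
    using uexec_frame[OF 2(1) assms(1)] Suc.prems by simp
  let ?s3 = "s2(i := (s2 i)(0 := Suc (l + k)))"
  have e3: "uexec B (c ;; incr i) s' (t + 1) ?s3"
    using uexec.Seq[OF 2(1) uexec.Put[of "Add (var i) (Const 1)" s2 B i "Const 0"]] s2i by simp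
  have "wp B (While (Lt (var i) hi) (c ;; incr i))
    (\<lambda>t' s'. s' i 0 = l + h \<and> (\<exists>T'. I h T' s' \<and> T + t + 2 + t' = T' + 1)) ?s3"
    using Suc.hyps(2) k 2 fr by (intro Suc.hyps(1)) auto
  then obtain t' s4 T' where 4: "uexec B (While (Lt (var i) hi) (c ;; incr i)) ?s3 t' s4"
    "s4 i 0 = l + h" "I h T' s4" "T + t + 2 + t' = T' + 1"
    unfolding wp_def by blast
  have "bval (Lt (var i) hi) s'" using hi[of s'] Suc.prems k by simp
  from uexec.While_True[OF this e3 4(1)] 4(2,3,4) show ?case
    unfolding wp_def
    by (intro exI[of _ "1 + (t + 1) + t'"] exI[of _ s4] conjI exI[of _ T']) auto
qed

text \<open>A round costs the body plus 2, for the test and the increment; the initialisation and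
  the failing last test give the other 2. Elapsed time belongs to the invariant because in
  breadth-first search the price of a round depends on the queue, not on the round number
  alone.\<close>

lemma wp_For_time:
  assumes "safe lo" and "aval lo s = l" and "i \<notin> mods c"
    and hi: "\<And>s'. (\<And>X. X \<notin> insert i (mods c) \<Longrightarrow> s' X = s X) \<Longrightarrow> aval hi s' = l + h"
    and I0: "I 0 0 (s(i := (s i)(0 := l)))"
    and body: "\<And>k T s'. k < h \<Longrightarrow> I k T s' \<Longrightarrow> s' i 0 = l + k \<Longrightarrow>
      (\<And>X. X \<notin> insert i (mods c) \<Longrightarrow> s' X = s X) \<Longrightarrow>
      wp B c (\<lambda>t s''. I (Suc k) (T + t + 2) (s''(i := (s'' i)(0 := Suc (l + k))))) s'"
    and post: "\<And>T s'. I h T s' \<Longrightarrow> s' i 0 = l + h \<Longrightarrow> (\<And>X. X \<notin> insert i (mods c) \<Longrightarrow> s' X = s X) \<Longrightarrow>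
      Q (T + 2) s'"
  shows "wp B (For i lo hi c) Q s"
proof -
  let ?s = "s(i := (s i)(0 := l))"
  have "wp B (While (Lt (var i) hi) (c ;; incr i))
    (\<lambda>t s'. s' i 0 = l + h \<and> (\<exists>T'. I h T' s' \<and> 0 + t = T' + 1)) ?s"
  proof (rule wp_While[where s = s and I = I and h = h and l = l])
    show "aval hi s' = l + h" if "\<And>X. X \<notin> insert i (mods c) \<Longrightarrow> s' X = s X" for s'
      by (rule hi) (fact that)
    show "wp B c (\<lambda>t s''. I (Suc k) (T + t + 2) (s''(i := (s'' i)(0 := Suc (l + k))))) s'"
      if "k < h" "I k T s'" "s' i 0 = l + k" "\<And>X. X \<notin> insert i (mods c) \<Longrightarrow> s' X = s X" for k T s'
      by (rule body) (fact that)+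
    show "I 0 0 ?s" by (rule I0)
  qed (use assms(3) in simp_all)
  then obtain t s' T where *: "uexec B (While (Lt (var i) hi) (c ;; incr i)) ?s t s'"
    "I h T s'" "s' i 0 = l + h" "t = T + 1"
    unfolding wp_def by auto
  have "uexec B (i ::= lo) s 1 ?s"
    using uexec.Put[of lo s B i "Const 0"] assms(1,2) by simp
  from uexec.Seq[OF this *(1)] *(4) have "wp B (For i lo hi c)
    (\<lambda>t s'. s' i 0 = l + h \<and> (\<exists>T. I h T s' \<and> t = T + 2)) s"
    unfolding wp_def For_def
    by (intro exI[of _ "1 + t"] exI[of _ s']) (simp add: *(2,3))
  then show ?thesis
  proof (rule wp_frame)
    fix t s'
    assume "s' i 0 = l + h \<and> (\<exists>T. I h T s' \<and> t = T + 2)"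
      and fr: "\<And>X. X \<notin> mods (For i lo hi c) \<Longrightarrow> s' X = s X"
    then obtain T where T: "s' i 0 = l + h" "I h T s'" "t = T + 2" by blast
    show "Q t s'" unfolding T(3) by (rule post) (use T(1,2) fr in simp_all)
  qed
qed

lemma wp_For:
  assumes "safe lo" and "aval lo s = l" and "i \<notin> mods c"
    and hi: "\<And>s'. (\<And>X. X \<notin> insert i (mods c) \<Longrightarrow> s' X = s X) \<Longrightarrow> aval hi s' = l + h"
    and I0: "I 0 (s(i := (s i)(0 := l)))"
    and body: "\<And>k s'. k < h \<Longrightarrow> I k s' \<Longrightarrow> s' i 0 = l + k \<Longrightarrow>
      (\<And>X. X \<notin> insert i (mods c) \<Longrightarrow> s' X = s X) \<Longrightarrow>
      wp B c (\<lambda>t s''. t \<le> T k \<and> I (Suc k) (s''(i := (s'' i)(0 := Suc (l + k))))) s'"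
    and post: "\<And>t s'. I h s' \<Longrightarrow> s' i 0 = l + h \<Longrightarrow> (\<And>X. X \<notin> insert i (mods c) \<Longrightarrow> s' X = s X) \<Longrightarrow>
      t \<le> 2 + (\<Sum>k<h. T k + 2) \<Longrightarrow> Q t s'"
  shows "wp B (For i lo hi c) Q s"
proof (rule wp_For_time[where I = "\<lambda>k t s. I k s \<and> t \<le> (\<Sum>j<k. T j + 2)", OF assms(1-3)])
  show "aval hi s' = l + h" if "\<And>X. X \<notin> insert i (mods c) \<Longrightarrow> s' X = s X" for s'
    by (rule hi) (fact that)
  show "I 0 (s(i := (s i)(0 := l))) \<and> 0 \<le> (\<Sum>j<0. T j + 2)" using I0 by simp
  show "Q (t + 2) s'" if "I h s' \<and> t \<le> (\<Sum>j<h. T j + 2)" "s' i 0 = l + h"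
    "\<And>X. X \<notin> insert i (mods c) \<Longrightarrow> s' X = s X" for t s'
    by (rule post) (use that(1,2) in \<open>auto intro: that(3)\<close>)
  show "wp B c (\<lambda>t s''. I (Suc k) (s''(i := (s'' i)(0 := Suc (l + k)))) \<and>
      u + t + 2 \<le> (\<Sum>j<Suc k. T j + 2)) s'"
    if "k < h" "I k s' \<and> u \<le> (\<Sum>j<k. T j + 2)" "s' i 0 = l + k"
      "\<And>X. X \<notin> insert i (mods c) \<Longrightarrow> s' X = s X" for k u s'
  proof (rule wp_frame)
    show "wp B c (\<lambda>t s''. t \<le> T k \<and> I (Suc k) (s''(i := (s'' i)(0 := Suc (l + k))))) s'"
      by (rule body) (use that(1-3) in \<open>auto intro: that(4)\<close>)
  qed (use that(2) in auto)
qed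

lemma wp_For_const:
  assumes "safe lo" and "aval lo s = l" and "i \<notin> mods c"
    and hi: "\<And>s'. (\<And>X. X \<notin> insert i (mods c) \<Longrightarrow> s' X = s X) \<Longrightarrow> aval hi s' = l + h"
    and I0: "I 0 (s(i := (s i)(0 := l)))"
    and body: "\<And>k s'. k < h \<Longrightarrow> I k s' \<Longrightarrow> s' i 0 = l + k \<Longrightarrow>
      (\<And>X. X \<notin> insert i (mods c) \<Longrightarrow> s' X = s X) \<Longrightarrow>
      wp B c (\<lambda>t s''. t \<le> T \<and> I (Suc k) (s''(i := (s'' i)(0 := Suc (l + k))))) s'"
    and post: "\<And>t s'. I h s' \<Longrightarrow> s' i 0 = l + h \<Longrightarrow> (\<And>X. X \<notin> insert i (mods c) \<Longrightarrow> s' X = s X) \<Longrightarrow>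
      t \<le> 2 + h * (T + 2) \<Longrightarrow> Q t s'"
  shows "wp B (For i lo hi c) Q s"
proof (rule wp_For[where T = "\<lambda>_. T" and I = I])
  show "aval hi s' = l + h" if "\<And>X. X \<notin> insert i (mods c) \<Longrightarrow> s' X = s X" for s'
    by (rule hi) (fact that)
  show "wp B c (\<lambda>t s''. t \<le> T \<and> I (Suc k) (s''(i := (s'' i)(0 := Suc (l + k))))) s'"
    if "k < h" "I k s'" "s' i 0 = l + k" "\<And>X. X \<notin> insert i (mods c) \<Longrightarrow> s' X = s X" for k s'
    by (rule body) (fact that)+
  show "Q t s'" if "I h s'" "s' i 0 = l + h" "\<And>X. X \<notin> insert i (mods c) \<Longrightarrow> s' X = s X"
    "t \<le> 2 + (\<Sum>k<h. T + 2)" for t s'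
    by (rule post) (use that(4) in \<open>auto intro: that\<close>)
qed (rule assms(1) assms(2) assms(3) I0)+

section \<open>Median graphs\<close>

lemma adj_rel_sym: "(u, v) \<in> adj_rel E \<Longrightarrow> (v, u) \<in> adj_rel E"
  by (simp add: adj_rel_def insert_commute)

lemma adj_rel_pow_sym: "(u, v) \<in> adj_rel E ^^ k \<Longrightarrow> (v, u) \<in> adj_rel E ^^ k"
proof (induction k arbitrary: v)
  case (Suc k)
  then obtain w where "(u, w) \<in> adj_rel E ^^ k" "(w, v) \<in> adj_rel E" by auto
  then show ?case using Suc.IH adj_rel_sym by (metis relpow_Suc_I2)
qed simp

lemma gdist_le: "(u, v) \<in> adj_rel E ^^ k \<Longrightarrow> gdist E u v \<le> k"
  unfolding gdist_def by (rule Least_le)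

lemma gdist_sym: "gdist E u v = gdist E v u"
  unfolding gdist_def using adj_rel_pow_sym by metis

locale rooted_median =
  fixes V :: "'a set" and E :: "'a set set" and v0 :: 'a
  assumes median: "median_graph V E" and root: "v0 \<in> V"
begin

abbreviation dist :: "'a \<Rightarrow> 'a \<Rightarrow> nat" where
  "dist \<equiv> gdist E"

abbreviation depth :: "'a \<Rightarrow> nat" where
  "depth \<equiv> gdist E v0"

abbreviation closer :: "'a \<Rightarrow> 'a \<Rightarrow> 'a \<Rightarrow> bool" where
  "closer z u v \<equiv> dist z u < dist z v"

lemma finite_V: "finite V"
  using median by (simp add: median_graph_def simple_graph_def)

lemma edgeD: "{u, v} \<in> E \<Longrightarrow> u \<in> V \<and> v \<in> V \<and> u \<noteq> v"
proof -
  assume "{u, v} \<in> E"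
  then have "{u, v} \<subseteq> V" "card {u, v} = 2"
    using median unfolding median_graph_def simple_graph_def by blast+
  then show ?thesis by (cases "u = v") auto
qed

lemma edge_obtain: "e \<in> E \<Longrightarrow> \<exists>u v. e = {u, v}"
proof -
  assume "e \<in> E"
  then have "card e = 2"
    using median unfolding median_graph_def simple_graph_def by blast
  then show ?thesis by (auto simp: card_2_iff)
qed

lemma dist_path:
  assumes "u \<in> V" "v \<in> V"
  shows "(u, v) \<in> adj_rel E ^^ dist u v"
proof -
  have "(u, v) \<in> (adj_rel E)\<^sup>*"
    using assms median unfolding median_graph_def connected_graph_def by blast
  then obtain k where "(u, v) \<in> adj_rel E ^^ k" by (auto dest: rtrancl_imp_relpow)
  then show ?thesis unfolding gdist_def by (rule LeastI)
qed

lemma dist_triangle: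
  assumes "u \<in> V" "v \<in> V" "w \<in> V"
  shows "dist u w \<le> dist u v + dist v w"
proof -
  have "(u, w) \<in> adj_rel E ^^ (dist u v + dist v w)"
    using dist_path[OF assms(1,2)] dist_path[OF assms(2,3)] by (auto simp: relpow_add)
  then show ?thesis by (rule gdist_le)
qed

lemma dist_0 [simp]: "dist u u = 0"
  using gdist_le[of u u 0 E] by simp

lemma dist_0_iff: "u \<in> V \<Longrightarrow> v \<in> V \<Longrightarrow> dist u v = 0 \<longleftrightarrow> u = v"
  using dist_path[of u v] by auto

lemma dist_1_iff: "u \<in> V \<Longrightarrow> v \<in> V \<Longrightarrow> dist u v = 1 \<longleftrightarrow> {u, v} \<in> E"
proof
  assume V: "u \<in> V" "v \<in> V" and "dist u v = 1"
  then show "{u, v} \<in> E" using dist_path[of u v] by (auto simp: adj_rel_def)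
next
  assume V: "u \<in> V" "v \<in> V" and e: "{u, v} \<in> E"
  have "dist u v \<le> 1" using e by (intro gdist_le) (auto simp: adj_rel_def)
  moreover have "dist u v \<noteq> 0" using e edgeD dist_0_iff V by blast
  ultimately show "dist u v = 1" by simp
qed

lemma dist_edge: "{u, v} \<in> E \<Longrightarrow> dist u v = 1"
  using edgeD dist_1_iff by blast

lemma pred:
  assumes "u \<in> V" "v \<in> V" "u \<noteq> v"
  shows "\<exists>w. {w, v} \<in> E \<and> dist u w + 1 = dist u v"
proof -
  obtain k where k: "dist u v = Suc k"
    using dist_0_iff[OF assms(1,2)] assms(3) not0_implies_Suc by blast
  then obtain w where w: "(u, w) \<in> adj_rel E ^^ k" "(w, v) \<in> adj_rel E"
    using dist_path[OF assms(1,2)] by auto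
  then have e: "{w, v} \<in> E" by (simp add: adj_rel_def)
  have "dist u w \<le> k" using w by (intro gdist_le)
  moreover have "dist u v \<le> dist u w + dist w v"
    using dist_triangle assms edgeD[OF e] by blast
  ultimately show ?thesis using e k dist_edge[OF e] by auto
qed

lemma median_unique:
  assumes "x \<in> V" "y \<in> V" "z \<in> V" "x \<noteq> y" "y \<noteq> z" "z \<noteq> x"
    and "m \<in> interval V E x y" "m \<in> interval V E y z" "m \<in> interval V E z x"
    and "m' \<in> interval V E x y" "m' \<in> interval V E y z" "m' \<in> interval V E z x"
  shows "m = m'"
proof -
  obtain a where "interval V E x y \<inter> interval V E y z \<inter> interval V E z x = {a}"
    using median assms(1-6) unfolding median_graph_def by metis
  moreover have "m \<in> interval V E x y \<inter> interval V E y z \<inter> interval V E z x"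
    "m' \<in> interval V E x y \<inter> interval V E y z \<inter> interval V E z x"
    using assms by simp_all
  ultimately show ?thesis by simp
qed

lemma median_exists:
  assumes "x \<in> V" "y \<in> V" "z \<in> V" "x \<noteq> y" "y \<noteq> z" "z \<noteq> x"
  shows "\<exists>m\<in>V. dist x m + dist m y = dist x y \<and> dist y m + dist m z = dist y z \<and>
    dist z m + dist m x = dist z x"
proof -
  obtain a where "interval V E x y \<inter> interval V E y z \<inter> interval V E z x = {a}"
    using median assms unfolding median_graph_def by metis
  then show ?thesis by (auto simp: interval_def)
qed

section \<open>Bipartiteness and the quadrangle condition\<close>

lemma bipartite:
  assumes e: "{x, y} \<in> E" and "z \<in> V"
  shows "dist z x = dist z y + 1 \<or> dist z y = dist z x + 1"
proof (cases "z = x \<or> z = y")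
  case True
  then show ?thesis using dist_edge[OF e] gdist_sym[of E x y] by auto
next
  case False
  have V: "x \<in> V" "y \<in> V" "x \<noteq> y" using edgeD[OF e] by auto
  obtain m where m: "m \<in> V" "dist x m + dist m y = dist x y" "dist y m + dist m z = dist y z"
    "dist z m + dist m x = dist z x"
    using median_exists[OF V(1,2) assms(2)] V False by metis
  \<comment> \<open>The interval of an edge consists of its two ends, so the median is one of them
    and lies on a geodesic from \<open>z\<close> to the other.\<close>
  from m(2) dist_edge[OF e] have "dist x m = 0 \<or> dist m y = 0" by arith
  then have "m = x \<or> m = y" using dist_0_iff V m(1) by blast
  then show ?thesis
    using m(2-4) dist_edge[OF e] gdist_sym[of E] by (metis add.commute)
qed

lemma closer_iff:
  assumes "{x, y} \<in> E" "z \<in> V"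
  shows "closer z x y \<longleftrightarrow> dist z y = dist z x + 1" "\<not> closer z x y \<longleftrightarrow> closer z y x"
  using bipartite[OF assms] by auto

lemma dist_2:
  assumes "{w, v} \<in> E" "{w', v} \<in> E" "w \<noteq> w'"
  shows "dist w w' = 2"
proof -
  have V: "w \<in> V" "w' \<in> V" "v \<in> V" using assms edgeD by blast+
  have "dist w w' \<le> dist w v + dist v w'" using dist_triangle V by blast
  then have "dist w w' \<le> 2" using dist_edge[OF assms(1)] dist_edge[OF assms(2)]
    by (simp add: gdist_sym[of E v])
  moreover have "dist w w' \<noteq> 0" using V assms dist_0_iff by blast
  moreover have "dist w w' \<noteq> 1"
    using bipartite[OF assms(2) V(1)] dist_edge[OF assms(1)] by auto
  ultimately show ?thesis by simp
qed

text \<open>The median of \<open>z\<close>, \<open>w\<close> and \<open>w'\<close> is equidistant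
  from \<open>w\<close> and \<open>w'\<close>, which are at distance 2 from each other; so it is
  adjacent to both.\<close>

lemma quadrangle:
  assumes "{w, v} \<in> E" "{w', v} \<in> E" "w \<noteq> w'" "z \<in> V"
    and "closer z w v" "closer z w' v"
  shows "\<exists>y. {y, w} \<in> E \<and> {y, w'} \<in> E \<and> closer z y w"
proof -
  have V: "w \<in> V" "w' \<in> V" "v \<in> V" using assms edgeD by blast+
  have eq: "dist z w = dist z w'"
    using assms closer_iff(1)[of w v z] closer_iff(1)[of w' v z] by simp
  have "w = w'" if "dist z w = 0"
    using that eq assms(4) V dist_0_iff[of z w] dist_0_iff[of z w'] by simp
  then have ne: "z \<noteq> w" "w' \<noteq> z" using assms(3) eq by auto
  then obtain m where m: "m \<in> V" "dist z m + dist m w = dist z w"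
    "dist w m + dist m w' = dist w w'" "dist w' m + dist m z = dist w' z"
    using median_exists[OF assms(4) V(1,2) ne(1) assms(3) ne(2)] by blast
  have "dist m w = dist m w'"
    using m(2,4) eq gdist_sym[of E m z] gdist_sym[of E w' m] gdist_sym[of E w' z] by linarith
  then have "dist m w = 1" "dist m w' = 1"
    using m(3) dist_2[OF assms(1-3)] gdist_sym[of E w m] by auto
  then show ?thesis using m V dist_1_iff by (intro exI[of _ m]) auto
qed

text \<open>Both vertices are medians of \<open>z\<close>, \<open>w\<close> and
  \<open>w'\<close>.\<close>

lemma quadrangle_unique:
  assumes "{y, w} \<in> E" "{y, w'} \<in> E" "{y', w} \<in> E" "{y', w'} \<in> E" "w \<noteq> w'" "z \<in> V"
    and "closer z y w" "closer z y w'" "closer z y' w" "closer z y' w'"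
  shows "y = y'"
proof -
  have V: "w \<in> V" "w' \<in> V" "y \<in> V" "y' \<in> V" using assms edgeD by blast+
  have ne: "z \<noteq> w" "z \<noteq> w'" using assms(7,8) by auto
  have 2: "dist w w' = 2" using assms dist_2[of w y w'] by (simp add: insert_commute)
  have i: "m \<in> interval V E z w \<and> m \<in> interval V E w w' \<and> m \<in> interval V E w' z"
    if "m \<in> V" "{m, w} \<in> E" "{m, w'} \<in> E" "closer z m w" "closer z m w'" for m
  proof -
    have "dist z w = dist z m + 1" "dist z w' = dist z m + 1"
      using that closer_iff(1)[of m w z] closer_iff(1)[of m w' z] assms(6) by simp_all
    then show ?thesis
      using that(1) 2 dist_edge[OF that(2)] dist_edge[OF that(3)] gdist_sym[of E w m]
        gdist_sym[of E w' m] gdist_sym[of E w' z] gdist_sym[of E m z] by (simp add: interval_def)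
  qed
  show ?thesis
    using median_unique[OF assms(6) V(1,2) ne(1) assms(5) ne(2)[symmetric]] i[of y] i[of y'] V assms
    by blast
qed

section \<open>\<open>\<Theta>\<close>-classes and halfspaces\<close>

text \<open>If the two edges were oriented oppositely as seen from \<open>z\<close>, two opposite
  corners would both be common neighbours of the other two and closer to \<open>z\<close>, against
  \<open>quadrangle_unique\<close>. Thus opposite edges cut out the same halfspaces.\<close>

lemma four_cycle_closer:
  assumes c: "four_cycle E u v y x" and z: "z \<in> V"
  shows "closer z u v \<longleftrightarrow> closer z x y"
proof -
  have *: False if "four_cycle E u v y x" "closer z u v" "closer z y x" for u v x y
  proof -
    have e: "{u, v} \<in> E" "{v, y} \<in> E" "{y, x} \<in> E" "{x, u} \<in> E" "u \<noteq> y" "v \<noteq> x"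
      using that(1) by (auto simp: four_cycle_def)
    have "closer z u x" "closer z y v"
      using bipartite[OF e(1) z] bipartite[OF e(2) z] bipartite[OF e(3) z] bipartite[OF e(4) z] that(2,3)
      by linarith+
    then have "u = y"
      using e that by (intro quadrangle_unique[of u v x y z]) (auto simp: insert_commute z)
    with e show False by simp
  qed
  have "\<not> (closer z u v \<and> closer z y x)" using *[OF c] by blast
  moreover have "four_cycle E v u x y" using c by (auto simp: four_cycle_def insert_commute)
  then have "\<not> (closer z v u \<and> closer z x y)" using * by blast
  moreover have "{u, v} \<in> E" "{x, y} \<in> E"
    using c by (auto simp: four_cycle_def insert_commute)
  ultimately show ?thesis using closer_iff(2) z by blast
qed

text \<open>All edges of a class bound the same two halfspaces. The ends of \<open>f\<close> have to
  be named by an existential, since a doubleton does not say which end corresponds to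
  \<open>u\<close>.\<close>

lemma theta0_closer:
  assumes "(e, f) \<in> (theta0 E)\<^sup>*" "e = {u, v}" "e \<in> E"
  shows "f \<in> E \<and> (\<exists>x y. f = {x, y} \<and> (\<forall>z\<in>V. closer z u v \<longleftrightarrow> closer z x y))"
  using assms(1)
proof (induction rule: rtrancl_induct)
  case base
  then show ?case using assms by auto
next
  case (step f g)
  then obtain x y where xy: "f = {x, y}" "\<And>z. z \<in> V \<Longrightarrow> closer z u v \<longleftrightarrow> closer z x y" by blast
  from step(2) obtain a b c d where abcd: "f = {a, b}" "g = {c, d}" "four_cycle E a b d c"
    by (auto simp: theta0_def)
  have g: "g \<in> E" using abcd by (auto simp: four_cycle_def insert_commute)
  have cl: "closer z a b \<longleftrightarrow> closer z c d" "closer z b a \<longleftrightarrow> closer z d c" if "z \<in> V" for z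
    using four_cycle_closer[OF abcd(3) that] four_cycle_closer[of b a c d z] abcd(3) that
    by (auto simp: four_cycle_def insert_commute)
  from xy(1) abcd(1) have "(x = a \<and> y = b) \<or> (x = b \<and> y = a)" by (auto simp: doubleton_eq_iff)
  then show ?case
  proof
    assume "x = a \<and> y = b"
    then show ?thesis using abcd(2) xy(2) cl g by (intro conjI exI[of _ c] exI[of _ d]) auto
  next
    assume "x = b \<and> y = a"
    then show ?thesis using abcd(2) xy(2) cl g by (intro conjI exI[of _ d] exI[of _ c]) auto
  qed
qed

definition cls :: "'a set \<Rightarrow> 'a set set" where
  "cls e = (theta0 E)\<^sup>* `` {e}"

lemma theta0_sym: "(e, f) \<in> theta0 E \<Longrightarrow> (f, e) \<in> theta0 E"
proof -
  assume "(e, f) \<in> theta0 E"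
  then obtain u v x y where "e = {u, v}" "f = {x, y}" "four_cycle E u v y x"
    by (auto simp: theta0_def)
  moreover from this(3) have "four_cycle E x y v u" by (auto simp: four_cycle_def insert_commute)
  ultimately show ?thesis by (auto simp: theta0_def)
qed

lemma theta_sym: "(e, f) \<in> (theta0 E)\<^sup>* \<Longrightarrow> (f, e) \<in> (theta0 E)\<^sup>*"
  using theta0_sym by (metis symI sym_rtrancl symD)

lemma theta_classes_eq: "theta_classes E = cls ` E"
  by (auto simp: theta_classes_def quotient_def cls_def)

lemma cls_self [simp]: "e \<in> cls e"
  by (simp add: cls_def)

lemma cls_eq: "f \<in> cls e \<Longrightarrow> cls f = cls e"
  unfolding cls_def using theta_sym by (auto intro: rtrancl_trans)

lemma class_eq_cls: "F \<in> theta_classes E \<Longrightarrow> e \<in> F \<Longrightarrow> F = cls e"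
  using cls_eq by (auto simp: theta_classes_eq)

lemma cls_class: "e \<in> E \<Longrightarrow> cls e \<in> theta_classes E"
  by (simp add: theta_classes_eq)

lemma class_edge:
  assumes "F \<in> theta_classes E" "e \<in> F"
  shows "e \<in> E"
proof -
  obtain f where f: "f \<in> E" "F = cls f" using assms by (auto simp: theta_classes_eq)
  then obtain u v where "f = {u, v}" using edge_obtain by blast
  then show ?thesis using theta0_closer[of f e u v] f assms by (auto simp: cls_def)
qed

lemma class_closer:
  assumes "F \<in> theta_classes E" "{u, v} \<in> F" "{x, y} \<in> F"
  shows "(\<forall>z\<in>V. closer z u v \<longleftrightarrow> closer z x y) \<or> (\<forall>z\<in>V. closer z u v \<longleftrightarrow> closer z y x)"
proof -
  have "({u, v}, {x, y}) \<in> (theta0 E)\<^sup>*"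
    using class_eq_cls[OF assms(1,2)] assms(3) by (simp add: cls_def)
  from theta0_closer[OF this refl class_edge[OF assms(1,2)]]
  obtain a b where ab: "{x, y} = {a, b}" "\<forall>z\<in>V. closer z u v \<longleftrightarrow> closer z a b" by blast
  from ab(1) have "(x = a \<and> y = b) \<or> (x = b \<and> y = a)" by (auto simp: doubleton_eq_iff)
  with ab(2) show ?thesis by blast
qed

lemma four_cycle_class:
  assumes "four_cycle E u v y x" "F \<in> theta_classes E" "{u, v} \<in> F"
  shows "{x, y} \<in> F"
proof -
  have "({u, v}, {x, y}) \<in> theta0 E" using assms(1) by (auto simp: theta0_def)
  then show ?thesis using class_eq_cls[OF assms(2,3)] by (auto simp: cls_def)
qed

lemma four_cycle_rot: "four_cycle E u v y x \<Longrightarrow> four_cycle E u x y v"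
  by (auto simp: four_cycle_def insert_commute)

text \<open>Take \<open>w\<close> itself as the test vertex: if the ends match, it lies on the side
  of \<open>v\<close> and at distance 1 from \<open>u\<close>, hence at distance 0 from
  \<open>v\<close>. With the reversed matching, \<open>u\<close> would be closer to \<open>w\<close>
  than to itself.\<close>

lemma class_neighbour_unique:
  assumes "F \<in> theta_classes E" "{u, v} \<in> F" "{u, w} \<in> F"
  shows "v = w"
proof -
  have e: "{u, v} \<in> E" "{u, w} \<in> E" using assms class_edge by blast+
  have V: "u \<in> V" "v \<in> V" "w \<in> V" using e edgeD by blast+
  have uv: "closer u u v" "closer w w u"
    using dist_edge[OF e(1)] dist_edge[OF e(2)] by (simp_all add: gdist_sym[of E w u])
  from class_closer[OF assms] show ?thesis
  proof
    assume "\<forall>z\<in>V. closer z u v \<longleftrightarrow> closer z u w"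
    then have "\<not> closer w u v" using V uv by auto
    then have "closer w v u" using closer_iff(2) e V by blast
    then have "dist w v = 0" using dist_edge[OF e(2)] by (simp add: gdist_sym[of E w u])
    then show ?thesis using dist_0_iff V by auto
  next
    assume "\<forall>z\<in>V. closer z u v \<longleftrightarrow> closer z w u"
    then have "closer u w u" using V uv by blast
    then show ?thesis by simp
  qed
qed

lemma orthogonal_sym:
  assumes "orthogonal E F F'"
  shows "orthogonal E F' F"
proof -
  obtain u v x y where "four_cycle E u v y x" "{u, v} \<in> F" "{x, y} \<in> F" "{u, x} \<in> F'" "{v, y} \<in> F'"
    using assms unfolding orthogonal_def by blast
  then show ?thesis unfolding orthogonal_def using four_cycle_rot by blast
qed

lemma orthogonal_irrefl:
  assumes "F \<in> theta_classes E"
  shows "\<not> orthogonal E F F"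
proof
  assume "orthogonal E F F"
  then obtain u v x y where "four_cycle E u v y x" "{u, v} \<in> F" "{u, x} \<in> F"
    unfolding orthogonal_def by blast
  then show False using class_neighbour_unique[OF assms, of u v x] by (auto simp: four_cycle_def)
qed

lemma four_cycle_orthogonal:
  assumes "four_cycle E u v y x" "F \<in> theta_classes E" "F' \<in> theta_classes E"
    "{u, v} \<in> F" "{u, x} \<in> F'"
  shows "orthogonal E F F'"
  using assms four_cycle_class[OF assms(1)] four_cycle_class[OF four_cycle_rot[OF assms(1)]]
  unfolding orthogonal_def by blast

text \<open>Orthogonality, witnessed by one cycle anywhere, spans a square at every vertex with
  edges of both classes. The corners of the witness represent all four intersections of halfspaces,
  so one of them lies beyond both edges at \<open>u\<close>; the quadrangle condition towards that
  corner closes the square.\<close>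

lemma orthogonal_square:
  assumes "orthogonal E F F'" "F \<in> theta_classes E" "F' \<in> theta_classes E"
    and "{u, w} \<in> F" "{u, w'} \<in> F'"
  shows "\<exists>y. four_cycle E u w y w'"
proof -
  obtain a b x y where sq: "four_cycle E a b y x" "{a, b} \<in> F" "{x, y} \<in> F" "{a, x} \<in> F'" "{b, y} \<in> F'"
    using assms(1) unfolding orthogonal_def by blast
  have e: "{u, w} \<in> E" "{u, w'} \<in> E" using assms class_edge by blast+
  have e': "{a, b} \<in> E" "{x, y} \<in> E" "{a, x} \<in> E" "{b, y} \<in> E"
    using sq by (auto simp: four_cycle_def insert_commute)
  have V: "u \<in> V" "w \<in> V" "w' \<in> V" "a \<in> V" "b \<in> V" "x \<in> V" "y \<in> V"
    using e e' edgeD by blast+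
  have ne: "w \<noteq> w'"
  proof
    assume "w = w'"
    then have "F = F'" using assms class_eq_cls by metis
    then show False using assms orthogonal_irrefl by simp
  qed
  have self: "closer p p q" "closer q q p" if "{p, q} \<in> E" for p q
    using dist_edge[OF that] by (simp_all add: gdist_sym[of E q p])
  note s = self[OF e'(1)] self[OF e'(2)] self[OF e'(3)] self[OF e'(4)]
  have h: "closer z a b \<longleftrightarrow> closer z x y" "closer z b a \<longleftrightarrow> closer z y x" if "z \<in> V" for z
    using four_cycle_closer[OF sq(1) that] closer_iff(2)[OF e'(1) that] closer_iff(2)[OF e'(2) that]
    by blast+
  have h': "closer z a x \<longleftrightarrow> closer z b y" "closer z x a \<longleftrightarrow> closer z y b" if "z \<in> V" for z
    using four_cycle_closer[OF four_cycle_rot[OF sq(1)] that] closer_iff(2)[OF e'(3) that]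
      closer_iff(2)[OF e'(4) that] by blast+
  have n: "closer z w u \<longleftrightarrow> \<not> closer z u w" "closer z w' u \<longleftrightarrow> \<not> closer z u w'" if "z \<in> V" for z
    using closer_iff(2)[OF e(1) that] closer_iff(2)[OF e(2) that] by blast+
  have "\<exists>c\<in>{a, b, x, y}. closer c w u \<and> closer c w' u"
    using class_closer[OF assms(2,4) sq(2)] class_closer[OF assms(3,5) sq(4)]
  proof (elim disjE)
    assume "\<forall>z\<in>V. closer z u w \<longleftrightarrow> closer z a b" "\<forall>z\<in>V. closer z u w' \<longleftrightarrow> closer z a x"
    then have "closer y w u \<and> closer y w' u" using n h h' s V by (metis less_asym)
    then show ?thesis by blast
  next
    assume "\<forall>z\<in>V. closer z u w \<longleftrightarrow> closer z a b" "\<forall>z\<in>V. closer z u w' \<longleftrightarrow> closer z x a"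
    then have "closer b w u \<and> closer b w' u" using n h h' s V by (metis less_asym)
    then show ?thesis by blast
  next
    assume "\<forall>z\<in>V. closer z u w \<longleftrightarrow> closer z b a" "\<forall>z\<in>V. closer z u w' \<longleftrightarrow> closer z a x"
    then have "closer x w u \<and> closer x w' u" using n h h' s V by (metis less_asym)
    then show ?thesis by blast
  next
    assume "\<forall>z\<in>V. closer z u w \<longleftrightarrow> closer z b a" "\<forall>z\<in>V. closer z u w' \<longleftrightarrow> closer z x a"
    then have "closer a w u \<and> closer a w' u" using n h h' s V by (metis less_asym)
    then show ?thesis by blast
  qed
  then obtain c where c: "c \<in> V" "closer c w u" "closer c w' u" using V by blast
  obtain y' where y': "{y', w} \<in> E" "{y', w'} \<in> E" "closer c y' w"
    using quadrangle[of w u w' c] e c ne by (auto simp: insert_commute)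
  then have "y' \<noteq> u" using c by auto
  then have "four_cycle E u w y' w'"
    using y' e ne edgeD by (auto simp: four_cycle_def insert_commute)
  then show ?thesis ..
qed

section \<open>Edges of a class directed away from the root\<close>

definition arc :: "'a set set \<Rightarrow> 'a \<Rightarrow> 'a \<Rightarrow> bool" where
  "arc F w u \<longleftrightarrow> F \<in> theta_classes E \<and> {w, u} \<in> F \<and> depth w < depth u"

lemma arcD:
  assumes "arc F w u"
  shows "F \<in> theta_classes E" "{w, u} \<in> F" "{w, u} \<in> E" "depth u = depth w + 1" "w \<in> V" "u \<in> V"
    "F = cls {w, u}"
proof -
  show 1: "F \<in> theta_classes E" "{w, u} \<in> F" using assms by (auto simp: arc_def)
  show 2: "{w, u} \<in> E" using 1 class_edge by blast
  then show "w \<in> V" "u \<in> V" using edgeD by blast+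
  show "depth u = depth w + 1" using bipartite[OF 2 root] assms by (auto simp: arc_def)
  show "F = cls {w, u}" using class_eq_cls 1 by blast
qed

lemma arc_cls: "{w, u} \<in> E \<Longrightarrow> depth w < depth u \<Longrightarrow> arc (cls {w, u}) w u"
  by (simp add: arc_def cls_class)

text \<open>Evaluating \<open>class_closer\<close> at the root rules out the reversed matching,
  because both arcs point away from the root.\<close>

lemma arc_closer:
  assumes "arc F w u" "arc F w' u'" "z \<in> V"
  shows "closer z w u \<longleftrightarrow> closer z w' u'"
  using class_closer[of F w u w' u'] assms root unfolding arc_def
  by (metis less_asym)

lemma arc_low_unique: "arc F w u \<Longrightarrow> arc F w' u \<Longrightarrow> w = w'"
  using class_neighbour_unique[of F u w w'] by (auto simp: arc_def insert_commute)

lemma arc_up_unique: "arc F w u \<Longrightarrow> arc F w u' \<Longrightarrow> u = u'"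
  using class_neighbour_unique[of F w u u'] by (auto simp: arc_def)

lemma arc_not_both: "arc F w u \<Longrightarrow> \<not> arc F u z"
  using class_neighbour_unique[of F u w z] by (auto simp: arc_def insert_commute)

definition inc :: "'a \<Rightarrow> 'a set set set" where
  "inc u = {F. \<exists>w. arc F w u}"

definition outc :: "'a \<Rightarrow> 'a set set set" where
  "outc u = {F. \<exists>w. arc F u w}"

text \<open>Depth is the distance to the root, so the fourth vertex of a square spanned by two
  incoming edges is their common lower neighbour.\<close>

lemma inc_square:
  assumes "arc F w u" "arc F' w' u" "F \<noteq> F'"
  shows "\<exists>y. arc F' y w \<and> arc F y w' \<and> four_cycle E u w y w'"
proof -
  note a = arcD[OF assms(1)] and b = arcD[OF assms(2)]
  have ne: "w \<noteq> w'" using assms(3) a b by auto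
  obtain y where y: "{y, w} \<in> E" "{y, w'} \<in> E" "closer v0 y w"
    using quadrangle[OF a(3) b(3) ne root] a(4) b(4) by auto
  have c: "four_cycle E u w y w'"
    using a b y ne edgeD[of w u] edgeD[of w' u] edgeD[of y w] edgeD[of y w']
    by (auto simp: four_cycle_def insert_commute)
  have "{y, w} \<in> F'" "{y, w'} \<in> F"
    using four_cycle_class[OF c a(1)] four_cycle_class[OF four_cycle_rot[OF c] b(1)] a(2) b(2)
    by (auto simp: insert_commute)
  then show ?thesis using y a b c by (intro exI[of _ y]) (auto simp: arc_def)
qed

lemma inc_orthogonal:
  assumes "F \<in> inc u" "F' \<in> inc u" "F \<noteq> F'"
  shows "orthogonal E F F'"
proof -
  obtain w w' where a: "arc F w u" "arc F' w' u" using assms by (auto simp: inc_def)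
  then obtain y where "four_cycle E u w y w'" using inc_square assms(3) by blast
  then show ?thesis
    using a by (intro four_cycle_orthogonal[of u w y w']) (auto simp: arc_def insert_commute)
qed

text \<open>The square at \<open>u\<close> exists by orthogonality, and opposite edges are directed
  alike, so its fourth vertex lies above \<open>w\<close> and below \<open>z\<close>.\<close>

lemma mixed_square:
  assumes "orthogonal E F F'" "arc F w u" "arc F' u z"
  shows "\<exists>y. arc F y z \<and> arc F' w y"
proof -
  note a = arcD[OF assms(2)] and b = arcD[OF assms(3)]
  obtain y where y: "four_cycle E u w y z"
    using orthogonal_square[OF assms(1) a(1) b(1), of u w z] a(2) b(2) by (auto simp: insert_commute)
  have cl: "{y, z} \<in> F" "{w, y} \<in> F'"
    using four_cycle_class[OF y a(1)] four_cycle_class[OF four_cycle_rot[OF y] b(1)] a(2) b(2)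
    by (auto simp: insert_commute)
  have "closer v0 u w \<longleftrightarrow> closer v0 z y" "closer v0 u z \<longleftrightarrow> closer v0 w y"
    using four_cycle_closer[OF y root] four_cycle_closer[OF four_cycle_rot[OF y] root] by auto
  moreover have "{y, z} \<in> E" "{w, y} \<in> E" using y by (auto simp: four_cycle_def insert_commute)
  ultimately have "depth y < depth z" "depth w < depth y"
    using a(4) b(4) bipartite[OF _ root, of y z] by auto
  then show ?thesis using a b cl by (auto simp: arc_def)
qed

lemma out_square:
  assumes "orthogonal E F F'" "arc F u w" "arc F' u z"
  shows "\<exists>y. arc F z y \<and> arc F' w y"
proof -
  note a = arcD[OF assms(2)] and b = arcD[OF assms(3)]
  obtain y where y: "four_cycle E u w y z"
    using orthogonal_square[OF assms(1) a(1) b(1), of u w z] a(2) b(2) by (auto simp: insert_commute)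
  have cl: "{z, y} \<in> F" "{w, y} \<in> F'"
    using four_cycle_class[OF y a(1)] four_cycle_class[OF four_cycle_rot[OF y] b(1)] a(2) b(2)
    by (auto simp: insert_commute)
  have "closer v0 u w \<longleftrightarrow> closer v0 z y" "closer v0 u z \<longleftrightarrow> closer v0 w y"
    using four_cycle_closer[OF y root] four_cycle_closer[OF four_cycle_rot[OF y] root] by auto
  then show ?thesis using a b cl by (auto simp: arc_def)
qed

text \<open>The converse of \<open>mixed_square\<close>: it suffices to look for an edge of the class at the upper end.\<close>

lemma square_orthogonal:
  assumes "F \<noteq> F'" "arc F' u z" "F \<in> inc u"
  shows "orthogonal E F F' \<longleftrightarrow> F \<in> inc z"
proof
  assume "F \<in> inc z"
  moreover have "F' \<in> inc z" using assms by (auto simp: inc_def)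
  ultimately show "orthogonal E F F'" using assms(1) inc_orthogonal by blast
next
  assume "orthogonal E F F'"
  moreover obtain w where "arc F w u" using assms(3) by (auto simp: inc_def)
  ultimately show "F \<in> inc z" using mixed_square assms(2) unfolding inc_def by blast
qed

end

text \<open>Minimality under inclusion in local form: each element has a private member, hit by no
  other element of \<open>L\<close>. This form passes to \<open>L - {x}\<close> with the members not
  hit by \<open>x\<close>, and it is what the program tests.\<close>

definition minimal_hitting :: "('b \<Rightarrow> 'c \<Rightarrow> bool) \<Rightarrow> 'c set \<Rightarrow> 'b set \<Rightarrow> bool" where
  "minimal_hitting R J L \<longleftrightarrow> (\<forall>f\<in>J. \<exists>x\<in>L. R x f) \<and>
     (\<forall>x\<in>L. \<exists>f\<in>J. R x f \<and> (\<forall>x'\<in>L. R x' f \<longrightarrow> x' = x))"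

lemma minimal_hitting_alt:
  "minimal_hitting R J L \<longleftrightarrow>
    (\<forall>f\<in>J. \<exists>x\<in>L. R x f) \<and> (\<forall>x\<in>L. \<exists>f\<in>J. \<forall>x'\<in>L. R x' f \<longrightarrow> x' = x)"
proof -
  have "R x f \<and> (\<forall>x'\<in>L. R x' f \<longrightarrow> x' = x) \<longleftrightarrow> (\<forall>x'\<in>L. R x' f \<longrightarrow> x' = x)"
    if hit: "\<forall>f\<in>J. \<exists>x\<in>L. R x f" and f: "f \<in> J" for x f
  proof -
    obtain y where "y \<in> L" "R y f" using hit f by blast
    then show ?thesis by blast
  qed
  then show ?thesis unfolding minimal_hitting_def by (auto cong: conj_cong bex_cong)
qed

context rooted_median
begin

section \<open>Cubes\<close>

text \<open>The descent through a cube from its top. With the order of the classes fixed, the end is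
  determined by the start; that the order does not matter follows later by exchanging
  squares.\<close>

fun down :: "'a \<Rightarrow> 'a set set list \<Rightarrow> 'a \<Rightarrow> bool" where
  "down v [] u \<longleftrightarrow> v = u"
| "down v (F # Fs) u \<longleftrightarrow> (\<exists>w. arc F w v \<and> down w Fs u)"

lemma down_append: "down v (Fs @ Gs) u \<longleftrightarrow> (\<exists>w. down v Fs w \<and> down w Gs u)"
  by (induction Fs arbitrary: v) auto

lemma down_unique: "down v Fs u \<Longrightarrow> down v Fs u' \<Longrightarrow> u = u'"
proof (induction Fs arbitrary: v)
  case (Cons F Fs)
  then show ?case using arc_low_unique by auto blast
qed simp

lemma down_top_unique: "down v Fs u \<Longrightarrow> down v' Fs u \<Longrightarrow> v = v'"
proof (induction Fs arbitrary: v v')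
  case (Cons F Fs)
  then obtain w w' where "arc F w v" "down w Fs u" "arc F w' v'" "down w' Fs u" by auto
  moreover from this Cons.IH have "w = w'" by blast
  ultimately show ?case using arc_up_unique by blast
qed simp

lemma down_V: "down v Fs u \<Longrightarrow> v \<in> V \<Longrightarrow> u \<in> V"
proof (induction Fs arbitrary: v)
  case (Cons F Fs)
  then show ?case using arcD(5) by auto
qed simp

lemma inc_down:
  assumes "arc F w v" "F' \<in> inc v" "F \<noteq> F'"
  shows "F' \<in> inc w"
proof -
  obtain w' where "arc F' w' v" using assms(2) by (auto simp: inc_def)
  then obtain y where "arc F' y w" using inc_square[OF assms(1)] assms(3) by blast
  then show ?thesis by (auto simp: inc_def)
qed

lemma down_exists:
  "distinct Fs \<Longrightarrow> set Fs \<subseteq> inc v \<Longrightarrow> \<exists>u. down v Fs u"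
proof (induction Fs arbitrary: v)
  case Nil
  show ?case by (rule exI[of _ v]) simp
next
  case (Cons F Fs)
  then obtain w where w: "arc F w v" by (auto simp: inc_def)
  have "set Fs \<subseteq> inc w" using inc_down[OF w] Cons.prems by fastforce
  then obtain u where "down w Fs u" using Cons.IH[OF _ \<open>set Fs \<subseteq> inc w\<close>] Cons.prems(1) by auto
  then show ?case using w by auto
qed

lemma inc_down_list:
  "distinct (F # Fs) \<Longrightarrow> set (F # Fs) \<subseteq> inc v \<Longrightarrow> down v Fs u \<Longrightarrow> F \<in> inc u"
proof (induction Fs arbitrary: v)
  case (Cons G Fs)
  then obtain w where w: "arc G w v" "down w Fs u" by auto
  have "set (F # Fs) \<subseteq> inc w" using inc_down[OF w(1)] Cons.prems by fastforce
  then show ?case using Cons.IH[of w] Cons.prems w by auto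
qed simp

text \<open>The arc of \<open>F\<close> slides along the descent through a ladder of squares, one
  for each class of \<open>Fs\<close>.\<close>

lemma down_shift:
  "arc F w v \<Longrightarrow> down w Fs u \<Longrightarrow> distinct (F # Fs) \<Longrightarrow> set Fs \<subseteq> inc v \<Longrightarrow>
    \<exists>v'. arc F u v' \<and> down v Fs v'"
proof (induction Fs arbitrary: v w)
  case (Cons G Fs)
  then obtain x where x: "arc G x w" "down x Fs u" by auto
  obtain v2 where v2: "arc G v2 v" using Cons.prems by (auto simp: inc_def)
  have "F \<noteq> G" using Cons.prems by auto
  then obtain y where y: "arc G y w" "arc F y v2" using inc_square[OF Cons.prems(1) v2] by blast
  have "y = x" using arc_low_unique y(1) x(1) by blast
  moreover have "set Fs \<subseteq> inc v2" using inc_down[OF v2] Cons.prems by fastforce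
  ultimately obtain v' where "arc F u v'" "down v2 Fs v'"
    using Cons.IH[of x v2] x y(2) Cons.prems by auto
  then show ?case using v2 by auto
qed auto

lemma down_out:
  "down v Fs u \<Longrightarrow> distinct Fs \<Longrightarrow> set Fs \<subseteq> inc v \<Longrightarrow> set Fs \<subseteq> outc u"
proof (induction Fs arbitrary: v)
  case (Cons F Fs)
  then obtain w where w: "arc F w v" "down w Fs u" by auto
  have "set Fs \<subseteq> inc w" using inc_down[OF w(1)] Cons.prems by fastforce
  then have "set Fs \<subseteq> outc u" using Cons w by auto
  moreover have "F \<in> outc u"
    using down_shift[OF w] Cons.prems by (auto simp: outc_def)
  ultimately show ?case by simp
qed simp

lemma out_up:
  "down v Fs u \<Longrightarrow> F \<in> outc u \<Longrightarrow> \<forall>G\<in>set Fs. orthogonal E F G \<Longrightarrow> F \<in> outc v"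
proof (induction Fs arbitrary: v)
  case (Cons G Fs)
  then obtain w where w: "arc G w v" "down w Fs u" by auto
  then obtain x where "arc F w x" using Cons by (auto simp: outc_def)
  then obtain y where "arc F v y" using out_square[of F G w x v] w Cons.prems by auto
  then show ?case by (auto simp: outc_def)
qed simp

text \<open>The cube is built upwards, one class at a time: by \<open>out_up\<close> the class
  \<open>F\<close> still leaves the top of the smaller cube, and \<open>mixed_square\<close> lifts
  the incoming classes of that top to the upper end of its arc.\<close>

lemma cube_top:
  "distinct Fs \<Longrightarrow> set Fs \<subseteq> outc u \<Longrightarrow> pairwise (orthogonal E) (set Fs) \<Longrightarrow> u \<in> V \<Longrightarrow>
    \<exists>v\<in>V. set Fs \<subseteq> inc v \<and> down v Fs u"
proof (induction Fs)
  case (Cons F Fs)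
  then obtain w where w: "w \<in> V" "set Fs \<subseteq> inc w" "down w Fs u"
    by (auto simp: pairwise_insert)
  have orth: "orthogonal E F G" "orthogonal E G F" if "G \<in> set Fs" for G
    using that Cons.prems by (auto simp: pairwise_insert)
  have "F \<in> outc w" using out_up[OF w(3)] Cons.prems orth by auto
  then obtain v where v: "arc F w v" by (auto simp: outc_def)
  have "G \<in> inc v" if "G \<in> set Fs" for G
  proof -
    have "G \<in> inc w" using w(2) that by blast
    then obtain x where "arc G x w" unfolding inc_def by blast
    then show ?thesis using mixed_square[OF orth(2)[OF that] _ v] by (auto simp: inc_def)
  qed
  moreover have "F \<in> inc v" using v by (auto simp: inc_def)
  ultimately show ?case using v w arcD(6)[OF v] by auto
qed auto

section \<open>Indegrees and the dimension\<close>

lemma inc_classes: "inc v \<subseteq> theta_classes E"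
  by (auto simp: inc_def arc_def)

lemma outc_classes: "outc v \<subseteq> theta_classes E"
  by (auto simp: outc_def arc_def)

lemma finite_inc: "finite (inc v)"
proof -
  have "inc v \<subseteq> (\<lambda>w. cls {w, v}) ` V"
    using arcD(5,7) unfolding inc_def by blast
  then show ?thesis using finite_V finite_subset by blast
qed

lemma finite_outc: "finite (outc v)"
proof -
  have "outc v \<subseteq> (\<lambda>w. cls {v, w}) ` V"
    using arcD(6,7) unfolding outc_def by blast
  then show ?thesis using finite_V finite_subset by blast
qed

text \<open>The incoming classes of \<open>v\<close> span a cube below \<open>v\<close>: a set
  \<open>S\<close> of them is sent to the end of the descent that crosses exactly the classes in
  \<open>S\<close>. There these classes are outgoing and the others incoming, which makes the map
  injective.\<close>

lemma induced_cube_inc: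
  assumes v: "v \<in> V"
  shows "induced_cube V E (card (inc v))"
proof -
  obtain Fs where Fs: "set Fs = inc v" "distinct Fs"
    using finite_distinct_list[OF finite_inc] by blast
  define k where "k = length Fs"
  have k: "k = card (inc v)" using Fs distinct_card k_def by metis
  define sel where "sel S I = map ((!) Fs) (filter (\<lambda>i. i \<in> S) I)" for S I
  have sel: "distinct (sel S [0..<k])" "set (sel S [0..<k]) \<subseteq> inc v" for S
  proof -
    show "distinct (sel S [0..<k])"
      unfolding sel_def distinct_map inj_on_def k_def using Fs(2) by (simp add: nth_eq_iff_index_eq)
    show "set (sel S [0..<k]) \<subseteq> inc v"
      unfolding sel_def k_def Fs(1)[symmetric] by auto
  qed
  define f where "f S = (SOME u. down v (sel S [0..<k]) u)" for S
  have f: "down v (sel S [0..<k]) (f S)" for S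
    unfolding f_def using down_exists[OF sel] by (rule someI_ex)
  have fV: "f S \<in> V" for S using down_V[OF f v] .
  have out: "Fs ! i \<in> outc (f S)" if "i < k" "i \<in> S" for i S
  proof -
    have "Fs ! i \<in> set (sel S [0..<k])" using that by (auto simp: sel_def)
    then show ?thesis using down_out[OF f sel] by blast
  qed
  have inn: "Fs ! i \<in> inc (f S)" if "i < k" "i \<notin> S" for i S
  proof (rule inc_down_list[OF _ _ f])
    have "Fs ! i \<notin> set (sel S [0..<k])"
      using that Fs by (auto simp: sel_def nth_eq_iff_index_eq k_def)
    then show "distinct (Fs ! i # sel S [0..<k])" using sel by simp
    show "set (Fs ! i # sel S [0..<k]) \<subseteq> inc v" using sel that Fs by (auto simp: k_def)
  qed
  have not_both: "\<not> (F \<in> outc x \<and> F \<in> inc x)" for F x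
    using arc_not_both by (auto simp: inc_def outc_def)
  have inj: "S = T" if "f S = f T" "S \<subseteq> {..<k}" "T \<subseteq> {..<k}" for S T
  proof (rule ccontr)
    assume "S \<noteq> T"
    then obtain i where i: "i < k" "(i \<in> S \<and> i \<notin> T) \<or> (i \<in> T \<and> i \<notin> S)"
      using \<open>S \<subseteq> {..<k}\<close> \<open>T \<subseteq> {..<k}\<close> by blast
    then show False
      using out[of i S] out[of i T] inn[of i S] inn[of i T] not_both \<open>f S = f T\<close> by metis
  qed
  \<comment> \<open>The two descents agree up to position \<open>i\<close>; there one of them
    crosses a further class, and \<open>down_shift\<close> carries its arc along the common rest to
    the bottom.\<close>
  have step: "{f S, f T} \<in> E" if "T = insert i S" "i \<notin> S" "i < k" for S T i
  proof -
    have split: "[0..<k] = [0..<i] @ i # [Suc i..<k]"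
      using \<open>i < k\<close> upt_add_eq_append[of 0 i "k - i"] upt_conv_Cons[of i k] by simp
    have eq: "sel S [0..<i] = sel T [0..<i]" "sel S [Suc i..<k] = sel T [Suc i..<k]"
      unfolding sel_def using that by (auto intro!: arg_cong[of _ _ "map ((!) Fs)"] filter_cong)
    have T: "sel T [0..<k] = sel T [0..<i] @ Fs ! i # sel T [Suc i..<k]"
      unfolding split using that by (simp add: sel_def)
    have S: "sel S [0..<k] = sel T [0..<i] @ sel T [Suc i..<k]"
      unfolding split using that eq by (simp add: sel_def)
    from f[of T] obtain a w where a: "down v (sel T [0..<i]) a" "arc (Fs ! i) w a"
      "down w (sel T [Suc i..<k]) (f T)"
      unfolding T down_append by auto
    have "set (sel T [Suc i..<k]) \<subseteq> inc a"
    proof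
      fix G assume G: "G \<in> set (sel T [Suc i..<k])"
      show "G \<in> inc a"
      proof (rule inc_down_list[OF _ _ a(1)])
        show "distinct (G # sel T [0..<i])" using G sel(1)[of T] unfolding T by auto
        show "set (G # sel T [0..<i]) \<subseteq> inc v" using G sel(2)[of T] unfolding T by auto
      qed
    qed
    then obtain v' where v': "arc (Fs ! i) (f T) v'" "down a (sel T [Suc i..<k]) v'"
      using down_shift[OF a(2,3)] sel(1)[of T] unfolding T by auto
    then have "down v (sel S [0..<k]) v'" unfolding S down_append using a by blast
    then have "v' = f S" using down_unique f by blast
    then show ?thesis using arcD(3)[OF v'(1)] by (simp add: insert_commute)
  qed
  \<comment> \<open>Every class on which two sets differ is the class of the edge between their
    images, so adjacent images differ in one class only.\<close>
  have diff: "Fs ! i = cls {f S, f T}"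
    if e: "{f S, f T} \<in> E" and i: "i < k" "i \<in> S" "i \<notin> T" for S T i
  proof -
    obtain p q where p: "arc (Fs ! i) (f S) p" and q: "arc (Fs ! i) q (f T)"
      using out[of i S] inn[of i T] i by (auto simp: inc_def outc_def)
    have "\<not> closer (f T) q (f T)" by simp
    then have "\<not> closer (f T) (f S) p" using arc_closer[OF p q fV] by blast
    then have "closer (f T) p (f S)" using closer_iff(2)[OF arcD(3)[OF p] fV] by blast
    then have "dist (f T) p = 0" using dist_edge[OF e] by (simp add: gdist_sym[of E "f T" "f S"])
    then have "p = f T" using dist_0_iff fV arcD(6)[OF p] by blast
    then show ?thesis using arcD(7)[OF p] by simp
  qed
  have iff: "{f S, f T} \<in> E \<longleftrightarrow> card ((S - T) \<union> (T - S)) = 1"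
    if "S \<subseteq> {..<k}" "T \<subseteq> {..<k}" for S T
  proof
    assume e: "{f S, f T} \<in> E"
    have "f S \<noteq> f T" using e edgeD by blast
    then have "S \<noteq> T" by auto
    then obtain i where i: "i \<in> (S - T) \<union> (T - S)" by blast
    have "j = i" if "j \<in> (S - T) \<union> (T - S)" for j
    proof -
      have "Fs ! j = cls {f S, f T}" if "j \<in> (S - T) \<union> (T - S)" for j
        using that diff[of S T j] diff[of T S j] e \<open>S \<subseteq> {..<k}\<close> \<open>T \<subseteq> {..<k}\<close>
        by (auto simp: insert_commute)
      from this[OF i] this[OF that] have "Fs ! j = Fs ! i" by simp
      moreover have "j < length Fs" "i < length Fs"
        using i that \<open>S \<subseteq> {..<k}\<close> \<open>T \<subseteq> {..<k}\<close> by (auto simp: k_def)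
      ultimately show ?thesis using Fs(2) by (simp add: nth_eq_iff_index_eq)
    qed
    then have "(S - T) \<union> (T - S) = {i}" using i by blast
    then show "card ((S - T) \<union> (T - S)) = 1" by simp
  next
    assume "card ((S - T) \<union> (T - S)) = 1"
    then obtain i where i: "(S - T) \<union> (T - S) = {i}" by (auto simp: card_1_singleton_iff)
    then have *: "(j \<in> S \<and> j \<notin> T) \<or> (j \<in> T \<and> j \<notin> S) \<longleftrightarrow> j = i" for j
      unfolding set_eq_iff by auto
    have "(T = insert i S \<and> i \<notin> S) \<or> (S = insert i T \<and> i \<notin> T)"
    proof (cases "i \<in> S")
      case True
      then have "S = insert i T" using * by (intro set_eqI) (metis insert_iff)
      then show ?thesis using True *[of i] by simp
    next
      case False
      then have "T = insert i S" using * by (intro set_eqI) (metis insert_iff)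
      then show ?thesis using False by simp
    qed
    moreover have "i < k" using i that by blast
    ultimately show "{f S, f T} \<in> E" using step[of T i S] step[of S i T] by (auto simp: insert_commute)
  qed
  show ?thesis unfolding induced_cube_def k[symmetric]
    using inj fV iff by (intro exI[of _ f]) (auto simp: inj_on_def)
qed

lemma induced_cube_le: "induced_cube V E k \<Longrightarrow> 2 ^ k \<le> card V"
proof -
  assume "induced_cube V E k"
  then obtain f :: "nat set \<Rightarrow> 'a" where "inj_on f (Pow {..<k})" "f ` Pow {..<k} \<subseteq> V"
    unfolding induced_cube_def by blast
  then have "card (Pow {..<k}) \<le> card V" using card_inj_on_le finite_V by blast
  then show ?thesis by (simp add: card_Pow)
qed

lemma finite_cubes: "finite {k. induced_cube V E k}"
proof (rule finite_subset)
  show "{k. induced_cube V E k} \<subseteq> {..card V}"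
    using induced_cube_le less_exp le_trans less_imp_le_nat by blast
qed simp

lemma card_inc_le: "v \<in> V \<Longrightarrow> card (inc v) \<le> dimension V E"
  unfolding dimension_def using induced_cube_inc finite_cubes by (intro Max_ge) auto

lemma two_power_dimension: "2 ^ dimension V E \<le> card V"
proof -
  have "dimension V E \<in> {k. induced_cube V E k}"
    unfolding dimension_def using induced_cube_inc[OF root] finite_cubes by (intro Max_in) auto
  then show ?thesis using induced_cube_le by blast
qed

section \<open>Labels of the classes\<close>

text \<open>The depth condition puts \<open>m\<close> on a geodesic from the root to
  \<open>g\<close>. The last edge of a geodesic from \<open>m\<close> to \<open>g\<close> is then an
  arc into \<open>g\<close>, and there is only one such arc.\<close>

lemma sole_in_neighbour:
  assumes inc: "inc g = {F}" and p: "arc F p g" and m: "m \<in> V" "m \<noteq> g"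
    and depth: "depth m + dist m g = depth g"
  shows "dist m p + 1 = dist m g"
proof -
  have g: "g \<in> V" using arcD[OF p] by simp
  obtain w where w: "{w, g} \<in> E" "dist m w + 1 = dist m g" using pred[OF m(1) g m(2)] by blast
  have "depth w \<le> depth m + dist m w"
    using dist_triangle root m edgeD[OF w(1)] by blast
  then have "depth w < depth g" using w depth by simp
  then have a: "arc (cls {w, g}) w g" using arc_cls w by blast
  then have "cls {w, g} = F" using inc by (auto simp: inc_def)
  then have "w = p" using a p arc_low_unique by metis
  then show ?thesis using w by simp
qed

text \<open>Let \<open>m\<close> be the median of the root and the two candidates. If it differed
  from \<open>g\<close>, a geodesic from \<open>g'\<close> through \<open>m\<close> would enter
  \<open>g\<close> from below across \<open>F\<close>; then \<open>g'\<close> would lie on the lower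
  side of \<open>F\<close>, although it is an upper end itself. By symmetry both candidates equal
  \<open>m\<close>.\<close>

lemma gate_unique:
  assumes "inc g = {F}" "inc g' = {F}"
  shows "g = g'"
proof (rule ccontr)
  assume ne: "g \<noteq> g'"
  have "F \<in> inc g" "F \<in> inc g'" using assms by simp_all
  then obtain p p' where p: "arc F p g" "arc F p' g'" unfolding inc_def by blast
  have V: "g \<in> V" "g' \<in> V" "p \<in> V" "p' \<in> V" using arcD p by blast+
  have "v0 \<noteq> g" "g' \<noteq> v0" using arcD(4) p by fastforce+
  then obtain m where m: "m \<in> V" "depth m + dist m g = depth g" "dist g m + dist m g' = dist g g'"
    "dist g' m + dist m v0 = dist g' v0"
    using median_exists[OF root V(1,2)] ne by blast
  have m': "depth m + dist m g' = depth g'"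
    using m(4) gdist_sym[of E g' m] gdist_sym[of E m v0] gdist_sym[of E g' v0] by linarith
  have "m = g"
  proof (rule ccontr)
    assume "m \<noteq> g"
    from sole_in_neighbour[OF assms(1) p(1) m(1) this m(2)]
    have "dist m p + 1 = dist m g" .
    moreover have "dist g' p \<le> dist g' m + dist m p" using dist_triangle V m by blast
    ultimately have "closer g' p g"
      using m(3) gdist_sym[of E g' g] gdist_sym[of E g' m] gdist_sym[of E g m] by linarith
    then have "closer g' p' g'" using arc_closer p V by blast
    then show False by simp
  qed
  moreover have "m = g'"
  proof (rule ccontr)
    assume "m \<noteq> g'"
    from sole_in_neighbour[OF assms(2) p(2) m(1) this m']
    have "dist m p' + 1 = dist m g'" .
    moreover have "dist g p' \<le> dist g m + dist m p'" using dist_triangle V m by blast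
    ultimately have "closer g p' g'" using m(3) by linarith
    then have "closer g p g" using arc_closer p V by blast
    then show False by simp
  qed
  ultimately show False using ne by simp
qed

text \<open>As long as another class comes in, moving down along it keeps \<open>F\<close> incoming
  by \<open>inc_square\<close> and decreases the depth.\<close>

lemma gate_exists:
  assumes "arc F w v"
  shows "\<exists>g\<in>V. inc g = {F}"
  using assms
proof (induction "depth v" arbitrary: v w rule: less_induct)
  case less
  show ?case
  proof (cases "inc v = {F}")
    case True
    then show ?thesis using arcD(6)[OF less.prems] by blast
  next
    case False
    moreover have "F \<in> inc v" using less.prems by (auto simp: inc_def)
    ultimately obtain F' where "F' \<in> inc v" "F' \<noteq> F" by blast
    then obtain w' where w': "arc F' w' v" "F \<noteq> F'" by (auto simp: inc_def)
    then obtain y where "arc F y w'" using inc_square[OF less.prems] by blast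
    then show ?thesis using less.hyps[of w' y] arcD(4)[OF w'(1)] by simp
  qed
qed

definition gate :: "'a set set \<Rightarrow> 'a" where
  "gate F = (THE g. inc g = {F})"

lemma gate_eq: "inc g = {F} \<Longrightarrow> gate F = g"
  unfolding gate_def by (rule the_equality) (simp_all add: gate_unique)

lemma class_arc:
  assumes "F \<in> theta_classes E"
  shows "\<exists>w v. arc F w v"
proof -
  obtain e where e: "e \<in> E" "F = cls e" using assms by (auto simp: theta_classes_eq)
  then obtain u v where uv: "e = {u, v}" using edge_obtain by blast
  then have "depth u < depth v \<or> depth v < depth u"
    using bipartite[of u v v0] e root by auto
  then show ?thesis using arc_cls[of u v] arc_cls[of v u] e uv by (auto simp: insert_commute)
qed

lemma gate_inc:
  assumes "F \<in> theta_classes E"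
  shows "inc (gate F) = {F}" "gate F \<in> V"
proof -
  obtain g where "g \<in> V" "inc g = {F}" using class_arc[OF assms] gate_exists by blast
  then show "inc (gate F) = {F}" "gate F \<in> V" using gate_eq by simp_all
qed

lemma inj_gate: "inj_on gate (theta_classes E)"
proof (rule inj_onI)
  fix F F' assume "F \<in> theta_classes E" "F' \<in> theta_classes E" "gate F = gate F'"
  then have "{F} = {F'}" using gate_inc(1) by metis
  then show "F = F'" by simp
qed

section \<open>Minimal parallel POFs as minimal hitting sets\<close>

text \<open>Classes incoming into a common vertex are pairwise orthogonal, hence every set of them
  is a POF.\<close>

lemma incoming_pairs_eq: "incoming_pairs V E v0 = {(L, u). u \<in> V \<and> L \<subseteq> inc u}"
proof -
  have "pof E L \<and> incoming E v0 L u \<longleftrightarrow> L \<subseteq> inc u" for L u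
  proof
    assume "pof E L \<and> incoming E v0 L u"
    then show "L \<subseteq> inc u" by (auto simp: pof_def incoming_def inc_def arc_def)
  next
    assume L: "L \<subseteq> inc u"
    have "pairwise (orthogonal E) L"
      using L inc_orthogonal unfolding pairwise_def by blast
    moreover have "incoming E v0 L u"
      using L by (auto simp: incoming_def inc_def arc_def)
    ultimately show "pof E L \<and> incoming E v0 L u"
      using L inc_classes by (auto simp: pof_def)
  qed
  then show ?thesis by (auto simp: incoming_pairs_def)
qed

lemma outgoing_iff: "M \<subseteq> theta_classes E \<Longrightarrow> outgoing E v0 M u \<longleftrightarrow> M \<subseteq> outc u"
  by (auto simp: outgoing_def outc_def arc_def)

lemma parallel_at_iff:
  assumes L: "L \<subseteq> inc u" and M: "M \<subseteq> outc u"
  shows "parallel_at E v0 L u M \<longleftrightarrow> (\<forall>F\<in>M. \<exists>X\<in>L. \<not> orthogonal E X F)"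
proof -
  have "pof E (L \<union> {F}) \<longleftrightarrow> (\<forall>X\<in>L. orthogonal E X F)" if "F \<in> M" for F
  proof -
    have "pairwise (orthogonal E) L" using L inc_orthogonal unfolding pairwise_def by blast
    moreover have "F \<notin> L" using that L M arc_not_both by (fastforce simp: inc_def outc_def)
    moreover have "L \<union> {F} \<subseteq> theta_classes E" using that L M inc_classes outc_classes by blast
    ultimately show ?thesis
      unfolding pof_def using orthogonal_sym[of F] orthogonal_sym[of _ F]
      by (auto simp: pairwise_insert)
  qed
  moreover have "outgoing E v0 M u" using M outgoing_iff outc_classes by blast
  ultimately show ?thesis unfolding parallel_at_def parallel_def by blast
qed

text \<open>Being parallel is monotone in \<open>L\<close>, so it suffices to rule out the subsets
  obtained by removing one element \<open>x\<close>; that this removal fails means that some class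
  of \<open>M\<close> is hit by no element of \<open>L\<close> other than \<open>x\<close>.\<close>

lemma min_parallel_eq:
  assumes L: "L \<subseteq> inc u"
  shows "min_parallel E v0 L u = {M. M \<subseteq> outc u \<and> pairwise (orthogonal E) M \<and>
    minimal_hitting (\<lambda>X F. \<not> orthogonal E X F) M L}"
proof -
  have *: "(parallel_at E v0 L u M \<and> (\<forall>L'. L' \<subset> L \<longrightarrow> \<not> parallel_at E v0 L' u M)) \<longleftrightarrow>
    minimal_hitting (\<lambda>X F. \<not> orthogonal E X F) M L" if M: "M \<subseteq> outc u" for M
  proof -
    have "(\<forall>L'. L' \<subset> L \<longrightarrow> \<not> parallel_at E v0 L' u M) \<longleftrightarrow>
      (\<forall>x\<in>L. \<not> parallel_at E v0 (L - {x}) u M)"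
    proof
      assume r: "\<forall>x\<in>L. \<not> parallel_at E v0 (L - {x}) u M"
      show "\<forall>L'. L' \<subset> L \<longrightarrow> \<not> parallel_at E v0 L' u M"
      proof (intro allI impI)
        fix L' assume L': "L' \<subset> L"
        then obtain x where x: "x \<in> L" "L' \<subseteq> L - {x}" by blast
        have sub: "L - {x} \<subseteq> inc u" "L' \<subseteq> inc u" using L L' by auto
        have "\<not> (\<forall>F\<in>M. \<exists>X\<in>L - {x}. \<not> orthogonal E X F)"
          using r x(1) parallel_at_iff[OF sub(1) M] by blast
        then show "\<not> parallel_at E v0 L' u M"
          unfolding parallel_at_iff[OF sub(2) M] using x(2) by blast
      qed
    next
      assume "\<forall>L'. L' \<subset> L \<longrightarrow> \<not> parallel_at E v0 L' u M"
      moreover have "L - {x} \<subset> L" if "x \<in> L" for x using that by blast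
      ultimately show "\<forall>x\<in>L. \<not> parallel_at E v0 (L - {x}) u M" by blast
    qed
    moreover have "parallel_at E v0 (L - {x}) u M \<longleftrightarrow>
      (\<forall>F\<in>M. \<exists>X\<in>L - {x}. \<not> orthogonal E X F)" for x
      using L by (intro parallel_at_iff M) blast
    moreover have "\<not> (\<forall>F\<in>M. \<exists>X\<in>L - {x}. \<not> orthogonal E X F) \<longleftrightarrow>
      (\<exists>F\<in>M. \<forall>X\<in>L. \<not> orthogonal E X F \<longrightarrow> X = x)" for x
      by blast
    ultimately show ?thesis
      unfolding minimal_hitting_alt parallel_at_iff[OF L M] by simp
  qed
  show ?thesis
  proof (intro set_eqI iffI)
    fix M assume M: "M \<in> min_parallel E v0 L u"
    then have "M \<subseteq> outc u" using outgoing_iff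
      by (auto simp: min_parallel_def parallel_at_def pof_def)
    then show "M \<in> {M. M \<subseteq> outc u \<and> pairwise (orthogonal E) M \<and>
      minimal_hitting (\<lambda>X F. \<not> orthogonal E X F) M L}"
      using M *[of M] by (auto simp: min_parallel_def pof_def)
  next
    fix M assume M: "M \<in> {M. M \<subseteq> outc u \<and> pairwise (orthogonal E) M \<and>
      minimal_hitting (\<lambda>X F. \<not> orthogonal E X F) M L}"
    then show "M \<in> min_parallel E v0 L u"
      using *[of M] outc_classes by (auto simp: min_parallel_def pof_def)
  qed
qed

end

section \<open>Counting minimal hitting sets\<close>

definition hitting_sets :: "('b \<Rightarrow> 'c \<Rightarrow> bool) \<Rightarrow> 'b set \<Rightarrow> 'c set \<Rightarrow> 'b set set" where
  "hitting_sets R D J = {L. L \<subseteq> D \<and> minimal_hitting R J L}"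

definition rest :: "('b \<Rightarrow> 'c \<Rightarrow> bool) \<Rightarrow> 'c set \<Rightarrow> 'b \<Rightarrow> 'c set" where
  "rest R J x = {f \<in> J. \<not> R x f}"

lemma finite_hitting_sets: "finite D \<Longrightarrow> finite (hitting_sets R D J)"
  by (rule finite_subset[of _ "Pow D"]) (auto simp: hitting_sets_def)

lemma minimal_hitting_remove:
  "minimal_hitting R J L \<Longrightarrow> x \<in> L \<Longrightarrow> minimal_hitting R (rest R J x) (L - {x})"
  unfolding minimal_hitting_def rest_def by blast

lemma hitting_sets_insert:
  assumes "L \<in> hitting_sets R D J" "x \<in> L"
  shows "L \<in> insert x ` hitting_sets R (D - {x}) (rest R J x)"
proof (rule image_eqI)
  show "L = insert x (L - {x})" using assms(2) by blast
  show "L - {x} \<in> hitting_sets R (D - {x}) (rest R J x)"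
    using assms minimal_hitting_remove by (auto simp: hitting_sets_def)
qed

lemma card_hitting_sets_branch:
  assumes "finite D"
  shows "card (hitting_sets R D J) \<le>
    card (hitting_sets R (D - {x}) J) + card (hitting_sets R (D - {x}) (rest R J x))"
proof -
  let ?A = "hitting_sets R (D - {x}) J" and ?B = "hitting_sets R (D - {x}) (rest R J x)"
  have fin: "finite ?A" "finite ?B" using assms by (auto intro: finite_hitting_sets)
  have "hitting_sets R D J \<subseteq> ?A \<union> insert x ` ?B"
  proof
    fix L assume L: "L \<in> hitting_sets R D J"
    show "L \<in> ?A \<union> insert x ` ?B"
      using L hitting_sets_insert[OF L] by (cases "x \<in> L") (auto simp: hitting_sets_def)
  qed
  then have "card (hitting_sets R D J) \<le> card (?A \<union> insert x ` ?B)"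
    using fin by (intro card_mono) auto
  also have "\<dots> \<le> card ?A + card (insert x ` ?B)" by (rule card_Un_le)
  also have "card (insert x ` ?B) \<le> card ?B" using fin by (intro card_image_le)
  finally show ?thesis by simp
qed

lemma card_hitting_sets_sum:
  assumes "finite D" "a \<in> J"
  shows "card (hitting_sets R D J) \<le>
    (\<Sum>x\<in>{x \<in> D. R x a}. card (hitting_sets R (D - {x}) (rest R J x)))"
proof -
  let ?S = "{x \<in> D. R x a}" and ?B = "\<lambda>x. hitting_sets R (D - {x}) (rest R J x)"
  have fin: "finite ?S" "finite (?B x)" for x using assms by (auto intro: finite_hitting_sets)
  have "hitting_sets R D J \<subseteq> (\<Union>x\<in>?S. insert x ` ?B x)"
  proof
    fix L assume L: "L \<in> hitting_sets R D J"
    then have "\<exists>x\<in>L. R x a" "L \<subseteq> D"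
      using assms(2) unfolding hitting_sets_def minimal_hitting_def by blast+
    then obtain x where "x \<in> L" "R x a" "x \<in> D" by blast
    then show "L \<in> (\<Union>x\<in>?S. insert x ` ?B x)"
      using hitting_sets_insert[OF L] by blast
  qed
  then have "card (hitting_sets R D J) \<le> card (\<Union>x\<in>?S. insert x ` ?B x)"
    using fin by (intro card_mono) auto
  also have "\<dots> \<le> (\<Sum>x\<in>?S. card (insert x ` ?B x))" using fin by (intro card_UN_le)
  also have "\<dots> \<le> (\<Sum>x\<in>?S. card (?B x))" using fin by (intro sum_mono card_image_le)
  finally show ?thesis .
qed

section \<open>Weights and the branching argument\<close>

definition degree :: "('b \<Rightarrow> 'c \<Rightarrow> bool) \<Rightarrow> 'c set \<Rightarrow> 'b \<Rightarrow> nat" where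
  "degree R J x = card {f \<in> J. R x f}"

text \<open>The weight \<open>13 / 10\<close> has to satisfy \<open>linear_le_power\<close>, where
  size 4 is critical and would allow about 1.278. The weight \<open>283 / 200\<close> is a
  \<open>w\<close> with \<open>1 + 4 / 9 * (13 / 10) / w \<le> w\<close>, which needs about 1.41,
  and with \<open>w \<le> 3.5394 / 2.5\<close>.\<close>

definition weight :: "nat \<Rightarrow> real" where
  "weight k = (if k = 0 then 1 else if k = 1 then 13 / 10 else 283 / 200)"

text \<open>The potential of the branching: every element that is still to be hit contributes a factor
  \<open>3 / 2\<close>, every available set a factor depending on the number of elements it still hits. That
  sets lose weight when their elements are hit elsewhere makes the branching on sets of size 2
  cheap enough.\<close>

definition potential :: "('b \<Rightarrow> 'c \<Rightarrow> bool) \<Rightarrow> 'b set \<Rightarrow> 'c set \<Rightarrow> real" where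
  "potential R D J = (3 / 2) ^ card J * (\<Prod>x\<in>D. weight (degree R J x))"

lemma weight_bounds: "1 \<le> weight k" "weight k \<le> 283 / 200" "0 < weight k" "0 \<le> weight k"
  by (auto simp: weight_def)

lemma weight_mono: "k \<le> l \<Longrightarrow> weight k \<le> weight l"
  by (auto simp: weight_def)

text \<open>When no element hits more than one member, a member hit by \<open>s\<close> elements
  leaves \<open>s\<close> choices, while its share of the potential is the right-hand side.\<close>

lemma linear_le_power: "real s \<le> 3 / 2 * (13 / 10) ^ s"
proof (induction s rule: less_induct)
  case (less s)
  show ?case
  proof (cases "s \<le> 4")
    case True
    then have "s \<in> {0, 1, 2, 3, 4}" by auto
    then show ?thesis by (auto simp: power_numeral_reduce)
  next
    case False
    then obtain r where r: "s = Suc r" "4 \<le> r" by (cases s) auto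
    \<comment> \<open>From 4 on, the quotient of successive integers is at most
      \<open>5 / 4\<close>.\<close>
    have "real s \<le> 13 / 10 * real r" using r by simp
    also have "\<dots> \<le> 13 / 10 * (3 / 2 * (13 / 10) ^ r)" using less[of r] r by simp
    finally show ?thesis using r by simp
  qed
qed

lemma rest_subset: "rest R J x \<subseteq> J"
  by (auto simp: rest_def)

lemma card_rest:
  assumes "finite J"
  shows "card J = card (rest R J x) + degree R J x"
proof -
  have "J = rest R J x \<union> {f \<in> J. R x f}" by (auto simp: rest_def)
  moreover have "card (rest R J x \<union> {f \<in> J. R x f}) = card (rest R J x) + card {f \<in> J. R x f}"
    using assms by (intro card_Un_disjoint) (auto simp: rest_def)
  ultimately show ?thesis by (simp add: degree_def)
qed

lemma degree_mono: "finite J \<Longrightarrow> J' \<subseteq> J \<Longrightarrow> degree R J' x \<le> degree R J x"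
  unfolding degree_def by (intro card_mono) auto

lemma potential_remove:
  "finite D \<Longrightarrow> x \<in> D \<Longrightarrow>
    potential R D J = weight (degree R J x) * potential R (D - {x}) J"
  by (simp add: potential_def prod.remove)

lemma potential_nonneg: "0 \<le> potential R D J"
  by (auto simp: potential_def intro!: mult_nonneg_nonneg prod_nonneg weight_bounds)

lemma potential_rest_le:
  assumes "finite D" "finite J" "k \<le> degree R J x"
  shows "(3 / 2) ^ k * potential R D (rest R J x) \<le> potential R D J"
proof -
  have "(3 / 2 :: real) ^ k * (3 / 2) ^ card (rest R J x) \<le> (3 / 2) ^ card J"
    using card_rest[OF assms(2), of R x] assms(3)
    by (simp flip: power_add)
  moreover have "(\<Prod>y\<in>D. weight (degree R (rest R J x) y)) \<le> (\<Prod>y\<in>D. weight (degree R J y))"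
    using assms(2) by (intro prod_mono conjI weight_mono degree_mono rest_subset weight_bounds)
  ultimately show ?thesis
    unfolding potential_def mult.assoc[symmetric]
    by (intro mult_mono) (auto intro!: prod_nonneg weight_bounds)
qed

text \<open>Induction on the available elements, by the largest number of members that one of them
  hits: three or more pay for a plain branching, exactly two need a loss of weight elsewhere, and at
  most one makes the members independent of each other.\<close>

lemma card_hitting_sets_le_potential:
  assumes "finite D" "finite J"
  shows "real (card (hitting_sets R D J)) \<le> potential R D J"
  using assms
proof (induction "card D" arbitrary: D J rule: less_induct)
  case less
  note fin = less.prems
  have IH: "real (card (hitting_sets R (D - {x}) J')) \<le> potential R (D - {x}) J'"
    if "x \<in> D" "J' \<subseteq> J" for x J'
    using less.hyps[of "D - {x}" J'] that fin finite_subset[OF that(2)] card_Diff1_less[of D x]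
    by simp
  consider "J = {}" | "J \<noteq> {}" "\<forall>x\<in>D. degree R J x \<le> 1" | x where "x \<in> D" "degree R J x \<ge> 3"
    | x where "x \<in> D" "degree R J x = 2" "\<forall>x\<in>D. degree R J x \<le> 2"
  proof (cases "\<exists>x\<in>D. degree R J x \<ge> 3")
    case True
    then show ?thesis using that by blast
  next
    case F: False
    then have *: "\<forall>x\<in>D. degree R J x \<le> 2" by force
    show ?thesis
    proof (cases "\<exists>x\<in>D. degree R J x = 2")
      case True
      then show ?thesis using that(4) * by blast
    next
      case False
      then have "\<forall>x\<in>D. degree R J x \<le> 1" using * by force
      then show ?thesis using that(1,2) by blast
    qed
  qed
  then show ?case
  proof cases
    case 1
    have "hitting_sets R D J \<subseteq> {{}}" by (auto simp: hitting_sets_def minimal_hitting_def 1)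
    then have "card (hitting_sets R D J) \<le> card {{} :: 'a set}" by (intro card_mono) auto
    moreover have "1 \<le> potential R D J"
      unfolding potential_def 1 by (auto intro!: prod_ge_1 weight_bounds)
    ultimately show ?thesis by simp
  next
    case 2
    then obtain a where a: "a \<in> J" by blast
    \<comment> \<open>Elements of \<open>?S\<close> hit nothing but \<open>a\<close>. Once one of
      them is chosen, the others have degree 0 and weight 1, so all branches have the same
      potential.\<close>
    let ?S = "{x \<in> D. R x a}"
    let ?P = "(3 / 2) ^ card (J - {a}) * (\<Prod>y\<in>D - ?S. weight (degree R J y))"
    have one: "{f \<in> J. R x f} = {a}" if "x \<in> ?S" for x
    proof -
      have "{a} \<subseteq> {f \<in> J. R x f}" using that a by auto
      moreover have "card {f \<in> J. R x f} \<le> 1" using 2 that by (auto simp: degree_def)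
      ultimately show ?thesis using fin by (intro card_seteq[symmetric]) auto
    qed
    have rest: "rest R J x = J - {a}" if "x \<in> ?S" for x
      using one[OF that] by (auto simp: rest_def)
    have zero: "weight (degree R (J - {a}) y) = 1" if "y \<in> ?S" for y
    proof -
      have "{f \<in> J - {a}. R y f} = {}" using one[OF that] by auto
      then show ?thesis unfolding degree_def by (simp only: card.empty weight_def if_True refl)
    qed
    have same: "degree R (J - {a}) y = degree R J y" if "y \<in> D - ?S" for y
    proof -
      have "{f \<in> J - {a}. R y f} = {f \<in> J. R y f}" using that by auto
      then show ?thesis unfolding degree_def by (rule arg_cong)
    qed
    have pot: "potential R (D - {x}) (rest R J x) = ?P" if "x \<in> ?S" for x
    proof -
      have "(\<Prod>y\<in>D - {x}. weight (degree R (J - {a}) y)) =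
        (\<Prod>y\<in>D - ?S. weight (degree R (J - {a}) y))"
        using fin that by (intro prod.mono_neutral_right) (auto intro!: zero)
      also have "\<dots> = (\<Prod>y\<in>D - ?S. weight (degree R J y))"
        by (intro prod.cong) (simp_all add: same)
      finally show ?thesis by (simp add: potential_def rest[OF that])
    qed
    have "real (card (hitting_sets R D J)) \<le>
      (\<Sum>x\<in>?S. real (card (hitting_sets R (D - {x}) (rest R J x))))"
      using card_hitting_sets_sum[OF fin(1) a, of R] by (simp flip: of_nat_sum)
    also have "\<dots> \<le> (\<Sum>x\<in>?S. potential R (D - {x}) (rest R J x))"
      by (intro sum_mono IH rest_subset) auto
    also have "\<dots> = real (card ?S) * ?P" using pot by simp
    also have "\<dots> \<le> (3 / 2 * (13 / 10) ^ card ?S) * ?P"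
      by (intro mult_right_mono linear_le_power mult_nonneg_nonneg prod_nonneg)
        (auto intro: weight_bounds)
    also have "(13 / 10) ^ card ?S = (\<Prod>y\<in>?S. weight (degree R J y))"
      using one by (simp add: degree_def weight_def)
    also have "3 / 2 * (\<Prod>y\<in>?S. weight (degree R J y)) * ?P =
      (3 / 2) ^ Suc (card (J - {a})) *
        ((\<Prod>y\<in>D - ?S. weight (degree R J y)) * (\<Prod>y\<in>?S. weight (degree R J y)))"
      by (simp add: mult_ac)
    also have "Suc (card (J - {a})) = card J" using fin a by (metis card.remove)
    also have "(\<Prod>y\<in>D - ?S. weight (degree R J y)) * (\<Prod>y\<in>?S. weight (degree R J y)) =
      (\<Prod>y\<in>D. weight (degree R J y))"
      using fin by (intro prod.subset_diff[symmetric]) auto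
    finally show ?thesis by (simp add: potential_def)
  next
    case (3 x)
    let ?Q = "potential R (D - {x}) J"
    have "real (card (hitting_sets R D J)) \<le> real (card (hitting_sets R (D - {x}) J)) +
      real (card (hitting_sets R (D - {x}) (rest R J x)))"
      using card_hitting_sets_branch[OF fin(1), of R J x] by linarith
    also have "\<dots> \<le> ?Q + potential R (D - {x}) (rest R J x)"
      using 3 by (intro add_mono IH rest_subset) auto
    \<comment> \<open>The factor needed is \<open>1 + (2 / 3) ^ 3 = 35 / 27\<close>.\<close>
    also have "\<dots> \<le> 283 / 200 * ?Q"
      using potential_rest_le[of "D - {x}" J 3 R x] fin 3 potential_nonneg[of R "D - {x}" J]
      by (simp add: power3_eq_cube)
    also have "\<dots> = potential R D J"
      using 3 by (simp add: potential_remove[OF fin(1) 3(1)] weight_def)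
    finally show ?thesis .
  next
    case (4 x)
    let ?Q = "potential R (D - {x}) J" and ?Q' = "potential R (D - {x}) (rest R J x)"
    have pot: "potential R D J = 283 / 200 * ?Q"
      using 4 by (simp add: potential_remove[OF fin(1) 4(1)] weight_def)
    have le: "9 / 4 * ?Q' \<le> ?Q"
      using potential_rest_le[of "D - {x}" J 2 R x] fin 4 by (simp add: power2_eq_square)
    have "card {f \<in> J. R x f} \<noteq> 0" using 4 by (simp add: degree_def)
    then obtain a where a: "a \<in> J" "R x a" by (auto simp: card_eq_0_iff)
    show ?thesis
    proof (cases "\<exists>y\<in>D - {x}. R y a")
      \<comment> \<open>Here \<open>x\<close> is the only element that hits \<open>a\<close>, so it
        belongs to every solution.\<close>
      case False
      then have "{x \<in> D. R x a} = {x}" using 4(1) a by auto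
      then have "card (hitting_sets R D J) \<le> card (hitting_sets R (D - {x}) (rest R J x))"
        using card_hitting_sets_sum[OF fin(1) a(1), of R] by simp
      also have "real \<dots> \<le> ?Q'" using 4 by (intro IH rest_subset) auto
      finally show ?thesis using pot le potential_nonneg[of R "D - {x}" "rest R J x"] by simp
    next
      case True
      then obtain y where y: "y \<in> D" "y \<noteq> x" "R y a" by blast
      let ?k = "degree R J y" and ?k' = "degree R (rest R J x) y"
      have "?k' < ?k"
        unfolding degree_def using fin a y by (intro psubset_card_mono) (auto simp: rest_def)
      \<comment> \<open>The extreme case is the drop from 2 to 1; from 1 to 0 the quotient is
        \<open>10 / 13\<close>, which is smaller.\<close>
      then have "weight ?k' \<le> (13 / 10) / (283 / 200) * weight ?k"
        using 4(3) y by (auto simp: weight_def)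
      then have "weight ?k' * potential R (D - {x} - {y}) (rest R J x) \<le>
        (13 / 10) / (283 / 200) * weight ?k * potential R (D - {x} - {y}) (rest R J x)"
        by (intro mult_right_mono potential_nonneg)
      also have "\<dots> \<le> (13 / 10) / (283 / 200) * weight ?k * (4 / 9 * potential R (D - {x} - {y}) J)"
        using potential_rest_le[of "D - {x} - {y}" J 2 R x] fin 4 weight_bounds[of ?k]
        by (intro mult_left_mono) (auto simp: power2_eq_square)
      \<comment> \<open>The constant is \<open>4 / 9\<close> times \<open>1.3 / 1.415\<close>, about
        0.4083, so that both branches together stay below \<open>1.415 * ?Q\<close>.\<close>
      finally have "?Q' \<le> 520 / 1273.5 * ?Q"
        using potential_remove[of "D - {x}" y R J] potential_remove[of "D - {x}" y R "rest R J x"]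
          fin y by (simp add: mult_ac)
      moreover have "real (card (hitting_sets R D J)) \<le> real (card (hitting_sets R (D - {x}) J)) +
        real (card (hitting_sets R (D - {x}) (rest R J x)))"
        using card_hitting_sets_branch[OF fin(1), of R J x] by linarith
      moreover have "\<dots> \<le> ?Q + ?Q'"
        using 4 by (intro add_mono IH rest_subset) auto
      ultimately show ?thesis using pot potential_nonneg[of R "D - {x}" J] by simp
    qed
  qed
qed

lemma card_hitting_sets_le:
  assumes "finite D" "finite J"
  shows "real (card (hitting_sets R D J)) \<le> (3 / 2) ^ card J * (283 / 200) ^ card D"
proof -
  have "(\<Prod>x\<in>D. weight (degree R J x)) \<le> (\<Prod>x\<in>D. 283 / 200)"
    by (intro prod_mono conjI weight_bounds)
  then have "potential R D J \<le> (3 / 2) ^ card J * (283 / 200) ^ card D"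
    by (simp add: potential_def)
  with card_hitting_sets_le_potential[OF assms] show ?thesis by (rule order_trans)
qed

section \<open>Bit masks\<close>

text \<open>Listed from the highest position down, the order in which the program peels off powers
  of two.\<close>

definition bits :: "nat \<Rightarrow> nat \<Rightarrow> nat list" where
  "bits m S = rev (filter (bit S) [0..<m])"

lemma set_bits: "set (bits m S) = {i. i < m \<and> bit S i}"
  by (auto simp: bits_def)

lemma set_bits_subset: "set (bits m S) \<subseteq> {..<m}"
  by (auto simp: set_bits)

lemma distinct_bits: "distinct (bits m S)"
  by (simp add: bits_def)

lemma length_bits: "length (bits m S) = card (set (bits m S))"
  by (simp add: distinct_card distinct_bits)

lemma length_bits_le: "length (bits m S) \<le> m"
  unfolding bits_def using length_filter_le[of "bit S" "[0..<m]"] by simp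

lemma bit_less: "S < 2 ^ m \<Longrightarrow> bit S i \<Longrightarrow> i < m" for S :: nat
  using take_bit_nat_eq_self_iff[of m S] bit_take_bit_iff[of m S i] by simp

lemma bits_inj:
  assumes "S < 2 ^ m" "T < 2 ^ m" "set (bits m S) = set (bits m T)"
  shows "S = T"
proof (rule bit_eqI)
  fix i
  show "bit S i \<longleftrightarrow> bit T i"
    using assms bit_less[of S m i] bit_less[of T m i] unfolding set_bits by blast
qed

lemma mask_insert:
  fixes S :: nat
  assumes "S < 2 ^ m" "x < m" "x \<notin> set (bits m S)"
  shows "S + 2 ^ x < 2 ^ m" "set (bits m (S + 2 ^ x)) = insert x (set (bits m S))"
proof -
  have nb: "\<not> bit S x" using assms by (simp add: set_bits)
  have eq: "S + 2 ^ x = set_bit x S" using nb by (simp add: set_bit_eq)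
  show "S + 2 ^ x < 2 ^ m"
    unfolding eq using take_bit_set_bit_eq[of m x S] take_bit_nat_eq_self_iff[of m S]
      take_bit_nat_eq_self_iff[of m "set_bit x S"] assms by simp
  show "set (bits m (S + 2 ^ x)) = insert x (set (bits m S))"
    unfolding eq set_bits using assms(2) by (auto simp: bit_set_bit_iff)
qed

lemma mask_exists: "I \<subseteq> {..<m} \<Longrightarrow> \<exists>S<2 ^ m. set (bits m S) = I"
proof -
  assume I: "I \<subseteq> {..<m}"
  then have "finite I" using finite_subset by blast
  then show ?thesis using I
  proof (induction I rule: finite_induct)
    case empty
    show ?case by (intro exI[of _ 0]) (simp add: set_bits)
  next
    case (insert x I)
    then obtain S where "S < 2 ^ m" "set (bits m S) = I" by auto
    then show ?case using mask_insert[of S m x] insert by (intro exI[of _ "S + 2 ^ x"]) auto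
  qed
qed

lemma bij_betw_masks: "bij_betw (\<lambda>S. set (bits m S)) {..<2 ^ m} (Pow {..<m})"
  unfolding bij_betw_def inj_on_def
  using bits_inj set_bits_subset mask_exists by (auto simp: image_iff) blast+

text \<open>The binomial theorem as a product over the positions; with \<open>c = 3 / 2\<close> it
  turns the bound per cube into one per top vertex.\<close>

lemma sum_masks: "(\<Sum>S<2 ^ m. (c :: real) ^ length (bits m S)) = (1 + c) ^ m"
proof -
  have "(\<Sum>S<2 ^ m. c ^ length (bits m S)) = (\<Sum>I\<in>Pow {..<m}. c ^ card I)"
    using sum.reindex_bij_betw[OF bij_betw_masks, of "\<lambda>I. c ^ card I" m]
    by (simp add: length_bits)
  also have "\<dots> = (\<Prod>i<m. c + 1)"
    by (subst prod_add) auto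
  finally show ?thesis by (simp add: add.commute)
qed

lemma bits_step:
  assumes "i < m"
  shows "rev (filter (bit S) [m - Suc i..<m]) =
    rev (filter (bit S) [m - i..<m]) @ (if bit S (m - Suc i) then [m - Suc i] else [])"
proof -
  have "[m - Suc i..<m] = (m - Suc i) # [m - i..<m]"
    using assms upt_conv_Cons[of "m - Suc i" m] by (simp add: Suc_diff_Suc)
  then show ?thesis by simp
qed

section \<open>Incremental enumeration of minimal hitting sets\<close>

lemma minimal_hitting_antichain:
  assumes "minimal_hitting R J A" "minimal_hitting R J B" "B \<subseteq> A"
  shows "A = B"
proof (rule ccontr)
  assume "A \<noteq> B"
  then obtain x where x: "x \<in> A" "x \<notin> B" using assms(3) by blast
  then obtain f where f: "f \<in> J" "\<forall>x'\<in>A. R x' f \<longrightarrow> x' = x"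
    using assms(1) unfolding minimal_hitting_def by blast
  obtain y where "y \<in> B" "R y f" using assms(2) f(1) unfolding minimal_hitting_def by blast
  then show False using f x assms(3) by blast
qed

text \<open>The parent of a minimal hitting set \<open>T\<close> of \<open>insert f J\<close>: either \<open>T\<close> itself, or \<open>T\<close>
  without the element that is only needed for \<open>f\<close>.\<close>

lemma minimal_hitting_parent:
  assumes "minimal_hitting R (insert f J) T" "\<not> minimal_hitting R J T"
  shows "\<exists>x\<in>T. minimal_hitting R J (T - {x})"
proof -
  have hit: "\<exists>x\<in>T. R x g" if "g \<in> insert f J" for g
    using assms(1) that unfolding minimal_hitting_def by blast
  have priv: "\<exists>g\<in>insert f J. R x g \<and> (\<forall>x'\<in>T. R x' g \<longrightarrow> x' = x)" if "x \<in> T" for x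
    using assms(1) that unfolding minimal_hitting_def by blast
  obtain x where x: "x \<in> T" "\<not> (\<exists>g\<in>J. R x g \<and> (\<forall>x'\<in>T. R x' g \<longrightarrow> x' = x))"
    using assms(2) hit unfolding minimal_hitting_def by blast
  then have f: "R x f" "\<forall>x'\<in>T. R x' f \<longrightarrow> x' = x" using priv[OF x(1)] by blast+
  have "\<exists>x'\<in>T - {x}. R x' g" if "g \<in> J" for g
  proof -
    obtain y where y: "y \<in> T" "R y g" using hit \<open>g \<in> J\<close> by blast
    show ?thesis
    proof (cases "y = x")
      case True
      then obtain x' where "x' \<in> T" "R x' g" "x' \<noteq> x" using x(2) y \<open>g \<in> J\<close> by blast
      then show ?thesis by blast
    qed (use y in blast)
  qed
  moreover have "\<exists>g\<in>J. R y g \<and> (\<forall>x'\<in>T - {x}. R x' g \<longrightarrow> x' = y)" if "y \<in> T - {x}" for y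
  proof -
    have y: "y \<in> T" "y \<noteq> x" using that by auto
    obtain g where g: "g \<in> insert f J" "R y g" "\<forall>x'\<in>T. R x' g \<longrightarrow> x' = y"
      using priv[OF y(1)] by blast
    have "g \<noteq> f" using g(3) f(1) x(1) y(2) by blast
    then show ?thesis using g by blast
  qed
  ultimately show ?thesis using x(1) unfolding minimal_hitting_def by blast
qed

text \<open>An element added to a parent has its private member outside \<open>J\<close>, hence it
  is the only element of \<open>T\<close> that hits \<open>f\<close>; this determines the parent. If
  \<open>T\<close> is itself minimal for \<open>J\<close>, the antichain property excludes a smaller
  parent. So the enumeration produces no duplicates.\<close>

lemma minimal_hitting_parent_unique:
  assumes "minimal_hitting R J A" "minimal_hitting R J B" "minimal_hitting R (insert f J) T"
    and "T = A \<or> (\<exists>x. x \<notin> A \<and> T = insert x A)" "T = B \<or> (\<exists>x. x \<notin> B \<and> T = insert x B)"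
  shows "A = B"
proof -
  have hit: "\<exists>x\<in>A. R x g" "\<exists>x\<in>B. R x g" if "g \<in> J" for g
    using assms(1,2) that unfolding minimal_hitting_def by blast+
  have only: "R x f" "\<forall>x'\<in>T. R x' f \<longrightarrow> x' = x"
    if C: "x \<notin> C" "T = insert x C" "\<And>g. g \<in> J \<Longrightarrow> \<exists>x\<in>C. R x g" for x C
  proof -
    have "x \<in> T" using C by blast
    then obtain g where g: "g \<in> insert f J" "R x g" "\<forall>x'\<in>T. R x' g \<longrightarrow> x' = x"
      using assms(3) unfolding minimal_hitting_def by blast
    have "g \<notin> J"
    proof
      assume "g \<in> J"
      then obtain y where "y \<in> C" "R y g" using C(3) by blast
      then show False using g(3) C(1,2) by blast
    qed
    then show "R x f" "\<forall>x'\<in>T. R x' f \<longrightarrow> x' = x" using g by auto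
  qed
  show ?thesis using assms(4,5)
  proof (elim disjE exE conjE)
    assume "T = A" "T = B"
    then show ?thesis by simp
  next
    fix x assume "T = A" "T = insert x B"
    then show ?thesis using minimal_hitting_antichain[OF assms(1,2)] by blast
  next
    fix x assume "T = insert x A" "T = B"
    then show ?thesis using minimal_hitting_antichain[OF assms(2,1)] by blast
  next
    fix x y assume x: "x \<notin> A" "T = insert x A" and y: "y \<notin> B" "T = insert y B"
    have "R x f" "\<forall>x'\<in>T. R x' f \<longrightarrow> x' = y"
      using only(1)[OF x hit(1)] only(2)[OF y hit(2)] by blast+
    moreover have "x \<in> T" using x by blast
    ultimately have "x = y" by blast
    have "A = T - {x}" using x by blast
    also have "\<dots> = B" using y \<open>x = y\<close> by blast
    finally show ?thesis .
  qed
qed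

text \<open>Privacy refers to positions, so a list with a repetition is rejected; appending an
  element already present needs no separate test.\<close>

definition list_minimal :: "('b \<Rightarrow> 'c \<Rightarrow> bool) \<Rightarrow> 'c list \<Rightarrow> 'b list \<Rightarrow> bool" where
  "list_minimal R fs xs \<longleftrightarrow> (\<forall>f\<in>set fs. \<exists>i<length xs. R (xs ! i) f) \<and>
     (\<forall>i<length xs. \<exists>f\<in>set fs. R (xs ! i) f \<and> (\<forall>i'<length xs. R (xs ! i') f \<longrightarrow> i' = i))"

lemma list_minimal_iff:
  "list_minimal R fs xs \<longleftrightarrow> distinct xs \<and> minimal_hitting R (set fs) (set xs)"
proof
  assume l: "list_minimal R fs xs"
  have "distinct xs"
    unfolding distinct_conv_nth
  proof (intro allI impI)
    fix i j assume "i < length xs" "j < length xs" "i \<noteq> j"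
    moreover obtain f where "R (xs ! i) f" "\<forall>i'<length xs. R (xs ! i') f \<longrightarrow> i' = i"
      using l \<open>i < length xs\<close> unfolding list_minimal_def by blast
    ultimately show "xs ! i \<noteq> xs ! j" by metis
  qed
  moreover have "minimal_hitting R (set fs) (set xs)"
    unfolding minimal_hitting_def
  proof (intro conjI ballI)
    fix f assume "f \<in> set fs"
    then obtain i where "i < length xs" "R (xs ! i) f"
      using l unfolding list_minimal_def by blast
    then show "\<exists>x\<in>set xs. R x f" using nth_mem by blast
  next
    fix x assume "x \<in> set xs"
    then obtain i where i: "i < length xs" "x = xs ! i" unfolding in_set_conv_nth by blast
    then obtain f where f: "f \<in> set fs" "R (xs ! i) f" "\<forall>i'<length xs. R (xs ! i') f \<longrightarrow> i' = i"
      using l unfolding list_minimal_def by blast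
    have "x' = x" if "x' \<in> set xs" "R x' f" for x'
    proof -
      obtain j where "j < length xs" "x' = xs ! j" using \<open>x' \<in> set xs\<close> unfolding in_set_conv_nth by blast
      then show ?thesis using f(3) \<open>R x' f\<close> i(2) by simp
    qed
    then show "\<exists>f\<in>set fs. R x f \<and> (\<forall>x'\<in>set xs. R x' f \<longrightarrow> x' = x)"
      using f(1,2) i(2) by blast
  qed
  ultimately show "distinct xs \<and> minimal_hitting R (set fs) (set xs)" ..
next
  assume d: "distinct xs \<and> minimal_hitting R (set fs) (set xs)"
  have "\<exists>i<length xs. R (xs ! i) f" if "f \<in> set fs" for f
    using d that unfolding minimal_hitting_def by (metis in_set_conv_nth)
  moreover have "\<exists>f\<in>set fs. R (xs ! i) f \<and> (\<forall>i'<length xs. R (xs ! i') f \<longrightarrow> i' = i)"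
    if "i < length xs" for i
  proof -
    have "xs ! i \<in> set xs" using that by simp
    then obtain f where "f \<in> set fs" "R (xs ! i) f" "\<forall>x'\<in>set xs. R x' f \<longrightarrow> x' = xs ! i"
      using d unfolding minimal_hitting_def by blast
    then show ?thesis using d that by (intro bexI[of _ f]) (auto simp: nth_eq_iff_index_eq)
  qed
  ultimately show "list_minimal R fs xs" unfolding list_minimal_def by blast
qed

text \<open>The children of \<open>S\<close> when one member is added to the family. With
  \<open>list_minimal\<close> as \<open>ok\<close>, the addition of \<open>2 ^ x\<close> sets a new
  bit, because an \<open>x\<close> already in \<open>S\<close> is refused.\<close>

definition berge_step :: "nat \<Rightarrow> (nat list \<Rightarrow> bool) \<Rightarrow> nat \<Rightarrow> nat list" where
  "berge_step m ok S = (if ok (bits m S) then [S] else []) @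
     map (\<lambda>x. S + 2 ^ x) (filter (\<lambda>x. ok (bits m S @ [x])) [0..<m])"

fun berge :: "nat \<Rightarrow> (nat \<Rightarrow> 'c \<Rightarrow> bool) \<Rightarrow> 'c list \<Rightarrow> nat \<Rightarrow> nat list" where
  "berge m R fs 0 = [0]"
| "berge m R fs (Suc k) =
     concat (map (berge_step m (list_minimal R (take (Suc k) fs))) (berge m R fs k))"

lemma distinct_concat_map:
  "distinct xs \<Longrightarrow> (\<And>x. x \<in> set xs \<Longrightarrow> distinct (f x)) \<Longrightarrow>
    (\<And>x x' y. x \<in> set xs \<Longrightarrow> x' \<in> set xs \<Longrightarrow> y \<in> set (f x) \<Longrightarrow> y \<in> set (f x') \<Longrightarrow> x = x') \<Longrightarrow>
    distinct (concat (map f xs))"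
proof (induction xs)
  case (Cons x xs)
  have "distinct (concat (map f xs))" using Cons by (intro Cons.IH) auto
  moreover have "set (f x) \<inter> set (concat (map f xs)) = {}"
    using Cons.prems(1) Cons.prems(3)[of x] by fastforce
  ultimately show ?case using Cons.prems(2) by simp
qed simp

lemma berge_stepD:
  assumes "T \<in> set (berge_step m (list_minimal R fs) S)" "S < 2 ^ m"
  shows "T < 2 ^ m \<and> minimal_hitting R (set fs) (set (bits m T)) \<and>
    (set (bits m T) = set (bits m S) \<or>
      (\<exists>x. x \<notin> set (bits m S) \<and> set (bits m T) = insert x (set (bits m S))))"
proof -
  consider "T = S" "list_minimal R fs (bits m S)"
    | x where "x < m" "T = S + 2 ^ x" "list_minimal R fs (bits m S @ [x])"
    using assms(1) by (auto simp: berge_step_def split: if_splits)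
  then show ?thesis
  proof cases
    case 1
    then show ?thesis using assms(2) by (simp add: list_minimal_iff)
  next
    case (2 x)
    then have "x \<notin> set (bits m S)" "minimal_hitting R (set fs) (insert x (set (bits m S)))"
      by (simp_all add: list_minimal_iff)
    then show ?thesis using mask_insert[OF assms(2) 2(1)] 2(2) by auto
  qed
qed

text \<open>Completeness rests on the existence of a parent, distinctness on its uniqueness; no
  solution ever has to be compared with another one.\<close>

lemma berge_correct:
  "k \<le> length fs \<Longrightarrow> distinct (berge m R fs k) \<and>
    set (berge m R fs k) = {S. S < 2 ^ m \<and> minimal_hitting R (set (take k fs)) (set (bits m S))}"
proof (induction k)
  case 0
  have "set (bits m S) = {} \<longleftrightarrow> S = 0" if "S < 2 ^ m" for S
    using bits_inj[OF that, of 0] by (auto simp: set_bits)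
  then show ?case by (auto simp: minimal_hitting_def)
next
  case (Suc k)
  let ?J = "set (take k fs)" and ?f = "fs ! k" and ?L = "berge m R fs k"
  let ?step = "berge_step m (list_minimal R (take (Suc k) fs))"
  have IH: "distinct ?L" "S \<in> set ?L \<longleftrightarrow> S < 2 ^ m \<and> minimal_hitting R ?J (set (bits m S))" for S
    using Suc by auto
  have J: "set (take (Suc k) fs) = insert ?f ?J"
    using Suc.prems by (simp add: take_Suc_conv_app_nth)
  have disj: "S = S'" if "S \<in> set ?L" "S' \<in> set ?L" "T \<in> set (?step S)" "T \<in> set (?step S')" for S S' T
  proof -
    have S: "S < 2 ^ m" "S' < 2 ^ m" "minimal_hitting R ?J (set (bits m S))"
      "minimal_hitting R ?J (set (bits m S'))" using that IH by auto
    have "set (bits m S) = set (bits m S')"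
      using berge_stepD[OF that(3) S(1)] berge_stepD[OF that(4) S(2)] J
      by (intro minimal_hitting_parent_unique[OF S(3,4), of ?f "set (bits m T)"]) auto
    then show ?thesis using bits_inj S by blast
  qed
  have step: "distinct (?step S)" for S
    by (auto simp: berge_step_def distinct_map inj_on_def)
  have "distinct (concat (map ?step ?L))"
    using IH(1) step disj by (intro distinct_concat_map) blast+
  moreover have "set (concat (map ?step ?L)) =
    {S. S < 2 ^ m \<and> minimal_hitting R (set (take (Suc k) fs)) (set (bits m S))}"
  proof (intro set_eqI iffI)
    fix T assume "T \<in> set (concat (map ?step ?L))"
    then obtain S where "S \<in> set ?L" "T \<in> set (?step S)" by auto
    then show "T \<in> {S. S < 2 ^ m \<and> minimal_hitting R (set (take (Suc k) fs)) (set (bits m S))}"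
      using berge_stepD IH(2) by blast
  next
    fix T assume "T \<in> {S. S < 2 ^ m \<and> minimal_hitting R (set (take (Suc k) fs)) (set (bits m S))}"
    then have T: "T < 2 ^ m" "minimal_hitting R (insert ?f ?J) (set (bits m T))" using J by auto
    show "T \<in> set (concat (map ?step ?L))"
    proof (cases "minimal_hitting R ?J (set (bits m T))")
      case True
      have "T \<in> set (?step T)"
        using T distinct_bits J by (simp add: berge_step_def list_minimal_iff)
      then show ?thesis using True T IH(2) by auto
    next
      case False
      from minimal_hitting_parent[OF T(2) this] obtain x where x: "x \<in> set (bits m T)"
        "minimal_hitting R ?J (set (bits m T) - {x})" by blast
      obtain S where S: "S < 2 ^ m" "set (bits m S) = set (bits m T) - {x}"
        using mask_exists[of "set (bits m T) - {x}" m] set_bits_subset by blast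
      have xm: "x < m" "x \<notin> set (bits m S)" using x S set_bits_subset by auto
      have ins: "insert x (set (bits m S)) = set (bits m T)" using S x by auto
      then have "S + 2 ^ x = T" using mask_insert[OF S(1) xm] T bits_inj by metis
      moreover have "list_minimal R (take (Suc k) fs) (bits m S @ [x])"
        using xm distinct_bits T(2) ins J by (simp add: list_minimal_iff)
      ultimately have "T \<in> set (?step S)" using xm by (auto simp: berge_step_def)
      then show ?thesis using S x IH(2) by auto
    qed
  qed
  ultimately show ?case by simp
qed

text \<open>The level after \<open>k\<close> members solves the same problem for a prefix of the
  family, so one bound in terms of the full length covers every level and excludes a larger peak in
  the middle of the run.\<close>

lemma length_berge_le:
  assumes "k \<le> length fs"
  shows "real (length (berge m R fs k)) \<le> (3 / 2) ^ length fs * (283 / 200) ^ m"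
proof -
  let ?B = "berge m R fs k" and ?J = "set (take k fs)"
  have b: "distinct ?B" "set ?B = {S. S < 2 ^ m \<and> minimal_hitting R ?J (set (bits m S))}"
    using berge_correct[OF assms] by auto
  have "length ?B = card ((\<lambda>S. set (bits m S)) ` set ?B)"
    using b bits_inj distinct_card[OF b(1)] by (subst card_image) (auto simp: inj_on_def)
  also have "\<dots> \<le> card (hitting_sets R {..<m} ?J)"
    using b set_bits_subset
    by (intro card_mono finite_hitting_sets) (auto simp: hitting_sets_def)
  also have "real \<dots> \<le> (3 / 2) ^ card ?J * (283 / 200) ^ m"
    using card_hitting_sets_le[of "{..<m}" ?J R] by simp
  also have "card ?J \<le> length fs"
    using card_length[of "take k fs"] by simp
  finally show ?thesis by simp
qed

lemma minimal_hitting_image: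
  assumes "inj_on g I"
  shows "minimal_hitting (\<lambda>i. R (g i)) J I \<longleftrightarrow> minimal_hitting R J (g ` I)"
  unfolding minimal_hitting_def using assms by (simp add: inj_on_eq_iff)

section \<open>Cubes by top vertex and mask\<close>

locale graph_input = rooted_median V E v0
  for V :: "nat set" and E :: "nat set set" and v0 :: nat +
  fixes A :: "nat list list"
  assumes adjacency: "adjacency_lists V E A"
begin

abbreviation n :: nat where
  "n \<equiv> length A"

definition ins :: "nat \<Rightarrow> nat list" where
  "ins v = filter (\<lambda>w. depth w < depth v) (A ! v)"

definition indeg :: "nat \<Rightarrow> nat" where
  "indeg v = length (ins v)"

definition inlist :: "nat \<Rightarrow> nat set set list" where
  "inlist v = map (\<lambda>w. cls {w, v}) (ins v)"

text \<open>The shift by one frees 0 as the mark of an empty table cell.\<close>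

definition label :: "nat set set \<Rightarrow> nat" where
  "label F = Suc (gate F)"

lemma V_eq: "V = {..<n}"
  using adjacency by (simp add: adjacency_lists_def)

lemma neighbours: "u < n \<Longrightarrow> set (A ! u) = {v. {u, v} \<in> E}"
  and distinct_neighbours: "u < n \<Longrightarrow> distinct (A ! u)"
  using adjacency by (simp_all add: adjacency_lists_def)

lemma root_less: "v0 < n"
  using root V_eq by simp

lemma edge_less: "{u, v} \<in> E \<Longrightarrow> u < n" "{u, v} \<in> E \<Longrightarrow> v < n"
  using edgeD V_eq by auto

lemma set_ins: "v < n \<Longrightarrow> set (ins v) = {w. {w, v} \<in> E \<and> depth w < depth v}"
  by (auto simp: ins_def neighbours insert_commute)

lemma distinct_ins: "v < n \<Longrightarrow> distinct (ins v)"
  by (simp add: ins_def distinct_neighbours)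

lemma ins_arc: "v < n \<Longrightarrow> w \<in> set (ins v) \<Longrightarrow> arc (cls {w, v}) w v"
  by (simp add: set_ins arc_cls)

lemma arc_ins: "arc F w v \<Longrightarrow> w \<in> set (ins v)"
  using arcD[of F w v] V_eq by (simp add: set_ins)

lemma set_inlist: "v < n \<Longrightarrow> set (inlist v) = inc v"
proof (intro set_eqI iffI)
  fix F assume "v < n" "F \<in> set (inlist v)"
  then show "F \<in> inc v" using ins_arc by (auto simp: inlist_def inc_def)
next
  fix F assume "F \<in> inc v"
  then obtain w where w: "arc F w v" by (auto simp: inc_def)
  then show "F \<in> set (inlist v)" using arc_ins[OF w] arcD(7)[OF w] by (simp add: inlist_def)
qed

lemma distinct_inlist: "v < n \<Longrightarrow> distinct (inlist v)"
  unfolding inlist_def distinct_map inj_on_def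
  using distinct_ins ins_arc arc_low_unique by metis

lemma length_inlist [simp]: "length (inlist v) = indeg v"
  by (simp add: inlist_def indeg_def)

lemma indeg_card: "v < n \<Longrightarrow> indeg v = card (inc v)"
  using distinct_card[OF distinct_inlist, of v] set_inlist by simp

lemma indeg_le: "v < n \<Longrightarrow> indeg v \<le> dimension V E"
  using card_inc_le indeg_card V_eq by simp

lemma two_power_indeg: "v < n \<Longrightarrow> 2 ^ indeg v \<le> n"
  using two_power_dimension indeg_le[of v] V_eq
  by (metis card_lessThan le_trans one_le_numeral power_increasing)

lemma indeg_less: "v < n \<Longrightarrow> indeg v < n"
  using two_power_indeg[of v] less_exp[of "indeg v"] by linarith

lemma inlist_arc: "v < n \<Longrightarrow> i < indeg v \<Longrightarrow> arc (inlist v ! i) (ins v ! i) v"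
  using ins_arc[of v "ins v ! i"] by (simp add: inlist_def indeg_def)

lemma inlist_class: "v < n \<Longrightarrow> i < indeg v \<Longrightarrow> inlist v ! i \<in> theta_classes E"
  using inlist_arc arcD(1) by blast

lemma label_inj: "inj_on label (theta_classes E)"
  using inj_gate by (auto simp: inj_on_def label_def)

lemma label_bounds: "F \<in> theta_classes E \<Longrightarrow> 1 \<le> label F" "F \<in> theta_classes E \<Longrightarrow> label F \<le> n"
  using gate_inc(2)[of F] V_eq by (simp_all add: label_def)

lemma label_single:
  assumes "v < n" "indeg v = 1" "w \<in> set (ins v)"
  shows "label (cls {w, v}) = Suc v"
proof -
  have "cls {w, v} \<in> inc v" using ins_arc assms by (auto simp: inc_def)
  then have "inc v = {cls {w, v}}"
    using assms indeg_card[of v] by (auto simp: card_1_singleton_iff)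
  then show ?thesis using gate_eq by (simp add: label_def)
qed

text \<open>Two lower neighbours of \<open>v\<close> and a common lower neighbour of theirs form a
  square, so the label of \<open>{w, v}\<close> can be read off the opposite edge, whose upper end
  is less deep than \<open>v\<close>. Adjacency of \<open>x\<close> and \<open>w'\<close> is enough
  to identify the square.\<close>

lemma label_square:
  assumes "v < n" "w \<in> set (ins v)" "w' \<in> set (ins v)" "w \<noteq> w'" "x \<in> set (ins w)" "{x, w'} \<in> E"
  shows "cls {x, w'} = cls {w, v}"
proof -
  have w: "arc (cls {w, v}) w v" and w': "arc (cls {w', v}) w' v" using ins_arc assms by blast+
  have "w < n" using arcD(5)[OF w] V_eq by simp
  then have x: "arc (cls {x, w}) x w" using ins_arc assms by blast
  have "four_cycle E v w x w'"
    using arcD(3)[OF w] arcD(3)[OF w'] arcD(3)[OF x] assms(4,6) arcD(4)[OF w] arcD(4)[OF x]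
      edgeD[of w v] edgeD[of w' v] edgeD[of x w] edgeD[of x w']
    by (auto simp: four_cycle_def insert_commute)
  then have "{w', x} \<in> cls {w, v}"
    using four_cycle_class[of v w x w'] arcD(1,2)[OF w] by (simp add: insert_commute)
  then show ?thesis using cls_eq by (simp add: insert_commute)
qed

lemma square_bottom:
  assumes "v < n" "w \<in> set (ins v)" "w' \<in> set (ins v)" "w \<noteq> w'"
  shows "\<exists>x. x \<in> set (ins w) \<and> x \<in> set (ins w')"
proof -
  have w: "arc (cls {w, v}) w v" and w': "arc (cls {w', v}) w' v" using ins_arc assms by blast+
  have "cls {w, v} \<noteq> cls {w', v}" using w w' assms(4) arc_low_unique by metis
  then obtain y where "arc (cls {w', v}) y w" "arc (cls {w, v}) y w'" using inc_square w w' by blast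
  then show ?thesis using arc_ins by blast
qed

definition decode :: "nat \<Rightarrow> nat \<Rightarrow> nat set set list" where
  "decode v S = map ((!) (inlist v)) (bits (indeg v) S)"

lemma inj_inlist: "v < n \<Longrightarrow> inj_on ((!) (inlist v)) {..<indeg v}"
  using distinct_inlist by (simp add: inj_on_def nth_eq_iff_index_eq)

lemma distinct_decode: "v < n \<Longrightarrow> distinct (decode v S)"
  unfolding decode_def distinct_map
  using inj_on_subset[OF inj_inlist set_bits_subset] distinct_bits by blast

lemma set_decode: "set (decode v S) = (!) (inlist v) ` set (bits (indeg v) S)"
  by (simp add: decode_def)

lemma set_decode_subset: "v < n \<Longrightarrow> set (decode v S) \<subseteq> inc v"
proof
  fix F assume v: "v < n" and "F \<in> set (decode v S)"
  then obtain i where "i \<in> set (bits (indeg v) S)" "F = inlist v ! i" by (auto simp: set_decode)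
  moreover from this have "i < length (inlist v)" using set_bits_subset by auto
  ultimately show "F \<in> inc v" using nth_mem set_inlist[OF v] by blast
qed

lemma length_decode: "length (decode v S) = length (bits (indeg v) S)"
  by (simp add: decode_def)

lemma length_decode_le: "length (decode v S) \<le> indeg v"
  by (simp add: length_decode length_bits_le)

lemma decode_inj:
  assumes "v < n" "S < 2 ^ indeg v" "T < 2 ^ indeg v" "set (decode v S) = set (decode v T)"
  shows "S = T"
  using assms inj_on_image_eq_iff[OF inj_inlist[OF assms(1)] set_bits_subset set_bits_subset]
    bits_inj by (metis set_decode)

lemma decode_exists:
  assumes "v < n" "L \<subseteq> inc v"
  shows "\<exists>S<2 ^ indeg v. set (decode v S) = L"
proof -
  have "inc v = (!) (inlist v) ` {..<indeg v}"
    using set_inlist[OF assms(1)] by (auto simp: set_conv_nth)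
  then obtain I where I: "I \<subseteq> {..<indeg v}" "L = (!) (inlist v) ` I"
    using assms(2) by (metis subset_imageE)
  then show ?thesis using mask_exists[OF I(1)] by (auto simp: set_decode)
qed

definition bottom :: "nat \<Rightarrow> nat \<Rightarrow> nat" where
  "bottom v S = (THE u. down v (decode v S) u)"

lemma bottom_eq: "down v (decode v S) u \<Longrightarrow> bottom v S = u"
  unfolding bottom_def by (rule the_equality) (simp_all add: down_unique)

lemma down_bottom:
  assumes "v < n"
  shows "down v (decode v S) (bottom v S)"
proof -
  obtain u where "down v (decode v S) u"
    using down_exists[OF distinct_decode set_decode_subset, OF assms assms] by blast
  then show ?thesis using bottom_eq by simp
qed

lemma bottom_less: "v < n \<Longrightarrow> bottom v S < n"
  using down_V[OF down_bottom] V_eq by simp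

lemma decode_out: "v < n \<Longrightarrow> set (decode v S) \<subseteq> outc (bottom v S)"
  using down_out down_bottom distinct_decode set_decode_subset by blast

lemma down_front:
  assumes "down v Fs a" "arc F w a" "down w Gs u" "distinct (F # Fs)" "set (F # Fs) \<subseteq> inc v"
  shows "\<exists>v'. arc F v' v \<and> down v' (Fs @ Gs) u"
proof -
  obtain v' where v': "arc F v' v" using assms(5) by (auto simp: inc_def)
  have "set Fs \<subseteq> inc v'" using inc_down[OF v'] assms(4,5) by fastforce
  moreover have "distinct Fs" using assms(4) by simp
  ultimately obtain b where b: "down v' Fs b" using down_exists by blast
  then obtain a' where a': "arc F b a'" "down v Fs a'"
    using down_shift[OF v' b] assms(4,5) by auto
  then have "a' = a" using down_unique assms(1) by blast
  then have "b = w" using arc_low_unique a' assms(2) by blast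
  then show ?thesis using v' b assms(3) by (auto simp: down_append)
qed

text \<open>The classes of the new order are moved to the front one after the other by
  \<open>down_front\<close>; hence the bottom of a cube depends only on its set of classes.\<close>

lemma down_permute:
  "down v Fs u \<Longrightarrow> distinct Fs \<Longrightarrow> set Fs \<subseteq> inc v \<Longrightarrow> distinct Gs \<Longrightarrow> set Gs = set Fs \<Longrightarrow> down v Gs u"
proof (induction Gs arbitrary: v Fs)
  case (Cons F Gs)
  then have "F \<in> set Fs" by auto
  then obtain As Bs where Fs: "Fs = As @ F # Bs" by (auto dest: split_list)
  then obtain a w where aw: "down v As a" "arc F w a" "down w Bs u"
    using Cons.prems(1) by (auto simp: down_append)
  obtain v' where v': "arc F v' v" "down v' (As @ Bs) u"
    using down_front[OF aw] Cons.prems(2,3) Fs by auto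
  have "down v' Gs u"
  proof (rule Cons.IH[OF v'(2)])
    show "distinct (As @ Bs)" "distinct Gs" using Cons.prems Fs by auto
    show "set (As @ Bs) \<subseteq> inc v'" using inc_down[OF v'(1)] Cons.prems(2,3) Fs by fastforce
    show "set Gs = set (As @ Bs)" using Cons.prems(2,4,5) Fs by auto
  qed
  then show ?case using v' by auto
qed auto

definition levels :: "nat \<Rightarrow> nat \<Rightarrow> nat \<Rightarrow> nat list" where
  "levels v S k = (let u = bottom v S in
     berge (indeg u) (\<lambda>i F. \<not> orthogonal E (inlist u ! i) F) (decode v S) k)"

definition solutions :: "nat \<Rightarrow> nat \<Rightarrow> nat list" where
  "solutions v S = levels v S (length (decode v S))"

lemma distinct_solutions: "distinct (solutions v S)"
  unfolding solutions_def levels_def Let_def using berge_correct by blast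

lemma solutions_iff:
  assumes "v < n"
  shows "L \<in> set (solutions v S) \<longleftrightarrow> L < 2 ^ indeg (bottom v S) \<and>
    minimal_hitting (\<lambda>X F. \<not> orthogonal E X F) (set (decode v S)) (set (decode (bottom v S) L))"
  using berge_correct[of "length (decode v S)" "decode v S"]
    minimal_hitting_image[OF inj_on_subset[OF inj_inlist[OF bottom_less[OF assms, of S]] set_bits_subset],
      of "\<lambda>X F. \<not> orthogonal E X F" "set (decode v S)"]
  unfolding solutions_def levels_def Let_def set_decode[of "bottom v S"] by auto

definition masks :: "nat \<Rightarrow> (nat \<times> nat) list" where
  "masks v = map (Pair v) [0..<2 ^ indeg v]"

text \<open>The records \<open>(v, S)\<close> that the algorithm attaches to the pair \<open>(u, L)\<close> after having
  processed the cubes in \<open>ps\<close>, most recent first.\<close>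

definition records :: "(nat \<times> nat) list \<Rightarrow> nat \<Rightarrow> nat \<Rightarrow> (nat \<times> nat) list" where
  "records ps u L = rev (filter (\<lambda>(v, S). bottom v S = u \<and> L \<in> set (solutions v S)) ps)"

definition cubes :: "(nat \<times> nat) list" where
  "cubes = concat (map masks [0..<n])"

lemma set_cubes: "set cubes = {(v, S). v < n \<and> S < 2 ^ indeg v}"
  by (auto simp: cubes_def masks_def)

lemma distinct_cubes: "distinct cubes"
  unfolding cubes_def
  by (rule distinct_concat_map) (auto simp: masks_def distinct_map inj_on_def)

text \<open>The cubes with bottom \<open>u\<close> correspond to the POFs outgoing from
  \<open>u\<close>: \<open>cube_top\<close> supplies a cube for each, and two cubes with equal
  bottom and equal classes have the same top, since a descent can be reversed.\<close>

lemma min_parallel_records: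
  assumes u: "u < n" and L: "L < 2 ^ indeg u"
  shows "distinct (map (\<lambda>(v, S). set (decode v S)) (records cubes u L))"
    and "set (map (\<lambda>(v, S). set (decode v S)) (records cubes u L)) =
      min_parallel E v0 (set (decode u L)) u"
proof -
  have set: "set (records cubes u L) =
    {(v, S). v < n \<and> S < 2 ^ indeg v \<and> bottom v S = u \<and> L \<in> set (solutions v S)}"
    by (auto simp: records_def set_cubes)
  have inj: "inj_on (\<lambda>(v, S). set (decode v S)) (set (records cubes u L))"
  proof (rule inj_onI, clarify)
    fix v S v' S'
    assume *: "(v, S) \<in> set (records cubes u L)" "(v', S') \<in> set (records cubes u L)"
      "set (decode v S) = set (decode v' S')"
    have v: "v < n" "v' < n" "S < 2 ^ indeg v" "S' < 2 ^ indeg v'" "bottom v S = u" "bottom v' S' = u"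
      using * set by auto
    have "down v (decode v S) u" using down_bottom v by blast
    moreover have "down v' (decode v S) u"
      using down_permute[OF down_bottom[OF v(2), of S'] distinct_decode[OF v(2)]
          set_decode_subset[OF v(2)] distinct_decode[OF v(1)] *(3)] v by simp
    ultimately have "v = v'" by (rule down_top_unique)
    moreover from this have "S = S'" using decode_inj[of v S S'] * v by simp
    ultimately show "v = v' \<and> S = S'" by simp
  qed
  have "distinct (records cubes u L)" by (simp add: records_def distinct_cubes)
  then show "distinct (map (\<lambda>(v, S). set (decode v S)) (records cubes u L))"
    using inj by (simp add: distinct_map)
  have Lu: "set (decode u L) \<subseteq> inc u" using set_decode_subset u by blast
  show "set (map (\<lambda>(v, S). set (decode v S)) (records cubes u L)) =
      min_parallel E v0 (set (decode u L)) u"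
  proof (intro set_eqI iffI)
    fix M assume "M \<in> set (map (\<lambda>(v, S). set (decode v S)) (records cubes u L))"
    then obtain v S where v: "v < n" "S < 2 ^ indeg v" "bottom v S = u" "L \<in> set (solutions v S)"
      "M = set (decode v S)"
      using set by auto
    have "pairwise (orthogonal E) M"
      using v set_decode_subset[OF v(1), of S] inc_orthogonal unfolding pairwise_def by blast
    moreover have "M \<subseteq> outc u" using decode_out v by blast
    ultimately show "M \<in> min_parallel E v0 (set (decode u L)) u"
      using solutions_iff[OF v(1), of L S] v by (simp add: min_parallel_eq[OF Lu])
  next
    fix M assume "M \<in> min_parallel E v0 (set (decode u L)) u"
    then have M: "M \<subseteq> outc u" "pairwise (orthogonal E) M"
      "minimal_hitting (\<lambda>X F. \<not> orthogonal E X F) M (set (decode u L))"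
      by (simp_all add: min_parallel_eq[OF Lu])
    obtain Fs where Fs: "set Fs = M" "distinct Fs"
      using finite_distinct_list finite_subset[OF M(1) finite_outc] by blast
    obtain v where v: "v \<in> V" "M \<subseteq> inc v" "down v Fs u"
      using cube_top[of Fs u] M Fs u V_eq by auto
    have vn: "v < n" using v V_eq by simp
    obtain S where S: "S < 2 ^ indeg v" "set (decode v S) = M" using decode_exists[OF vn v(2)] by blast
    have "bottom v S = u"
      using down_permute[OF v(3) Fs(2) _ distinct_decode[OF vn, of S]] v Fs S by (intro bottom_eq) auto
    moreover from this have "L \<in> set (solutions v S)" using solutions_iff[OF vn, of L S] S M L by simp
    ultimately have "(v, S) \<in> set (records cubes u L)" using S vn by (simp add: set)
    then show "M \<in> set (map (\<lambda>(v, S). set (decode v S)) (records cubes u L))" using S by force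
  qed
qed

section \<open>Size bounds\<close>

abbreviation d :: nat where
  "d \<equiv> dimension V E"

text \<open>The second exponent is \<open>d\<close> instead of the indegree of the bottom, which
  varies with \<open>S\<close>; this allows the summation over all masks. Rounding down loses
  nothing, as the quantities to be bounded are integers.\<close>

definition bound :: "nat \<Rightarrow> nat \<Rightarrow> nat" where
  "bound v S = nat \<lfloor>(3 / 2) ^ length (bits (indeg v) S) * (283 / 200 :: real) ^ d\<rfloor>"

lemma length_levels_le:
  assumes "v < n" "k \<le> length (decode v S)"
  shows "length (levels v S k) \<le> bound v S"
proof -
  have "real (length (levels v S k)) \<le>
    (3 / 2) ^ length (decode v S) * (283 / 200) ^ indeg (bottom v S)"
    unfolding levels_def Let_def by (rule length_berge_le) (fact assms)
  also have "\<dots> \<le> (3 / 2) ^ length (decode v S) * (283 / 200) ^ d"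
    using indeg_le[OF bottom_less[OF assms(1)]] by (intro mult_left_mono power_increasing) auto
  finally show ?thesis unfolding bound_def by (simp add: length_decode le_nat_floor)
qed

lemma bound_pos: "1 \<le> bound v S"
proof -
  have "1 \<le> (3 / 2) ^ length (bits (indeg v) S) * (283 / 200 :: real) ^ d"
    by (rule order_trans[OF _ mult_mono[of 1 _ 1]]) (auto intro: one_le_power)
  then show ?thesis unfolding bound_def by (simp add: le_nat_iff)
qed

lemma bound_le: "real (bound v S) \<le> (3 / 2) ^ length (bits (indeg v) S) * (283 / 200) ^ d"
  unfolding bound_def by (simp add: of_nat_nat)

lemma sum_bound_le: "real (\<Sum>v<n. \<Sum>S<2 ^ indeg v. bound v S) \<le> real n * (1415 / 400) ^ d"
proof -
  have "real (\<Sum>v<n. \<Sum>S<2 ^ indeg v. bound v S) \<le>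
    (\<Sum>v<n. \<Sum>S<2 ^ indeg v. (3 / 2) ^ length (bits (indeg v) S) * (283 / 200) ^ d)"
    unfolding of_nat_sum by (intro sum_mono bound_le)
  also have "\<dots> = (\<Sum>v<n. (5 / 2) ^ indeg v * (283 / 200) ^ d)"
    using sum_masks[of "3 / 2"] by (simp flip: sum_distrib_right)
  also have "\<dots> \<le> (\<Sum>v<n. (5 / 2) ^ d * (283 / 200) ^ d)"
    using indeg_le by (intro sum_mono mult_right_mono power_increasing) auto
  also have "\<dots> = real n * (1415 / 400) ^ d"
    by (simp flip: power_mult_distrib)
  finally show ?thesis .
qed

text \<open>Every edge is an arc into one of its ends, and at most \<open>d\<close> arcs enter a
  vertex.\<close>

lemma sum_degrees_le: "(\<Sum>v<n. length (A ! v)) \<le> 2 * n * d"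
proof -
  have "length (A ! v) \<le> (\<Sum>w<n. of_bool (w \<in> set (ins v))) + (\<Sum>w<n. of_bool (v \<in> set (ins w)))"
    if v: "v < n" for v
  proof -
    have "length (A ! v) = card (set (A ! v))" using distinct_card distinct_neighbours v by metis
    also have "\<dots> \<le> card ({w. w < n \<and> w \<in> set (ins v)} \<union> {w. w < n \<and> v \<in> set (ins w)})"
    proof (rule card_mono)
      show "set (A ! v) \<subseteq> {w. w < n \<and> w \<in> set (ins v)} \<union> {w. w < n \<and> v \<in> set (ins w)}"
      proof
        fix w assume "w \<in> set (A ! v)"
        then have e: "{v, w} \<in> E" using neighbours v by simp
        then show "w \<in> {w. w < n \<and> w \<in> set (ins v)} \<union> {w. w < n \<and> v \<in> set (ins w)}"
          using bipartite[OF e root] edge_less[OF e] by (auto simp: set_ins insert_commute)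
      qed
    qed auto
    also have "\<dots> \<le> card {w. w < n \<and> w \<in> set (ins v)} + card {w. w < n \<and> v \<in> set (ins w)}"
      by (rule card_Un_le)
    also have "\<dots> = (\<Sum>w<n. of_bool (w \<in> set (ins v))) + (\<Sum>w<n. of_bool (v \<in> set (ins w)))"
      by (simp add: sum.If_cases of_bool_def Int_def lessThan_def)
    finally show ?thesis .
  qed
  then have "(\<Sum>v<n. length (A ! v)) \<le>
    (\<Sum>v<n. (\<Sum>w<n. of_bool (w \<in> set (ins v))) + (\<Sum>w<n. of_bool (v \<in> set (ins w))))"
    by (intro sum_mono) auto
  also have "\<dots> = 2 * (\<Sum>v<n. \<Sum>w<n. of_bool (w \<in> set (ins v)))"
    using sum.swap[of "\<lambda>v w. of_bool (v \<in> set (ins w)) :: nat" "{..<n}" "{..<n}"]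
    by (simp only: sum.distrib mult_2)
  also have "\<dots> \<le> 2 * (\<Sum>v<n. d)"
  proof (intro mult_le_mono2 sum_mono)
    fix v assume "v \<in> {..<n}"
    then have v: "v < n" by simp
    have "(\<Sum>w<n. of_bool (w \<in> set (ins v))) = card {w. w < n \<and> w \<in> set (ins v)}"
      by (simp add: sum.If_cases of_bool_def Int_def lessThan_def)
    also have "\<dots> \<le> card (set (ins v))" by (intro card_mono) auto
    also have "\<dots> \<le> indeg v" unfolding indeg_def by (rule card_length)
    finally show "(\<Sum>w<n. of_bool (w \<in> set (ins v))) \<le> d" using indeg_le[OF v] by simp
  qed
  finally show ?thesis by simp
qed

section \<open>Breadth-first search\<close>

text \<open>The list retains the processed vertices, those before position \<open>h\<close>, so that
  in the end it orders all vertices by depth; the labelling relies on this order.\<close>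

definition bfs :: "nat list \<Rightarrow> nat \<Rightarrow> bool" where
  "bfs qs h \<longleftrightarrow> distinct qs \<and> set qs \<subseteq> V \<and> v0 \<in> set qs \<and>
     (\<forall>i j. i \<le> j \<longrightarrow> j < length qs \<longrightarrow> depth (qs ! i) \<le> depth (qs ! j)) \<and>
     (\<forall>x\<in>set qs. h < length qs \<longrightarrow> depth x \<le> depth (qs ! h) + 1) \<and>
     (\<forall>i<h. i < length qs \<longrightarrow> set (A ! (qs ! i)) \<subseteq> set qs)"

lemma card_V: "card V = n"
  using arg_cong[OF V_eq, of card] by simp

lemma bfs_less: "bfs qs h \<Longrightarrow> i < length qs \<Longrightarrow> qs ! i < n"
  using nth_mem V_eq unfolding bfs_def by blast

text \<open>A predecessor of \<open>y\<close> is less deep than the head, so it occurs before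
  position \<open>h\<close> and its neighbours have been entered. Consequently a vertex found
  missing is deeper than the head.\<close>

lemma bfs_visited:
  assumes b: "bfs qs h" and "h < length qs" and "y \<in> V" "depth y \<le> depth (qs ! h)"
  shows "y \<in> set qs"
  using assms(3,4)
proof (induction "depth y" arbitrary: y rule: less_induct)
  case less
  show ?case
  proof (cases "y = v0")
    case True
    then show ?thesis using b by (simp add: bfs_def)
  next
    case False
    then obtain w where w: "{w, y} \<in> E" "depth w + 1 = depth y" using pred root less.prems by metis
    then have "w \<in> set qs" using less edgeD[OF w(1)] by simp
    then obtain i where i: "i < length qs" "w = qs ! i" by (auto simp: in_set_conv_nth)
    have "\<not> h \<le> i"
    proof
      assume "h \<le> i"
      then have "depth (qs ! h) \<le> depth (qs ! i)" using b i by (auto simp: bfs_def)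
      then show False using w i less.prems by simp
    qed
    then have "set (A ! w) \<subseteq> set qs" using b i by (auto simp: bfs_def)
    moreover have "y \<in> set (A ! w)" using neighbours[of w] w(1) edge_less by auto
    ultimately show ?thesis by blast
  qed
qed

lemma bfs_append:
  assumes b: "bfs qs h" and h: "h < length qs" and w: "w \<in> set (A ! (qs ! h))" "w \<notin> set qs"
  shows "depth w = depth (qs ! h) + 1" "bfs (qs @ [w]) h"
proof -
  have "qs ! h < n" using bfs_less b h by blast
  then have e: "{qs ! h, w} \<in> E" using w neighbours by simp
  then have "w \<in> V" using edgeD by blast
  then have "\<not> depth w \<le> depth (qs ! h)" using bfs_visited[OF b h] w by blast
  then show d: "depth w = depth (qs ! h) + 1" using bipartite[OF e root] by simp
  show "bfs (qs @ [w]) h"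
    using b h d w \<open>w \<in> V\<close> unfolding bfs_def
    by (auto simp: nth_append less_Suc_eq)
qed

lemma bfs_next:
  assumes "bfs qs h" and "h < length qs" and "set (A ! (qs ! h)) \<subseteq> set qs"
  shows "bfs qs (Suc h)"
proof -
  have "depth x \<le> depth (qs ! Suc h) + 1" if "x \<in> set qs" "Suc h < length qs" for x
  proof -
    have "depth x \<le> depth (qs ! h) + 1" using assms that by (auto simp: bfs_def)
    moreover have "depth (qs ! h) \<le> depth (qs ! Suc h)" using assms that by (auto simp: bfs_def)
    ultimately show ?thesis by simp
  qed
  then show ?thesis using assms by (auto simp: bfs_def less_Suc_eq)
qed

lemma bfs_complete:
  assumes b: "bfs qs (length qs)"
  shows "set qs = V"
proof -
  have "y \<in> set qs" if "y \<in> V" for y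
    using that
  proof (induction "depth y" arbitrary: y rule: less_induct)
    case less
    show ?case
    proof (cases "y = v0")
      case True
      then show ?thesis using b by (simp add: bfs_def)
    next
      case False
      then obtain w where w: "{w, y} \<in> E" "depth w + 1 = depth y" using pred root less.prems by metis
      then have "w \<in> set qs" using less edgeD[OF w(1)] by simp
      then have "set (A ! w) \<subseteq> set qs" using b by (auto simp: bfs_def in_set_conv_nth)
      moreover have "y \<in> set (A ! w)" using neighbours[of w] w(1) edge_less by auto
      ultimately show ?thesis by blast
    qed
  qed
  then show ?thesis using b by (auto simp: bfs_def)
qed

text \<open>The queue cannot run empty before all \<open>n\<close> vertices are found, so the search
  can be a loop of exactly \<open>n\<close> rounds without a test for emptiness.\<close>

lemma bfs_index:
  assumes "bfs qs h" "h \<le> length qs" "h < n"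
  shows "h < length qs"
proof (rule ccontr)
  assume "\<not> h < length qs"
  then have "h = length qs" using assms(2) by simp
  then have "set qs = V" using bfs_complete assms(1) by simp
  then have "length qs = n" using distinct_card[of qs] assms(1) card_V by (simp add: bfs_def)
  then show False using \<open>h = length qs\<close> assms(3) by simp
qed

lemma bfs_init: "bfs [v0] 0"
  using root by (auto simp: bfs_def)

section \<open>The program: preprocessing\<close>

text \<open>Covers the numbers that are computed rather than copied, namely row offsets, table
  addresses and powers of two up to \<open>n\<close>, and also the offsets in the input.\<close>

definition mem_bound :: nat where
  "mem_bound = Suc n * Suc n"

text \<open>Two-dimensional arrays have rows of length \<open>n + 1\<close>; the array \<open>M\<close> holds the row offsets.\<close>

definition row :: "nat \<Rightarrow> nat \<Rightarrow> nat" where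
  "row u i = u * Suc n + i"

lemma row_eq_iff:
  assumes "i \<le> n" "j \<le> n"
  shows "row u i = row v j \<longleftrightarrow> u = v \<and> i = j"
proof
  assume "row u i = row v j"
  then have "(u * Suc n + i) div Suc n = (v * Suc n + j) div Suc n"
    "(u * Suc n + i) mod Suc n = (v * Suc n + j) mod Suc n" by (simp_all only: row_def)
  then show "u = v \<and> i = j" using assms by (simp del: mult_Suc_right)
qed simp

definition input_ok :: "memory \<Rightarrow> bool" where
  "input_ok s \<longleftrightarrow> s ''n'' 0 = n \<and> s ''root'' 0 = v0 \<and> (\<forall>u\<le>n. s ''off'' u = offset A u) \<and>
     (\<forall>u<n. \<forall>i<length (A ! u). s ''nbr'' (offset A u + i) = A ! u ! i)"

definition rows_ok :: "memory \<Rightarrow> bool" where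
  "rows_ok s \<longleftrightarrow> (\<forall>u\<le>n. s ''M'' u = u * Suc n)"

lemma offset_Suc: "u < n \<Longrightarrow> offset A (Suc u) = offset A u + length (A ! u)"
  by (simp add: offset_def take_Suc_conv_app_nth)

lemma concat_nth_offset:
  assumes "u < n" "i < length (A ! u)"
  shows "offset A u + i < length (concat A)" "concat A ! (offset A u + i) = A ! u ! i"
proof -
  have "A = take u A @ A ! u # drop (Suc u) A" using id_take_nth_drop[OF assms(1)] .
  then have c: "concat A = concat (take u A) @ A ! u @ concat (drop (Suc u) A)"
    by (metis concat.simps(2) concat_append)
  show "offset A u + i < length (concat A)"
    using arg_cong[OF c, of length] assms by (simp add: offset_def)
  show "concat A ! (offset A u + i) = A ! u ! i"
    unfolding offset_def using assms by (subst c) (simp add: nth_append)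
qed

lemma offset_le: "u \<le> n \<Longrightarrow> offset A u \<le> length (concat A)"
  unfolding offset_def by (metis append_take_drop_id concat_append length_append le_add1)

lemma input_ok_initial: "input_ok (input_memory A v0)"
  unfolding input_ok_def
  using concat_nth_offset by (auto simp: input_memory_def cells_def simp del: upt_Suc)

text \<open>The machine cannot multiply, so the row offsets are tabulated by repeated
  addition.\<close>

definition rows_prog :: com where
  "rows_prog = ''N'' ::= Add (var ''n'') (Const 1) ;;
     For ''v'' (Const 0) (var ''n'')
       (Put ''M'' (Add (var ''v'') (Const 1)) (Add (Get ''M'' (var ''v'')) (var ''N'')))"

lemma mods_rows_prog [simp]: "mods rows_prog = {''N'', ''v'', ''M''}"
  by (auto simp: rows_prog_def)

lemma wp_rows:
  assumes "input_ok s" and "s ''M'' 0 = 0"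
  shows "wp mem_bound rows_prog (\<lambda>t s'. rows_ok s' \<and> t \<le> 3 + 3 * n) s"
proof -
  have n: "s ''n'' 0 = n" using assms by (simp add: input_ok_def)
  show ?thesis
    unfolding rows_prog_def
    apply (simp add: n)
    apply (rule wp_For_const[where l = 0 and h = n and T = 1 and
        I = "\<lambda>k s. \<forall>u\<le>k. s ''M'' u = u * Suc n"])
    subgoal by simp
    subgoal by simp
    subgoal by simp
    subgoal using n by simp
    subgoal using assms by simp
    subgoal premises p for k s'
    proof -
      have "Suc k * Suc n \<le> Suc n * Suc n" using p(1) by (intro mult_le_mono1) simp
      then show ?thesis
        using p by (auto simp: mem_bound_def le_Suc_eq)
    qed
    subgoal by (simp add: rows_ok_def)
    done
qed

definition edges :: "com \<Rightarrow> com" where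
  "edges c = For ''e'' (Get ''off'' (var ''v'')) (Get ''off'' (Add (var ''v'') (Const 1)))
     (''w'' ::= Get ''nbr'' (var ''e'') ;; c)"

lemma mods_edges [simp]: "mods (edges c) = {''e'', ''w''} \<union> mods c"
  by (auto simp: edges_def)

lemma wp_edges:
  assumes ok: "input_ok s" and v: "s ''v'' 0 = v" "v < n"
    and c: "''e'' \<notin> mods c" "''v'' \<notin> mods c" "''off'' \<notin> mods c" "''nbr'' \<notin> mods c"
    and I0: "I 0 s"
    and stable: "\<And>k s x y. I k s \<Longrightarrow> I k (s(''e'' := x, ''w'' := y))"
    and body: "\<And>k s'. k < length (A ! v) \<Longrightarrow> I k s' \<Longrightarrow> s' ''e'' 0 = offset A v + k \<Longrightarrow>
      s' ''w'' 0 = A ! v ! k \<Longrightarrow> (\<And>X. X \<notin> insert ''e'' (insert ''w'' (mods c)) \<Longrightarrow> s' X = s X) \<Longrightarrow>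
      wp B c (\<lambda>t s''. t \<le> T \<and> I (Suc k) s'') s'"
    and post: "\<And>t s'. I (length (A ! v)) s' \<Longrightarrow>
      (\<And>X. X \<notin> insert ''e'' (insert ''w'' (mods c)) \<Longrightarrow> s' X = s X) \<Longrightarrow>
      t \<le> 2 + length (A ! v) * (T + 3) \<Longrightarrow> Q t s'"
  shows "wp B (edges c) Q s"
  unfolding edges_def
proof (rule wp_For_const[where l = "offset A v" and h = "length (A ! v)" and T = "T + 1" and I = I])
  have off: "s ''off'' v = offset A v" "s ''off'' (Suc v) = offset A v + length (A ! v)"
    using ok v by (simp_all add: input_ok_def offset_Suc)
  have stable1: "I k (s(''e'' := x))" if "I k s" for k s x
    using stable[OF that, of x "s ''w''"] by (simp add: fun_upd_idem)
  have stable2: "I k (s(''w'' := x))" if "I k s" for k s x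
    using stable[OF that, of "s ''e''" x] by (simp add: fun_upd_idem)
  show "aval (Get ''off'' (var ''v'')) s = offset A v" using off v by simp
  show "aval (Get ''off'' (Add (var ''v'') (Const 1))) s' = offset A v + length (A ! v)"
    if "\<And>X. X \<notin> insert ''e'' (mods (''w'' ::= Get ''nbr'' (var ''e'') ;; c)) \<Longrightarrow> s' X = s X" for s'
    using that[of "''v''"] that[of "''off''"] c off v by simp
  show "I 0 (s(''e'' := (s ''e'')(0 := offset A v)))" using I0 by (rule stable1)
  show "''e'' \<notin> mods (''w'' ::= Get ''nbr'' (var ''e'') ;; c)" using c by simp
  show "wp B (''w'' ::= Get ''nbr'' (var ''e'') ;; c)
      (\<lambda>t s''. t \<le> T + 1 \<and> I (Suc k) (s''(''e'' := (s'' ''e'')(0 := Suc (offset A v + k))))) s'"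
    if k: "k < length (A ! v)" "I k s'" "s' ''e'' 0 = offset A v + k"
      "\<And>X. X \<notin> insert ''e'' (mods (''w'' ::= Get ''nbr'' (var ''e'') ;; c)) \<Longrightarrow> s' X = s X" for k s'
  proof -
    have "s' ''nbr'' (offset A v + k) = A ! v ! k"
      using that(4)[of "''nbr''"] c ok v k(1) by (simp add: input_ok_def)
    then have "wp B c (\<lambda>t s''. t \<le> T \<and> I (Suc k) s'') (s'(''w'' := (s' ''w'')(0 := A ! v ! k)))"
      using k by (intro body stable2) auto
    then have "wp B c (\<lambda>t s''. 1 + t \<le> T + 1 \<and> I (Suc k) (s''(''e'' := (s'' ''e'')(0 := Suc (offset A v + k)))))
      (s'(''w'' := (s' ''w'')(0 := A ! v ! k)))"
      by (rule wp_frame) (simp add: stable1)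
    then show ?thesis using k \<open>s' ''nbr'' (offset A v + k) = A ! v ! k\<close> by simp
  qed
  show "Q t s'" if "I (length (A ! v)) s'" "s' ''e'' 0 = offset A v + length (A ! v)"
    "\<And>X. X \<notin> insert ''e'' (mods (''w'' ::= Get ''nbr'' (var ''e'') ;; c)) \<Longrightarrow> s' X = s X"
    "t \<le> 2 + length (A ! v) * (T + 1 + 2)" for t s'
    by (rule post) (use that(1,4) in \<open>auto simp: algebra_simps intro: that(3)\<close>)
qed simp

text \<open>\<open>D\<close> holds the depth plus one, so that 0, the initial content, means
  unvisited.\<close>

definition bfs_prog :: com where
  "bfs_prog =
     Put ''D'' (var ''root'') (Const 1) ;; Put ''Q'' (Const 0) (var ''root'') ;; ''t'' ::= Const 1 ;;
     For ''h'' (Const 0) (var ''n'')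
       (''v'' ::= Get ''Q'' (var ''h'') ;;
        edges (ifonly (Lt (Get ''D'' (var ''w'')) (Const 1))
          (Put ''D'' (var ''w'') (Add (Get ''D'' (var ''v'')) (Const 1)) ;;
           Put ''Q'' (var ''t'') (var ''w'') ;; incr ''t'')))"

lemma mods_bfs_prog [simp]: "mods bfs_prog = {''D'', ''Q'', ''t'', ''h'', ''v'', ''e'', ''w''}"
  by (auto simp: bfs_prog_def)

definition queue_ok :: "nat list \<Rightarrow> memory \<Rightarrow> bool" where
  "queue_ok qs s \<longleftrightarrow> s ''t'' 0 = length qs \<and> (\<forall>i<length qs. s ''Q'' i = qs ! i) \<and>
     (\<forall>v<n. s ''D'' v = (if v \<in> set qs then Suc (depth v) else 0))"

definition order_ok :: "nat list \<Rightarrow> bool" where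
  "order_ok qs \<longleftrightarrow> distinct qs \<and> set qs = {..<n} \<and> length qs = n \<and>
     (\<forall>i j. i \<le> j \<longrightarrow> j < n \<longrightarrow> depth (qs ! i) \<le> depth (qs ! j))"

lemma bfs_order:
  assumes "bfs qs n" "n \<le> length qs"
  shows "order_ok qs"
proof -
  have "length qs \<le> n"
    using assms distinct_card[of qs] card_mono[OF finite_V, of "set qs"] card_V by (simp add: bfs_def)
  then have l: "length qs = n" using assms by simp
  then have "set qs = {..<n}" using bfs_complete[of qs] assms(1) V_eq by simp
  moreover have "depth (qs ! i) \<le> depth (qs ! j)" if "i \<le> j" "j < n" for i j
    using assms(1) that l unfolding bfs_def by simp
  moreover have "distinct qs" using assms(1) unfolding bfs_def by simp
  ultimately show ?thesis using l unfolding order_ok_def by blast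
qed

lemma sum_order:
  assumes "order_ok qs"
  shows "(\<Sum>i<n. f (qs ! i)) = (\<Sum>v<n. f v)"
proof -
  have "bij_betw ((!) qs) {..<n} {..<n}"
    by (rule bij_betw_nth) (use assms in \<open>unfold order_ok_def, blast, metis, metis\<close>)
  then show ?thesis by (rule sum.reindex_bij_betw)
qed

lemma wp_bfs:
  assumes ok: "input_ok s" and "\<And>v. s ''D'' v = 0"
  shows "wp mem_bound bfs_prog
    (\<lambda>t s'. (\<exists>qs. order_ok qs \<and> queue_ok qs s') \<and> t \<le> 5 + 5 * n + 14 * (n * d)) s"
proof -
  have n: "s ''n'' 0 = n" "s ''root'' 0 = v0" using ok by (simp_all add: input_ok_def)
  \<comment> \<open>The price of the rounds done so far depends only on the first \<open>h\<close>
    queue entries, which later insertions do not change. At the end the order becomes irrelevant and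
    \<open>sum_degrees_le\<close> applies.\<close>
  define T where "T = (\<lambda>h qs. \<Sum>i<h. 5 + 7 * length (A ! (qs ! i)))"
  show ?thesis
    unfolding bfs_prog_def
    apply (simp add: n)
    apply (rule wp_For_time[where l = 0 and h = n and
        I = "\<lambda>h t s. \<exists>qs. bfs qs h \<and> h \<le> length qs \<and> queue_ok qs s \<and> t \<le> T h qs"])
    subgoal by simp
    subgoal by simp
    subgoal by simp
    subgoal by (simp add: n)
    subgoal
      by (rule exI[of _ "[v0]"]) (use assms bfs_init in \<open>auto simp: queue_ok_def T_def\<close>)
    subgoal premises p for h t s'
    proof -
      note fr = p(4)
      obtain qs where qs: "bfs qs h" "h \<le> length qs" "queue_ok qs s'" "t \<le> T h qs"
        using p(2) by blast
      have h: "h < length qs" using bfs_index[OF qs(1,2) p(1)] .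
      let ?v = "qs ! h"
      have v: "?v < n" using bfs_less[OF qs(1) h] .
      have ok': "input_ok s'" using ok fr by (simp add: input_ok_def)
      have Q: "s' ''Q'' h = ?v" using qs(3) h by (simp add: queue_ok_def)
      let ?I = "\<lambda>k s. \<exists>qs'. bfs qs' h \<and> h < length qs' \<and> queue_ok qs' s \<and>
        (\<forall>i<k. A ! ?v ! i \<in> set qs') \<and> (\<forall>i\<le>h. qs' ! i = qs ! i)"
      show ?thesis
        apply (simp add: p(3) Q)
        apply (rule wp_edges[where v = ?v and T = 4 and I = ?I])
        subgoal using ok' by (simp add: input_ok_def)
        subgoal by simp
        subgoal by (rule v)
        subgoal by simp
        subgoal by simp
        subgoal by simp
        subgoal by simp
        subgoal using qs h by (intro exI[of _ qs]) (auto simp: queue_ok_def)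
        subgoal by (simp add: queue_ok_def)
        subgoal premises q for k s2
        proof -
          obtain qs' where qs': "bfs qs' h" "h < length qs'" "queue_ok qs' s2"
            "\<forall>i<k. A ! ?v ! i \<in> set qs'" "\<forall>i\<le>h. qs' ! i = qs ! i" using q(2) by blast
          let ?w = "A ! ?v ! k"
          have w: "?w \<in> set (A ! ?v)" using q(1) by simp
          then have "?w < n" using neighbours[OF v] edge_less by auto
          have D: "s2 ''D'' ?w = (if ?w \<in> set qs' then Suc (depth ?w) else 0)"
            using qs'(3) \<open>?w < n\<close> by (simp add: queue_ok_def)
          have v2: "s2 ''v'' 0 = ?v" using q(5)[of "''v''"] by simp
          show ?thesis
          proof (cases "?w \<in> set qs'")
            case True
            then show ?thesis using D qs' q(4) by (auto simp: less_Suc_eq)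
          next
            case False
            have "bfs (qs' @ [?w]) h" "depth ?w = depth ?v + 1"
              using bfs_append[OF qs'(1,2), of ?w] False w qs'(5) by auto
            moreover have "s2 ''D'' ?v = Suc (depth ?v)"
              using qs'(2,3,5) v by (metis le_refl nth_mem queue_ok_def)
            moreover have "queue_ok (qs' @ [?w]) (s2(''D'' := (s2 ''D'')(?w := Suc (Suc (depth ?v))),
              ''Q'' := (s2 ''Q'')(length qs' := ?w), ''t'' := (s2 ''t'')(0 := Suc (length qs'))))"
              using qs'(3) \<open>depth ?w = depth ?v + 1\<close> by (auto simp: queue_ok_def nth_append less_Suc_eq)
            moreover have "s2 ''t'' 0 = length qs'" using qs'(3) by (simp add: queue_ok_def)
            ultimately show ?thesis
              using D False q(4) qs' v2
              by simp (rule exI[of _ "qs' @ [?w]"], auto simp: less_Suc_eq nth_append)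
          qed
        qed
        subgoal premises q for t' s2
        proof -
          obtain qs' where qs': "bfs qs' h" "h < length qs'" "queue_ok qs' s2"
            "\<forall>i<length (A ! ?v). A ! ?v ! i \<in> set qs'" "\<forall>i\<le>h. qs' ! i = qs ! i" using q(1) by blast
          have "set (A ! (qs' ! h)) \<subseteq> set qs'" using qs'(4,5) by (auto simp: in_set_conv_nth)
          then have "bfs qs' (Suc h)" using bfs_next qs' by blast
          moreover have "T h qs' = T h qs" unfolding T_def using qs'(5) by (intro sum.cong) auto
          then have "t + Suc t' + 2 \<le> T (Suc h) qs'"
            using q(3) qs(4) qs'(5) by (simp add: T_def)
          moreover have "queue_ok qs' (s2(''h'' := (s2 ''h'')(0 := Suc h)))"
            using qs'(3) by (simp add: queue_ok_def)
          ultimately show ?thesis using qs'(2) by (auto intro!: exI[of _ qs'])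
        qed
        done
    qed
    subgoal premises p for t s'
    proof -
      obtain qs where qs: "bfs qs n" "n \<le> length qs" "queue_ok qs s'" "t \<le> T n qs"
        using p(1) by blast
      have o: "order_ok qs" using bfs_order qs by blast
      have "T n qs = 5 * n + 7 * (\<Sum>v<n. length (A ! v))"
        unfolding T_def using sum_order[OF o, of "\<lambda>v. 5 + 7 * length (A ! v)"]
        by (simp add: sum.distrib sum_distrib_left)
      also have "\<dots> \<le> 5 * n + 14 * (n * d)" using sum_degrees_le by simp
      finally show ?thesis using o qs by auto
    qed
    done
qed

definition depth_ok :: "memory \<Rightarrow> bool" where
  "depth_ok s \<longleftrightarrow> (\<forall>v<n. s ''D'' v = Suc (depth v))"

lemma queue_depth: "order_ok qs \<Longrightarrow> queue_ok qs s \<Longrightarrow> depth_ok s"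
  by (simp add: order_ok_def queue_ok_def depth_ok_def)

definition ins_ok :: "memory \<Rightarrow> bool" where
  "ins_ok s \<longleftrightarrow> (\<forall>v<n. s ''m'' v = indeg v \<and> (\<forall>i<indeg v. s ''I'' (row v i) = ins v ! i))"

lemma length_neighbours_le:
  assumes "v < n"
  shows "length (A ! v) \<le> n"
proof -
  have "set (A ! v) \<subseteq> {..<n}" using neighbours[OF assms] edge_less by auto
  then have "card (set (A ! v)) \<le> n" using card_mono[of "{..<n}"] by simp
  then show ?thesis using distinct_card[OF distinct_neighbours[OF assms]] by simp
qed

definition indeg_prog :: com where
  "indeg_prog = For ''v'' (Const 0) (var ''n'')
     (edges (ifonly (Lt (Get ''D'' (var ''w'')) (Get ''D'' (var ''v'')))
       (Put ''I'' (Add (Get ''M'' (var ''v'')) (Get ''m'' (var ''v''))) (var ''w'') ;;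
        Put ''m'' (var ''v'') (Add (Get ''m'' (var ''v'')) (Const 1)))))"

lemma mods_indeg_prog [simp]: "mods indeg_prog = {''v'', ''e'', ''w'', ''I'', ''m''}"
  by (auto simp: indeg_prog_def)

lemma wp_indeg:
  assumes ok: "input_ok s" "rows_ok s" "depth_ok s" and "\<And>v. s ''m'' v = 0"
  shows "wp mem_bound indeg_prog (\<lambda>t s'. ins_ok s' \<and> t \<le> 2 + 4 * n + 12 * (n * d)) s"
proof -
  have n: "s ''n'' 0 = n" using ok by (simp add: input_ok_def)
  let ?I = "\<lambda>k s. \<forall>v<n. s ''m'' v = (if v < k then indeg v else 0) \<and>
    (v < k \<longrightarrow> (\<forall>i<indeg v. s ''I'' (row v i) = ins v ! i))"
  show ?thesis
    unfolding indeg_prog_def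
    apply (rule wp_For[where l = 0 and h = n and T = "\<lambda>v. 2 + 6 * length (A ! v)" and I = ?I])
    subgoal by simp
    subgoal by simp
    subgoal by simp
    subgoal by (simp add: n)
    subgoal using assms by simp
    subgoal premises p for v s'
    proof -
      note fr = p(4)
      have ok': "input_ok s'" using ok fr by (simp add: input_ok_def)
      have D: "s' ''D'' u = Suc (depth u)" if "u < n" for u using ok fr that by (simp add: depth_ok_def)
      have M: "s' ''M'' u = u * Suc n" if "u < n" for u using ok fr that by (simp add: rows_ok_def)
      let ?fs = "\<lambda>k. filter (\<lambda>w. depth w < depth v) (take k (A ! v))"
      let ?J = "\<lambda>k s. s ''m'' v = length (?fs k) \<and> (\<forall>i<length (?fs k). s ''I'' (row v i) = ?fs k ! i) \<and>
        (\<forall>u<n. u \<noteq> v \<longrightarrow> s ''m'' u = (if u < v then indeg u else 0) \<and>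
          (u < v \<longrightarrow> (\<forall>i<indeg u. s ''I'' (row u i) = ins u ! i)))"
      show ?thesis
        apply (rule wp_edges[where v = v and T = 3 and I = ?J])
        subgoal by (rule ok')
        subgoal using p(3) by simp
        subgoal by (rule p(1))
        subgoal by simp
        subgoal by simp
        subgoal by simp
        subgoal by simp
        subgoal using p(1,2) by auto
        subgoal by simp
        subgoal premises q for k s2
        proof -
          let ?w = "A ! v ! k"
          have "?w \<in> set (A ! v)" using q(1) by simp
          then have w: "?w < n" using neighbours[OF p(1)] edge_less by auto
          have v2: "s2 ''v'' 0 = v" using q(5)[of "''v''"] p(3) by simp
          have D2: "s2 ''D'' ?w = Suc (depth ?w)" "s2 ''D'' v = Suc (depth v)"
            using q(5)[of "''D''"] D[OF w] D[OF p(1)] by simp_all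
          have M2: "s2 ''M'' v = v * Suc n" using q(5)[of "''M''"] M[OF p(1)] by simp
          have fs: "?fs (Suc k) = ?fs k @ (if depth ?w < depth v then [?w] else [])"
            using q(1) by (simp add: take_Suc_conv_app_nth)
          have "length (?fs k) \<le> length (take k (A ! v))" by (rule length_filter_le)
          then have lk: "length (?fs k) < n"
            using q(1) length_neighbours_le[OF p(1)] by simp
          have addr: "row u i = v * Suc n + length (?fs k) \<longleftrightarrow> u = v \<and> i = length (?fs k)"
            if "i \<le> n" for u i
            using row_eq_iff[of i "length (?fs k)" u v] that lk by (auto simp: row_def)
          have addr': "row u i \<noteq> v * Suc n + length (?fs k)" if "u \<noteq> v" "i < indeg u" "u < n" for u i
            using addr[of i u] that indeg_less[of u] by simp
          show ?thesis
          proof (cases "depth ?w < depth v")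
            case False
            then show ?thesis using q(2) D2 v2 q(4) unfolding fs by simp
          next
            case True
            have le: "i \<le> n" if "i \<le> length (?fs k)" for i using that lk by simp
            have m: "s2 ''m'' v = length (?fs k)" using q(2) by blast
            show ?thesis
              using q(2) True unfolding fs
              by (auto simp: D2 v2 q(4) M2 m addr[OF le] addr' nth_append less_Suc_eq
                  simp del: mult_Suc_right)
          qed
        qed
        subgoal premises q for t s2
        proof -
          have "?fs (length (A ! v)) = ins v" by (simp add: ins_def)
          then show ?thesis using q(1,3) p(1) by (auto simp: less_Suc_eq indeg_def)
        qed
        done
    qed
    subgoal premises p for t s'
    proof -
      have "t \<le> 2 + (4 * n + 6 * (\<Sum>v<n. length (A ! v)))"
        using p(4) by (simp add: sum.distrib sum_distrib_left sum_Suc)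
      then show ?thesis using sum_degrees_le p(1) by (simp add: ins_ok_def)
    qed
    done
qed

section \<open>Labels of all edges, propagated along squares\<close>

definition arcs :: "(nat \<times> nat) set" where
  "arcs = {(w, v). v < n \<and> w \<in> set (ins v)}"

text \<open>The contents of the edge tables once the labels of the edges in \<open>P\<close> are known: the label of
  the edge between two vertices (\<open>A\<close>), the lower (\<open>d\<close>) and the upper (\<open>u\<close>) neighbour across a class,
  both shifted by 1, and the labels of the incoming edges (\<open>G\<close>).\<close>

definition tables :: "(nat \<times> nat) set \<Rightarrow> memory \<Rightarrow> bool" where
  "tables P s \<longleftrightarrow>
     (\<forall>a<n. \<forall>b<n. s ''A'' (row a b) = (if (a, b) \<in> P \<or> (b, a) \<in> P then label (cls {a, b}) else 0)) \<and>
     (\<forall>v<n. \<forall>w. (w, v) \<in> P \<longrightarrow> s ''d'' (row v (label (cls {w, v}))) = Suc w) \<and>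
     (\<forall>v<n. \<forall>c\<le>n. (\<forall>w. (w, v) \<in> P \<longrightarrow> label (cls {w, v}) \<noteq> c) \<longrightarrow> s ''d'' (row v c) = 0) \<and>
     (\<forall>w<n. \<forall>v. (w, v) \<in> P \<longrightarrow> s ''u'' (row w (label (cls {w, v}))) = Suc v) \<and>
     (\<forall>v<n. \<forall>i<indeg v. (ins v ! i, v) \<in> P \<longrightarrow> s ''G'' (row v i) = label (inlist v ! i))"

lemma tables_cong:
  "s' ''A'' = s ''A'' \<Longrightarrow> s' ''d'' = s ''d'' \<Longrightarrow> s' ''u'' = s ''u'' \<Longrightarrow> s' ''G'' = s ''G'' \<Longrightarrow>
    tables P s' \<longleftrightarrow> tables P s"
  unfolding tables_def by (simp only:)

lemma tables_update [simp]:
  "X \<notin> {''A'', ''d'', ''u'', ''G''} \<Longrightarrow> tables P (s(X := f)) \<longleftrightarrow> tables P s"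
  by (rule tables_cong) auto

lemma arcs_arc: "(w, v) \<in> arcs \<Longrightarrow> arc (cls {w, v}) w v"
  using ins_arc by (auto simp: arcs_def)

lemma arcs_less: "(w, v) \<in> arcs \<Longrightarrow> w < n \<and> v < n"
  using arcs_arc[THEN arcD(5)] V_eq by (auto simp: arcs_def)

lemma arcs_label_le: "(w, v) \<in> arcs \<Longrightarrow> label (cls {w, v}) \<le> n \<and> 0 < label (cls {w, v})"
  using label_bounds[OF arcD(1)[OF arcs_arc]] by (simp add: Suc_le_eq)

lemma arcs_label_eq:
  assumes "(w, v) \<in> arcs" "(w', v') \<in> arcs" "label (cls {w, v}) = label (cls {w', v'})"
  shows "cls {w, v} = cls {w', v'}"
  using label_inj assms arcD(1)[OF arcs_arc] by (auto dest: inj_onD)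

text \<open>Cells do not collide: a vertex has at most one arc of a given class in each direction,
  and labels are injective.\<close>

lemma tables_insert:
  assumes t: "tables P s" and P: "P \<subseteq> arcs" and v: "v < n" "i < indeg v"
    and c: "c = label (cls {ins v ! i, v})" and w: "w = ins v ! i"
    and s': "s' ''G'' = (s ''G'')(row v i := c)" "s' ''A'' = (s ''A'')(row v w := c, row w v := c)"
      "s' ''d'' = (s ''d'')(row v c := Suc w)" "s' ''u'' = (s ''u'')(row w c := Suc v)"
  shows "tables (insert (w, v) P) s'"
proof -
  have a: "(w, v) \<in> arcs" using v w by (simp add: arcs_def indeg_def)
  have wn: "w < n" using arcs_less a by blast
  have cn: "c \<le> n" "0 < c" using arcs_label_le[OF a] c w by auto
  have ne: "w \<noteq> v" using arcD(4)[OF arcs_arc[OF a]] by auto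
  have cw: "c = label (cls {w, v})" using c w by simp
  have 1: "s' ''A'' (row a b) = (if (a, b) \<in> insert (w, v) P \<or> (b, a) \<in> insert (w, v) P
      then label (cls {a, b}) else 0)" if "a < n" "b < n" for a b
  proof -
    have t': "s ''A'' (row a b) = (if (a, b) \<in> P \<or> (b, a) \<in> P then label (cls {a, b}) else 0)"
      using t that unfolding tables_def by blast
    have iff: "row a b = row v w \<longleftrightarrow> a = v \<and> b = w" "row a b = row w v \<longleftrightarrow> a = w \<and> b = v"
      using that wn v(1) by (simp_all add: row_eq_iff)
    have vw: "label (cls {v, w}) = c" using cw by (simp add: insert_commute)
    consider "a = v" "b = w" | "a = w" "b = v" | "\<not> (a = v \<and> b = w)" "\<not> (a = w \<and> b = v)"
      by blast
    then show ?thesis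
    proof cases
      case 1
      have "s' ''A'' (row a b) = c" unfolding s'(2) fun_upd_apply iff using 1 by simp
      moreover have "(b, a) \<in> insert (w, v) P" using 1 by blast
      moreover have "label (cls {a, b}) = c" unfolding 1 by (rule vw)
      ultimately show ?thesis by presburger
    next
      case 2
      have "s' ''A'' (row a b) = c" unfolding s'(2) fun_upd_apply iff using 2 by simp
      moreover have "(a, b) \<in> insert (w, v) P" using 2 by blast
      moreover have "label (cls {a, b}) = c" unfolding 2 by (rule cw[symmetric])
      ultimately show ?thesis by presburger
    next
      case 3
      have "s' ''A'' (row a b) = s ''A'' (row a b)"
        unfolding s'(2) fun_upd_apply iff by (simp only: 3 if_False)
      moreover have "(a, b) \<in> insert (w, v) P \<longleftrightarrow> (a, b) \<in> P" "(b, a) \<in> insert (w, v) P \<longleftrightarrow> (b, a) \<in> P"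
        using 3 by blast+
      ultimately show ?thesis unfolding t' by presburger
    qed
  qed
  have 2: "s' ''d'' (row x (label (cls {y, x}))) = Suc y" if "x < n" "(y, x) \<in> insert (w, v) P" for x y
  proof (cases "(y, x) = (w, v)")
    case True
    then show ?thesis using cw by (simp add: s')
  next
    case False
    then have yx: "(y, x) \<in> P" "(y, x) \<in> arcs" using that P by auto
    have "row x (label (cls {y, x})) \<noteq> row v c"
    proof
      assume "row x (label (cls {y, x})) = row v c"
      then have "x = v" "label (cls {y, x}) = label (cls {w, v})"
        using row_eq_iff[of "label (cls {y, x})" c x v] arcs_label_le[OF yx(2)] cn cw by auto
      then have "y = w"
        using arcs_label_eq[OF yx(2) a] arcs_arc[OF yx(2)] arcs_arc[OF a] arc_low_unique by metis
      then show False using False \<open>x = v\<close> by simp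
    qed
    then show ?thesis using t yx that by (simp add: s' tables_def)
  qed
  have 3: "s' ''d'' (row x k) = 0"
    if "x < n" "k \<le> n" "\<forall>y. (y, x) \<in> insert (w, v) P \<longrightarrow> label (cls {y, x}) \<noteq> k" for x k
  proof -
    have "row x k \<noteq> row v c" using that row_eq_iff[of k c x v] cn cw by auto
    then show ?thesis using t that by (simp add: s' tables_def)
  qed
  have 4: "s' ''u'' (row y (label (cls {y, x}))) = Suc x" if "y < n" "(y, x) \<in> insert (w, v) P" for x y
  proof (cases "(y, x) = (w, v)")
    case True
    then show ?thesis using cw by (simp add: s')
  next
    case False
    then have yx: "(y, x) \<in> P" "(y, x) \<in> arcs" using that P by auto
    have "row y (label (cls {y, x})) \<noteq> row w c"
    proof
      assume "row y (label (cls {y, x})) = row w c"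
      then have "y = w" "label (cls {y, x}) = label (cls {w, v})"
        using row_eq_iff[of "label (cls {y, x})" c y w] arcs_label_le[OF yx(2)] cn cw by auto
      then have "x = v"
        using arcs_label_eq[OF yx(2) a] arcs_arc[OF yx(2)] arcs_arc[OF a] arc_up_unique by metis
      then show False using False \<open>y = w\<close> by simp
    qed
    then show ?thesis using t yx that by (simp add: s' tables_def)
  qed
  have 5: "s' ''G'' (row x j) = label (inlist x ! j)"
    if "x < n" "j < indeg x" "(ins x ! j, x) \<in> insert (w, v) P" for x j
  proof (cases "x = v \<and> j = i")
    case True
    then show ?thesis using v c by (simp add: s' inlist_def indeg_def)
  next
    case False
    have "row x j \<noteq> row v i"
      using row_eq_iff[of j i x v] indeg_less[OF that(1)] indeg_less[OF v(1)] that v False by auto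
    moreover have "(ins x ! j, x) \<noteq> (w, v)"
      using False w v that distinct_ins[OF v(1)] by (auto simp: nth_eq_iff_index_eq indeg_def)
    then have "(ins x ! j, x) \<in> P" using that(3) by blast
    then have "s ''G'' (row x j) = label (inlist x ! j)"
      using t that(1,2) unfolding tables_def by blast
    ultimately show ?thesis by (simp add: s')
  qed
  show ?thesis unfolding tables_def
    by (intro conjI allI impI; (rule 1 2 3 4 5; assumption))
qed

text \<open>If \<open>w\<close> is the only lower neighbour, \<open>v\<close> is the gate of the
  class and the label is \<open>v + 1\<close>. Otherwise \<open>b\<close> is another lower
  neighbour, and the scan over the lower neighbours \<open>x\<close> of \<open>w\<close> finds the
  edge \<open>{x, b}\<close> opposite to \<open>{w, v}\<close>; adjacency is read off table
  \<open>A\<close>, where it shows as a nonzero label.\<close>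

definition label_step :: com where
  "label_step =
     ''w'' ::= Get ''I'' (Add (Get ''M'' (var ''v'')) (var ''i'')) ;;
     ''c'' ::= Add (var ''v'') (Const 1) ;;
     ifonly (Lt (Const 1) (Get ''m'' (var ''v'')))
      (''b'' ::= Get ''I'' (Get ''M'' (var ''v'')) ;;
       ifonly (Lt (var ''i'') (Const 1)) (''b'' ::= Get ''I'' (Add (Get ''M'' (var ''v'')) (Const 1))) ;;
       For ''j'' (Const 0) (Get ''m'' (var ''w''))
        (''x'' ::= Get ''I'' (Add (Get ''M'' (var ''w'')) (var ''j'')) ;;
         ''y'' ::= Get ''A'' (Add (Get ''M'' (var ''x'')) (var ''b'')) ;;
         ifonly (Lt (Const 0) (var ''y'')) (''c'' ::= var ''y''))) ;;
     Put ''G'' (Add (Get ''M'' (var ''v'')) (var ''i'')) (var ''c'') ;;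
     Put ''A'' (Add (Get ''M'' (var ''v'')) (var ''w'')) (var ''c'') ;;
     Put ''A'' (Add (Get ''M'' (var ''w'')) (var ''v'')) (var ''c'') ;;
     Put ''d'' (Add (Get ''M'' (var ''v'')) (var ''c'')) (Add (var ''w'') (Const 1)) ;;
     Put ''u'' (Add (Get ''M'' (var ''w'')) (var ''c'')) (Add (var ''v'') (Const 1))"

lemma mods_label_step [simp]: "mods label_step =
    {''w'', ''c'', ''b'', ''j'', ''x'', ''y'', ''G'', ''A'', ''d'', ''u''}"
  by (auto simp: label_step_def)

lemma wp_label_step:
  assumes ok: "rows_ok s" "ins_ok s" "tables P s" and P: "P \<subseteq> arcs"
    and v: "s ''v'' 0 = v" "v < n" and i: "s ''i'' 0 = i" "i < indeg v"
    and lower: "\<And>x w. (x, w) \<in> arcs \<Longrightarrow> depth w < depth v \<Longrightarrow> (x, w) \<in> P"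
  shows "wp mem_bound label_step
    (\<lambda>t s'. tables (insert (ins v ! i, v) P) s' \<and> t \<le> 13 + 6 * d) s"
proof -
  let ?w = "ins v ! i" and ?c = "label (cls {ins v ! i, v})"
  have win: "?w \<in> set (ins v)" using i by (simp add: indeg_def)
  have a: "(?w, v) \<in> arcs" using win v by (simp add: arcs_def)
  have wn: "?w < n" using arcs_less a by blast
  have M: "s ''M'' u = u * Suc n" if "u < n" for u using ok that by (simp add: rows_ok_def)
  have m: "s ''m'' u = indeg u" if "u < n" for u using ok that by (simp add: ins_ok_def)
  have I: "s ''I'' (u * Suc n + j) = ins u ! j" if "u < n" "j < indeg u" for u j
    using ok that by (simp add: ins_ok_def row_def)
  have fin: "tables (insert (?w, v) P) (s'(''G'' := (s' ''G'')(v * Suc n + i := ?c),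
      ''A'' := (s' ''A'')(v * Suc n + ?w := ?c, ?w * Suc n + v := ?c),
      ''d'' := (s' ''d'')(v * Suc n + ?c := Suc ?w), ''u'' := (s' ''u'')(?w * Suc n + ?c := Suc v)))"
    if "s' ''A'' = s ''A''" "s' ''G'' = s ''G''" "s' ''d'' = s ''d''" "s' ''u'' = s ''u''" for s'
    by (rule tables_insert[OF ok(3) P v(2) i(2) refl refl]) (simp_all add: that row_def)
  show ?thesis
  proof (cases "1 < indeg v")
    case False
    then have "indeg v = 1" using i by simp
    then have c: "?c = Suc v" using label_single[OF v(2)] win by simp
    show ?thesis
      using False fin[of "s(''w'' := (s ''w'')(0 := ?w), ''c'' := (s ''c'')(0 := Suc v))"] c
      by (simp add: label_step_def v i M m I wn del: mult_Suc_right)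
  next
    case True
    define b where "b = ins v ! (if i = 0 then 1 else 0)"
    have bin: "b \<in> set (ins v)"
      unfolding b_def by (rule nth_mem) (use True in \<open>auto simp: indeg_def\<close>)
    have "i < length (ins v)" "(if i = 0 then 1 else 0) < length (ins v)"
      using i(2) True by (auto simp: indeg_def)
    from nth_eq_iff_index_eq[OF distinct_ins[OF v(2)] this]
    have bw: "?w \<noteq> b" unfolding b_def by simp
    have b: "(b, v) \<in> arcs" using bin v by (simp add: arcs_def)
    have bn: "b < n" using arcs_less b by blast
    have depths: "depth b < depth v" "depth v = depth ?w + 1" "depth v = depth b + 1"
      using arcD(4)[OF arcs_arc[OF a]] arcD(4)[OF arcs_arc[OF b]] by auto
    have A: "s ''A'' (x * Suc n + b) = (if (x, b) \<in> arcs then ?c else 0)" if x: "x \<in> set (ins ?w)" for x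
    proof -
      have xw: "(x, ?w) \<in> arcs" using x wn by (simp add: arcs_def)
      then have xn: "x < n" and xd: "depth ?w = depth x + 1"
        using arcs_less arcD(4)[OF arcs_arc] by blast+
      \<comment> \<open>Table \<open>A\<close> is symmetric, so the reversed pair has to be excluded
        as well; comparing depths does this.\<close>
      have "(b, x) \<notin> P"
      proof
        assume "(b, x) \<in> P"
        then have "depth x = depth b + 1" using P arcD(4)[OF arcs_arc] by blast
        then show False using xd depths by simp
      qed
      moreover have "(x, b) \<in> P \<longleftrightarrow> (x, b) \<in> arcs" using lower[OF _ depths(1)] P by blast
      moreover have "cls {x, b} = cls {?w, v}" if "(x, b) \<in> arcs"
        using label_square[OF v(2) win bin bw x] arcD(3)[OF arcs_arc[OF that]] by simp
      ultimately show ?thesis using ok(3) xn bn by (auto simp: tables_def row_def)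
    qed
    obtain x0 where x0: "x0 \<in> set (ins ?w)" "x0 \<in> set (ins b)"
      using square_bottom[OF v(2) win bin bw] by blast
    \<comment> \<open>The value \<open>v + 1\<close> remains only until an opposite edge is met. All
      matches carry the same label, so overwriting does no harm, and \<open>x0\<close> guarantees a
      match.\<close>
    let ?found = "\<lambda>k. if \<exists>j<k. (ins ?w ! j, b) \<in> arcs then ?c else Suc v"
    have loop: "wp mem_bound (For ''j'' (Const 0) (Get ''m'' (var ''w''))
        (''x'' ::= Get ''I'' (Add (Get ''M'' (var ''w'')) (var ''j'')) ;;
         ''y'' ::= Get ''A'' (Add (Get ''M'' (var ''x'')) (var ''b'')) ;;
         ifonly (Lt (Const 0) (var ''y'')) (''c'' ::= var ''y'')))
       (\<lambda>t s'. s' ''c'' 0 = ?c \<and> t \<le> 2 + 6 * d) s1"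
      if s1: "\<And>X. X \<notin> {''w'', ''c'', ''b''} \<Longrightarrow> s1 X = s X" "s1 ''w'' 0 = ?w" "s1 ''c'' 0 = Suc v" "s1 ''b'' 0 = b"
      for s1
      apply (rule wp_For_const[where l = 0 and h = "indeg ?w" and T = 4 and
          I = "\<lambda>k s. s ''c'' 0 = ?found k"])
      subgoal by simp
      subgoal by simp
      subgoal by simp
      subgoal using s1 m wn by simp
      subgoal using s1 by simp
      subgoal premises p for k s'
      proof -
        have fr: "s' X = s X" if "X \<notin> {''w'', ''c'', ''b'', ''j'', ''x'', ''y''}" for X
          using p(4)[of X] s1(1)[of X] that by simp
        have w': "s' ''w'' 0 = ?w" "s' ''b'' 0 = b" using p(4) s1 by simp_all
        let ?x = "ins ?w ! k"
        have x: "?x \<in> set (ins ?w)" using p(1) by (simp add: indeg_def)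
        then have xn: "?x < n" using arcs_less[of ?x ?w] wn by (auto simp: arcs_def)
        have "(\<exists>j<Suc k. (ins ?w ! j, b) \<in> arcs) \<longleftrightarrow> (\<exists>j<k. (ins ?w ! j, b) \<in> arcs) \<or> (?x, b) \<in> arcs"
          by (auto simp: less_Suc_eq)
        moreover have "0 < ?c" using arcs_label_le a by blast
        ultimately show ?thesis
          using p(2,3) by (simp add: fr w' M wn I p(1) xn A[OF x] del: mult_Suc_right) blast
      qed
      subgoal premises p for t s'
      proof -
        obtain j where j: "j < indeg ?w" "ins ?w ! j = x0"
          using x0(1) by (auto simp: in_set_conv_nth indeg_def)
        have "(x0, b) \<in> arcs" using x0(2) bn by (simp add: arcs_def)
        then have "s' ''c'' 0 = ?c" using p(1) j by auto
        moreover have "indeg ?w * 6 \<le> 6 * d" using indeg_le[OF wn] by simp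
        ultimately show ?thesis using p(4) by simp
      qed
      done
    let ?loop = "For ''j'' (Const 0) (Get ''m'' (var ''w''))
        (''x'' ::= Get ''I'' (Add (Get ''M'' (var ''w'')) (var ''j'')) ;;
         ''y'' ::= Get ''A'' (Add (Get ''M'' (var ''x'')) (var ''b'')) ;;
         ifonly (Lt (Const 0) (var ''y'')) (''c'' ::= var ''y''))"
    have after: "wp mem_bound ?loop
      (\<lambda>t s'. t \<le> 2 + 6 * d \<and> s' ''c'' 0 = ?c \<and> s' ''w'' 0 = ?w \<and> s' ''v'' 0 = v \<and> s' ''i'' 0 = i \<and>
        (\<forall>u<n. s' ''M'' u = u * Suc n) \<and>
        s' ''A'' = s ''A'' \<and> s' ''G'' = s ''G'' \<and> s' ''d'' = s ''d'' \<and> s' ''u'' = s ''u'') s1"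
      if s1: "\<And>X. X \<notin> {''w'', ''c'', ''b''} \<Longrightarrow> s1 X = s X" "s1 ''w'' 0 = ?w" "s1 ''c'' 0 = Suc v" "s1 ''b'' 0 = b"
      for s1
      by (rule wp_frame[OF loop[OF s1]]) (use s1 v i M in simp_all)
    have I1: "s ''I'' (v * Suc n) = ins v ! 0" "s ''I'' (Suc (v * Suc n)) = ins v ! 1"
      using I[of v 0] I[of v 1] v True by simp_all
    show ?thesis
      unfolding label_step_def
      apply (simp add: v i M m I wn True[simplified] I1 del: mult_Suc_right)
      apply (intro conjI impI)
      subgoal
        by (rule wp_frame[OF after]) (use v i wn fin in \<open>auto simp: b_def simp del: mult_Suc_right\<close>)
      subgoal
        by (rule wp_frame[OF after]) (use v i wn fin in \<open>auto simp: b_def simp del: mult_Suc_right\<close>)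
      done
  qed
qed

definition label_prog :: com where
  "label_prog = For ''h'' (Const 0) (var ''n'')
     (''v'' ::= Get ''Q'' (var ''h'') ;; For ''i'' (Const 0) (Get ''m'' (var ''v'')) label_step)"

lemma mods_label_prog [simp]: "mods label_prog =
    {''h'', ''v'', ''i'', ''w'', ''c'', ''b'', ''j'', ''x'', ''y'', ''G'', ''A'', ''d'', ''u''}"
  by (auto simp: label_prog_def)

text \<open>In the order of the search, all vertices of smaller depth come strictly earlier, so the
  opposite edge already has its label when it is looked up.\<close>

lemma wp_label:
  assumes ok: "input_ok s" "rows_ok s" "ins_ok s" and qs: "order_ok qs" "\<forall>i<n. s ''Q'' i = qs ! i"
    and zero: "\<And>i. s ''A'' i = 0" "\<And>i. s ''d'' i = 0"
  shows "wp mem_bound label_prog (\<lambda>t s'. tables arcs s' \<and> t \<le> 2 + n * (5 + d * (15 + 6 * d))) s"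
proof -
  have n: "s ''n'' 0 = n" using ok by (simp add: input_ok_def)
  define P where "P = (\<lambda>h. {(w, v) \<in> arcs. \<exists>i<h. v = qs ! i})"
  have Psub: "P h \<subseteq> arcs" for h by (auto simp: P_def)
  have qn: "qs ! h < n" if "h < n" for h
  proof -
    have "set qs = {..<n}" "length qs = n" using qs(1) unfolding order_ok_def by blast+
    then show ?thesis using nth_mem[of h qs] that by (metis lessThan_iff)
  qed
  have pos: "\<exists>i<h. v = qs ! i" if "h < n" "v < n" "depth v < depth (qs ! h)" for v h
  proof -
    have "set qs = {..<n}" "length qs = n" using qs(1) unfolding order_ok_def by blast+
    then have "\<exists>i<n. v = qs ! i" using that(2) by (metis in_set_conv_nth lessThan_iff)
    then obtain i where i: "i < n" "v = qs ! i" by blast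
    have "\<not> h \<le> i"
    proof
      assume "h \<le> i"
      then have "depth (qs ! h) \<le> depth (qs ! i)" using qs(1) i(1) unfolding order_ok_def by blast
      then show False using that i by simp
    qed
    then show ?thesis using i by (intro exI[of _ i]) simp
  qed
  show ?thesis
    unfolding label_prog_def
    apply (rule wp_For_const[where l = 0 and h = n and T = "3 + d * (15 + 6 * d)" and
        I = "\<lambda>h s. tables (P h) s"])
    subgoal by simp
    subgoal by simp
    subgoal by simp
    subgoal by (simp add: n)
    subgoal using zero by (simp add: tables_def P_def)
    subgoal premises p for h s'
    proof -
      let ?v = "qs ! h"
      note v = qn[OF p(1)]
      have Q: "s' ''Q'' h = ?v" using qs(2) p(1,4) by simp
      let ?P = "\<lambda>i. P h \<union> {(ins ?v ! j, ?v) | j. j < i}"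
      have sub: "?P i \<subseteq> arcs" if "i \<le> indeg ?v" for i
        using that v Psub by (auto simp: arcs_def indeg_def)
      have PS: "P (Suc h) = ?P (indeg ?v)"
      proof -
        have "P (Suc h) = P h \<union> {(w, v) \<in> arcs. v = ?v}" by (auto simp: P_def less_Suc_eq)
        also have "{(w, v) \<in> arcs. v = ?v} = {(ins ?v ! j, ?v) | j. j < indeg ?v}"
          using v by (auto simp: arcs_def in_set_conv_nth indeg_def)
        finally show ?thesis .
      qed
      show ?thesis
        apply (simp add: p(3) Q)
        apply (rule wp_For_const[where l = 0 and h = "indeg ?v" and T = "13 + 6 * d" and
            I = "\<lambda>i s. tables (?P i) s"])
        subgoal by simp
        subgoal by simp
        subgoal by simp
        subgoal using ok(3) v p(4) by (simp add: ins_ok_def)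
        subgoal using p(2) by simp
        subgoal premises q for i s2
        proof -
          have fr: "s2 X = s X" if "X \<notin> insert ''h'' (insert ''v'' (insert ''i'' (mods label_step)))" for X
            using q(4)[of X] p(4)[of X] that by simp
          have v2: "s2 ''v'' 0 = ?v" using q(4)[of "''v''"] by simp
          have Pi: "?P (Suc i) = insert (ins ?v ! i, ?v) (?P i)" by (auto simp: less_Suc_eq)
          have low: "(x, w) \<in> ?P i" if "(x, w) \<in> arcs" "depth w < depth ?v" for x w
          proof -
            have "w < n" using arcs_less that by blast
            then show ?thesis using pos[OF p(1) _ that(2)] that by (auto simp: P_def)
          qed
          have ok2: "rows_ok s2" "ins_ok s2"
            using ok fr by (simp_all add: rows_ok_def ins_ok_def)
          have w: "wp mem_bound label_step
              (\<lambda>t s'. tables (insert (ins ?v ! i, ?v) (?P i)) s' \<and> t \<le> 13 + 6 * d) s2"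
            by (rule wp_label_step[OF ok2 q(2) sub v2 v _ q(1) low]) (use q(1,3) in simp_all)
          show ?thesis
            by (rule wp_frame[OF w], unfold Pi) simp
        qed
        subgoal premises q for t s2
        proof -
          have "indeg ?v * (13 + 6 * d + 2) \<le> d * (15 + 6 * d)"
            using indeg_le[OF v] by (intro mult_le_mono) auto
          then have "t \<le> 2 + d * (15 + 6 * d)" using q(4) by linarith
          then show ?thesis using q(1) unfolding PS by simp
        qed
        done
    qed
    subgoal premises p for t s'
    proof -
      have "P n = arcs"
      proof -
        have sq: "set qs = {..<n}" "length qs = n" using qs(1) unfolding order_ok_def by blast+
        have "\<exists>i<n. v = qs ! i" if "v < n" for v
          using sq that by (metis in_set_conv_nth lessThan_iff)
        then show ?thesis by (auto simp: P_def arcs_def)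
      qed
      then show ?thesis using p(1,4) by (simp add: algebra_simps)
    qed
    done
qed

text \<open>The table stops at the largest indegree, where the powers are still at most
  \<open>n\<close>. Recomputing it for every vertex adds only a multiple of \<open>n * d\<close> to
  the time.\<close>

definition powers_prog :: com where
  "powers_prog = Put ''p'' (Const 0) (Const 1) ;;
     For ''v'' (Const 0) (var ''n'') (For ''i'' (Const 0) (Get ''m'' (var ''v''))
       (Put ''p'' (Add (var ''i'') (Const 1)) (Add (Get ''p'' (var ''i'')) (Get ''p'' (var ''i'')))))"

lemma mods_powers_prog [simp]: "mods powers_prog = {''p'', ''v'', ''i''}"
  by (auto simp: powers_prog_def)

definition powers_ok :: "memory \<Rightarrow> bool" where
  "powers_ok s \<longleftrightarrow> (\<forall>v<n. \<forall>i\<le>indeg v. s ''p'' i = 2 ^ i)"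

lemma n_le_mem_bound: "n \<le> mem_bound"
  by (simp add: mem_bound_def)

lemma wp_powers:
  assumes ok: "input_ok s" "ins_ok s"
  shows "wp mem_bound powers_prog (\<lambda>t s'. powers_ok s' \<and> t \<le> 3 + n * (4 + 3 * d)) s"
proof -
  have n: "s ''n'' 0 = n" using ok by (simp add: input_ok_def)
  show ?thesis
    unfolding powers_prog_def
    apply (simp add: n)
    apply (rule wp_For_const[where l = 0 and h = n and T = "2 + 3 * d" and
        I = "\<lambda>k s. s ''p'' 0 = 1 \<and> (\<forall>v<k. \<forall>i\<le>indeg v. s ''p'' i = 2 ^ i)"])
    subgoal by simp
    subgoal by simp
    subgoal by simp
    subgoal by (simp add: n)
    subgoal by simp
    subgoal premises p for v s'
      apply (rule wp_For_const[where l = 0 and h = "indeg v" and T = 1 and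
          I = "\<lambda>i s. (\<forall>j\<le>i. s ''p'' j = 2 ^ j) \<and> (\<forall>v'<v. \<forall>i\<le>indeg v'. s ''p'' i = 2 ^ i)"])
      subgoal by simp
      subgoal by simp
      subgoal by simp
      subgoal using ok(2) p by (simp add: ins_ok_def)
      subgoal using p(2) by simp
      subgoal premises q for i s2
      proof -
        have "(2::nat) ^ Suc i \<le> 2 ^ indeg v" using q(1) by (intro power_increasing) auto
        then have "2 ^ i + 2 ^ i \<le> mem_bound"
          using two_power_indeg[OF p(1)] n_le_mem_bound by simp
        moreover have "(2::nat) ^ i + 2 ^ i = 2 ^ Suc i" by simp
        ultimately show ?thesis using q(2,3) by (auto simp: le_Suc_eq simp del: power_Suc)
      qed
      subgoal premises q for t s2
      proof -
        have "indeg v * 3 \<le> 3 * d" using indeg_le[OF p(1)] by simp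
        then have "t \<le> 2 + 3 * d" using q(4) by simp
        then show ?thesis using q(1) by (auto simp: less_Suc_eq)
      qed
      done
    subgoal premises p for t s'
      using p(1,4) by (auto simp: powers_ok_def algebra_simps)
    done
qed

definition cls_prog :: com where
  "cls_prog = For ''v'' (Const 0) (var ''n'')
     (edges (Put ''cls'' (var ''e'') (Get ''A'' (Add (Get ''M'' (var ''v'')) (var ''w'')))))"

lemma mods_cls_prog [simp]: "mods cls_prog = {''v'', ''e'', ''w'', ''cls''}"
  by (auto simp: cls_prog_def)

definition cls_ok :: "memory \<Rightarrow> bool" where
  "cls_ok s \<longleftrightarrow> (\<forall>u<n. \<forall>i<length (A ! u). s ''cls'' (offset A u + i) = label (cls {u, A ! u ! i}))"

lemma offset_less:
  assumes "u < v" "v \<le> n"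
  shows "offset A u + length (A ! u) \<le> offset A v"
  using assms
proof (induction v)
  case (Suc v)
  then show ?case using offset_Suc[of v] by (cases "u = v") auto
qed simp

lemma offset_inj:
  assumes "u < n" "i < length (A ! u)" "v < n" "k < length (A ! v)" "offset A u + i = offset A v + k"
  shows "u = v \<and> i = k"
  using assms offset_less[of u v] offset_less[of v u] by (cases u v rule: linorder_cases) auto

lemma wp_cls:
  assumes ok: "input_ok s" "rows_ok s" "tables arcs s"
  shows "wp mem_bound cls_prog (\<lambda>t s'. cls_ok s' \<and> t \<le> 2 + 4 * n + 8 * (n * d)) s"
proof -
  have n: "s ''n'' 0 = n" using ok by (simp add: input_ok_def)
  let ?I = "\<lambda>e s. \<forall>u<n. \<forall>i<length (A ! u). offset A u + i < e \<longrightarrow>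
    s ''cls'' (offset A u + i) = label (cls {u, A ! u ! i})"
  show ?thesis
    unfolding cls_prog_def
    apply (rule wp_For[where l = 0 and h = n and T = "\<lambda>v. 2 + 4 * length (A ! v)" and
        I = "\<lambda>v s. ?I (offset A v) s"])
    subgoal by simp
    subgoal by simp
    subgoal by simp
    subgoal by (simp add: n)
    subgoal by (simp add: offset_def)
    subgoal premises p for v s'
      apply (rule wp_edges[where v = v and T = 1 and I = "\<lambda>k s. ?I (offset A v + k) s"])
      subgoal using ok p(4) by (simp add: input_ok_def)
      subgoal using p(3) by simp
      subgoal by (rule p(1))
      subgoal by simp
      subgoal by simp
      subgoal by simp
      subgoal by simp
      subgoal using p(2) by simp
      subgoal by simp
      subgoal premises q for k s2
      proof -
        let ?w = "A ! v ! k"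
        have "?w \<in> set (A ! v)" using q(1) by simp
        then have e: "{v, ?w} \<in> E" using neighbours[OF p(1)] by simp
        note w = edge_less(2)[OF e]
        have "(v, ?w) \<in> arcs \<or> (?w, v) \<in> arcs"
          using bipartite[OF e root] w p(1) e by (auto simp: arcs_def set_ins insert_commute)
        then have "s ''A'' (row v ?w) = label (cls {v, ?w})"
          using ok(3) p(1) w by (auto simp: tables_def)
        moreover have "s2 ''A'' = s ''A''" "s2 ''M'' v = v * Suc n" "s2 ''v'' 0 = v"
          using q(5) p ok(2) by (simp_all add: rows_ok_def)
        ultimately have val: "s2 ''A'' (s2 ''M'' (s2 ''v'' 0) + s2 ''w'' 0) = label (cls {v, ?w})"
          using q(4) by (simp add: row_def)
        have "label (cls {v, ?w}) = label (cls {u, A ! u ! i})"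
          if "u < n" "i < length (A ! u)" "offset A u + i = offset A v + k" for u i
          using offset_inj[OF that(1,2) p(1) q(1) that(3)] by simp
        then show ?thesis using q(2,3) val by (simp add: less_Suc_eq)
      qed
      subgoal premises q for t s2
        using q(1,3) offset_Suc[OF p(1)] by simp
      done
    subgoal premises p for t s'
    proof -
      have "offset A u + i < offset A n" if "u < n" "i < length (A ! u)" for u i
        using that offset_less[of u n] by simp
      moreover have "t \<le> 2 + (4 * n + 4 * (\<Sum>v<n. length (A ! v)))"
        using p(4) by (simp add: sum.distrib sum_distrib_left sum_Suc)
      ultimately show ?thesis using p(1) sum_degrees_le by (simp add: cls_ok_def)
    qed
    done
qed

section \<open>The program: decoding masks and checking candidates\<close>

text \<open>What the preprocessing leaves behind for the later programs, which do not write to these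
  arrays; with \<open>static_names\<close> its preservation becomes a syntactic check.\<close>

definition static_ok :: "memory \<Rightarrow> bool" where
  "static_ok s \<longleftrightarrow> s ''n'' 0 = n \<and> rows_ok s \<and> ins_ok s \<and> tables arcs s \<and> powers_ok s"

definition static_names :: "string set" where
  "static_names = {''n'', ''M'', ''m'', ''I'', ''A'', ''d'', ''u'', ''G'', ''p''}"

lemma static_frame:
  assumes "static_ok s" "\<And>X. X \<in> static_names \<Longrightarrow> s' X = s X"
  shows "static_ok s'"
proof -
  have eq: "s' ''n'' = s ''n''" "s' ''M'' = s ''M''" "s' ''m'' = s ''m''" "s' ''I'' = s ''I''"
    "s' ''A'' = s ''A''" "s' ''d'' = s ''d''" "s' ''u'' = s ''u''" "s' ''G'' = s ''G''"
    "s' ''p'' = s ''p''"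
    by (rule assms(2), simp add: static_names_def)+
  have "tables arcs s' \<longleftrightarrow> tables arcs s" by (rule tables_cong) (simp_all only: eq)
  moreover have "rows_ok s' \<longleftrightarrow> rows_ok s" "ins_ok s' \<longleftrightarrow> ins_ok s" "powers_ok s' \<longleftrightarrow> powers_ok s"
    unfolding rows_ok_def ins_ok_def powers_ok_def by (simp_all only: eq)
  ultimately show ?thesis
    using assms(1) eq(1) unfolding static_ok_def by simp
qed

lemma static_update [simp]: "X \<notin> static_names \<Longrightarrow> static_ok (s(X := f)) \<longleftrightarrow> static_ok s"
  by (rule iffI; erule static_frame) auto

lemma static_M: "static_ok s \<Longrightarrow> u < n \<Longrightarrow> s ''M'' u = u * Suc n"
  by (simp add: static_ok_def rows_ok_def)

lemma static_m: "static_ok s \<Longrightarrow> u < n \<Longrightarrow> s ''m'' u = indeg u"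
  by (simp add: static_ok_def ins_ok_def)

lemma static_p: "static_ok s \<Longrightarrow> u < n \<Longrightarrow> i \<le> indeg u \<Longrightarrow> s ''p'' i = 2 ^ i"
  by (simp add: static_ok_def powers_ok_def)

lemma static_G:
  assumes "static_ok s" "u < n" "i < indeg u"
  shows "s ''G'' (u * Suc n + i) = label (inlist u ! i)"
proof -
  have "(ins u ! i, u) \<in> arcs" using assms by (simp add: arcs_def indeg_def)
  then show ?thesis using assms by (simp add: static_ok_def tables_def row_def)
qed

lemma static_d:
  assumes "static_ok s" "arc F w v"
  shows "s ''d'' (v * Suc n + label F) = Suc w"
proof -
  have "v < n" using arcD(6)[OF assms(2)] V_eq by simp
  moreover have "(w, v) \<in> arcs" using arc_ins[OF assms(2)] \<open>v < n\<close> by (simp add: arcs_def)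
  ultimately show ?thesis
    using assms(1) arcD(7)[OF assms(2)] by (simp add: static_ok_def tables_def row_def)
qed

lemma static_d_0:
  assumes "static_ok s" "v < n" "F \<in> theta_classes E" "F \<notin> inc v"
  shows "s ''d'' (v * Suc n + label F) = 0"
proof -
  have "label (cls {w, v}) \<noteq> label F" if "(w, v) \<in> arcs" for w
  proof
    assume "label (cls {w, v}) = label F"
    then have "cls {w, v} = F"
      using label_inj arcD(1)[OF arcs_arc[OF that]] assms(3) by (auto dest: inj_onD)
    then show False using arcs_arc[OF that] assms(4) by (auto simp: inc_def)
  qed
  then show ?thesis
    using assms label_bounds(2)[OF assms(3)] by (simp add: static_ok_def tables_def row_def)
qed

lemma static_u:
  assumes "static_ok s" "arc F u z"
  shows "s ''u'' (u * Suc n + label F) = Suc z"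
proof -
  have "u < n" "z < n" using arcD(5,6)[OF assms(2)] V_eq by simp_all
  moreover have "(u, z) \<in> arcs" using arc_ins[OF assms(2)] \<open>z < n\<close> by (simp add: arcs_def)
  ultimately show ?thesis
    using assms(1) arcD(7)[OF assms(2)] by (simp add: static_ok_def tables_def row_def)
qed

definition holds :: "nat list \<Rightarrow> memory \<Rightarrow> bool" where
  "holds xs s \<longleftrightarrow> s ''l'' 0 = length xs \<and> (\<forall>j<length xs. s ''X'' j = xs ! j)"

text \<open>Without bit operations, the binary digits are found from the top: \<open>r\<close> is
  the part of the mask not yet decoded, and the current bit is set iff \<open>r\<close> is at least
  the corresponding power.\<close>

definition decode_prog :: com where
  "decode_prog = ''l'' ::= Const 0 ;; ''r'' ::= var ''S'' ;;
     For ''i'' (Const 0) (Get ''m'' (var ''a''))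
      (''k'' ::= Sub (Get ''m'' (var ''a'')) (Add (var ''i'') (Const 1)) ;;
       ifonly (Neg (Lt (var ''r'') (Get ''p'' (var ''k''))))
        (''r'' ::= Sub (var ''r'') (Get ''p'' (var ''k'')) ;;
         Put ''X'' (var ''l'') (Get ''G'' (Add (Get ''M'' (var ''a'')) (var ''k''))) ;;
         incr ''l''))"

lemma mods_decode_prog [simp]: "mods decode_prog = {''l'', ''r'', ''i'', ''k'', ''X''}"
  by (auto simp: decode_prog_def)

lemma wp_decode:
  assumes ok: "static_ok s" and a: "s ''a'' 0 = v" "v < n" and S: "s ''S'' 0 = S" "S < 2 ^ indeg v"
  shows "wp mem_bound decode_prog (\<lambda>t s'. holds (map label (decode v S)) s' \<and> t \<le> 4 + 7 * d) s"
proof -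
  let ?m = "indeg v"
  let ?xs = "\<lambda>i. map (\<lambda>j. label (inlist v ! j)) (rev (filter (bit S) [?m - i..<?m]))"
  have all: "?xs ?m = map label (decode v S)" by (simp add: decode_def bits_def)
  have le: "?m \<le> d" using indeg_le a by simp
  note m = static_m[OF ok a(2)]
  show ?thesis
    unfolding decode_prog_def
    apply (simp add: S)
    apply (rule wp_For_const[where l = 0 and h = ?m and T = 5 and
        I = "\<lambda>i s. s ''r'' 0 = take_bit (?m - i) S \<and> holds (?xs i) s"])
    subgoal by simp
    subgoal by simp
    subgoal by simp
    subgoal by (simp add: a m)
    subgoal using S take_bit_nat_eq_self_iff[of ?m S] by (simp add: holds_def)
    subgoal premises p for i s'
    proof -
      let ?k = "?m - Suc i"
      have fr: "s' X = s X" if "X \<notin> {''l'', ''r'', ''i'', ''k'', ''X''}" for X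
        using p(4)[of X] that by simp
      have k: "?k < ?m" "?m - i = Suc ?k" using p(1) by simp_all
      have r: "s' ''r'' 0 = 2 ^ ?k * of_bool (bit S ?k) + take_bit ?k S"
        using p(2) unfolding k(2) take_bit_Suc_from_most by simp
      have pk: "s ''p'' ?k = 2 ^ ?k" using static_p[OF ok a(2)] k by simp
      have G: "s ''G'' (v * Suc n + ?k) = label (inlist v ! ?k)" using static_G[OF ok a(2) k(1)] .
      have l: "s' ''l'' 0 = length (?xs i)" "\<And>j. j < length (?xs i) \<Longrightarrow> s' ''X'' j = ?xs i ! j"
        using p(2) by (simp_all add: holds_def)
      have step: "?xs (Suc i) = ?xs i @ (if bit S ?k then [label (inlist v ! ?k)] else [])"
        using bits_step[OF p(1), of S] by simp
      have lt: "take_bit ?k S < 2 ^ ?k" by simp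
      show ?thesis
      proof (cases "bit S ?k")
        case True
        have "holds (?xs i @ [label (inlist v ! ?k)]) s2"
          if "s2 ''l'' = (s' ''l'')(0 := Suc (length (?xs i)))"
            "s2 ''X'' = (s' ''X'')(length (?xs i) := label (inlist v ! ?k))" for s2
          using l that by (auto simp: holds_def nth_append less_Suc_eq simp del: length_map)
        then show ?thesis
          unfolding step using True lt
          by (simp add: fr a m p(3) pk r G l(1) static_M[OF ok a(2)] del: mult_Suc_right)
      next
        case False
        have "holds (?xs i) s2" if "s2 ''l'' = s' ''l''" "s2 ''X'' = s' ''X''" for s2
          using p(2) that by (simp add: holds_def)
        then show ?thesis
          unfolding step using False lt
          by (simp add: fr a m p(3) pk r del: mult_Suc_right)
      qed
    qed
    subgoal premises p for t s'
      using p(1,4) le all by simp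
    done
qed

text \<open>A member \<open>f\<close> is unhit if \<open>y\<close> stays 0, and it is private to the
  position \<open>w\<close> if \<open>y\<close> is 1; such positions are marked in \<open>P\<close>.
  A zero in table \<open>d\<close> means that the class does not come into \<open>Z[f]\<close>, the
  upper end of the arc of \<open>f\<close>.\<close>

definition check_prog :: com where
  "check_prog = ''r'' ::= Const 1 ;;
     For ''g'' (Const 0) (var ''l'') (Put ''P'' (var ''g'') (Const 0)) ;;
     For ''f'' (Const 0) (var ''K'')
      (''y'' ::= Const 0 ;;
       For ''g'' (Const 0) (var ''l'')
        (ifonly (Lt (Get ''d'' (Add (Get ''M'' (Get ''Z'' (var ''f''))) (Get ''X'' (var ''g'')))) (Const 1))
          (incr ''y'' ;; ''w'' ::= var ''g'')) ;;
       ifonly (Lt (var ''y'') (Const 1)) (''r'' ::= Const 0) ;;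
       ifonly (Conj (Lt (Const 0) (var ''y'')) (Lt (var ''y'') (Const 2)))
         (Put ''P'' (var ''w'') (Const 1))) ;;
     For ''g'' (Const 0) (var ''l'')
       (ifonly (Lt (Get ''P'' (var ''g'')) (Const 1)) (''r'' ::= Const 0))"

lemma mods_check_prog [simp]: "mods check_prog = {''r'', ''g'', ''P'', ''f'', ''y'', ''w''}"
  by (auto simp: check_prog_def)

text \<open>The inner loop counts the elements of \<open>xs\<close> hitting \<open>f\<close> and remembers the last one.\<close>

definition hit_count :: "(nat \<Rightarrow> bool) \<Rightarrow> nat \<Rightarrow> memory \<Rightarrow> bool" where
  "hit_count h g s \<longleftrightarrow> s ''y'' 0 = card {j. j < g \<and> h j} \<and>
     (0 < s ''y'' 0 \<longrightarrow> s ''w'' 0 < g \<and> h (s ''w'' 0))"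

lemma card_less_Suc: "card {j. j < Suc g \<and> h j} = card {j. j < g \<and> h j} + (if h g then 1 else 0)"
proof (cases "h g")
  case True
  then have "{j. j < Suc g \<and> h j} = insert g {j. j < g \<and> h j}" by (auto simp: less_Suc_eq)
  then show ?thesis using True by simp
next
  case False
  then have "{j. j < Suc g \<and> h j} = {j. j < g \<and> h j}" by (auto simp: less_Suc_eq)
  then show ?thesis using False by simp
qed

lemma hit_count_skip:
  assumes "hit_count h g s" "\<not> h g" "s' ''y'' = s ''y''" "s' ''w'' = s ''w''"
  shows "hit_count h (Suc g) s'"
proof -
  have "s ''y'' 0 = card {j. j < g \<and> h j}" "0 < s ''y'' 0 \<Longrightarrow> s ''w'' 0 < g \<and> h (s ''w'' 0)"
    using assms(1) unfolding hit_count_def by blast+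
  then show ?thesis
    unfolding hit_count_def card_less_Suc assms(3,4) using assms(2) less_SucI by presburger
qed

lemma hit_count_0: "hit_count h g s \<Longrightarrow> s ''y'' 0 < 1 \<longleftrightarrow> \<not> (\<exists>j<g. h j)"
  by (auto simp: hit_count_def card_gt_0_iff)

lemma hit_count_1:
  assumes "hit_count h g s"
  shows "0 < s ''y'' 0 \<and> s ''y'' 0 < 2 \<longleftrightarrow> (\<exists>j<g. h j \<and> (\<forall>j'<g. h j' \<longrightarrow> j' = j))"
    and "\<lbrakk>j < g; h j; \<forall>j'<g. h j' \<longrightarrow> j' = j\<rbrakk> \<Longrightarrow> s ''w'' 0 = j"
proof -
  let ?H = "{j. j < g \<and> h j}"
  have y: "s ''y'' 0 = card ?H" using assms by (simp add: hit_count_def)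
  have "0 < s ''y'' 0 \<and> s ''y'' 0 < 2 \<longleftrightarrow> card ?H = 1" using y by auto
  also have "\<dots> \<longleftrightarrow> (\<exists>j. ?H = {j})" by (rule card_1_singleton_iff[unfolded One_nat_def[symmetric]])
  also have "\<dots> \<longleftrightarrow> (\<exists>j<g. h j \<and> (\<forall>j'<g. h j' \<longrightarrow> j' = j))" by blast
  finally show "0 < s ''y'' 0 \<and> s ''y'' 0 < 2 \<longleftrightarrow> (\<exists>j<g. h j \<and> (\<forall>j'<g. h j' \<longrightarrow> j' = j))" .
  show "s ''w'' 0 = j" if "j < g" "h j" "\<forall>j'<g. h j' \<longrightarrow> j' = j"
  proof -
    have "j \<in> ?H" using that(1,2) by simp
    then have "0 < card ?H" by (auto simp: card_gt_0_iff)
    then have "s ''w'' 0 < g" "h (s ''w'' 0)" using assms y by (simp_all add: hit_count_def)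
    then show ?thesis using that(3) by blast
  qed
qed

lemma wp_check:
  assumes l: "s ''l'' 0 = length xs" and K: "s ''K'' 0 = length fs"
    and R: "\<And>f g. f < length fs \<Longrightarrow> g < length xs \<Longrightarrow>
      s ''d'' (s ''M'' (s ''Z'' f) + s ''X'' g) = 0 \<longleftrightarrow> R (xs ! g) (fs ! f)"
  shows "wp mem_bound check_prog (\<lambda>t s'. s' ''r'' 0 = (if list_minimal R fs xs then 1 else 0) \<and>
    t \<le> 7 + 7 * length xs + length fs * (9 + 5 * length xs)) s"
proof -
  let ?l = "length xs"
  let ?h = "\<lambda>f g. R (xs ! g) (fs ! f)"
  let ?hit = "\<lambda>k. \<forall>f<k. \<exists>g<?l. ?h f g"
  define uniq where "uniq f g \<longleftrightarrow> ?h f g \<and> (\<forall>g'<?l. ?h f g' \<longrightarrow> g' = g)" for f g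
  let ?priv = "\<lambda>k g. \<exists>f<k. uniq f g"
  define rv where "rv k = (if ?hit k then 1 else 0 :: nat)" for k
  have bex: "(\<exists>f\<in>set fs. Q f) \<longleftrightarrow> (\<exists>f<length fs. Q (fs ! f))" for Q
    by (auto simp: set_conv_nth)
  have minimal: "list_minimal R fs xs \<longleftrightarrow> ?hit (length fs) \<and> (\<forall>g<?l. ?priv (length fs) g)"
    unfolding list_minimal_def bex all_set_conv_all_nth uniq_def by (rule refl)
  have init: "wp mem_bound (For ''g'' (Const 0) (var ''l'') (Put ''P'' (var ''g'') (Const 0)))
      (\<lambda>t s'. (\<forall>g<?l. s' ''P'' g = 0) \<and> t \<le> 2 + 3 * ?l) s1" if "s1 ''l'' 0 = ?l" for s1
    apply (rule wp_For_const[where l = 0 and h = ?l and T = 1 and I = "\<lambda>k s. \<forall>g<k. s ''P'' g = 0"])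
    using that by (auto simp: less_Suc_eq)
  have final: "wp mem_bound (For ''g'' (Const 0) (var ''l'')
        (ifonly (Lt (Get ''P'' (var ''g'')) (Const 1)) (''r'' ::= Const 0)))
      (\<lambda>t s'. s' ''r'' 0 = (if b \<and> (\<forall>g<?l. 0 < s1 ''P'' g) then 1 else 0) \<and> t \<le> 2 + 4 * ?l) s1"
    if "s1 ''l'' 0 = ?l" "s1 ''r'' 0 = (if b then 1 else 0)" for s1 b
    apply (rule wp_For_const[where l = 0 and h = ?l and T = 2 and
        I = "\<lambda>k s. s ''r'' 0 = (if b \<and> (\<forall>g<k. 0 < s1 ''P'' g) then 1 else 0)"])
    using that by (auto simp: less_Suc_eq)
  have inner: "wp mem_bound (For ''g'' (Const 0) (var ''l'')
        (ifonly (Lt (Get ''d'' (Add (Get ''M'' (Get ''Z'' (var ''f''))) (Get ''X'' (var ''g'')))) (Const 1))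
          (incr ''y'' ;; ''w'' ::= var ''g'')))
      (\<lambda>t s'. hit_count (?h f) ?l s' \<and> t \<le> 2 + 5 * ?l) s1"
    if f: "f < length fs" and s1: "s1 ''l'' 0 = ?l" "s1 ''f'' 0 = f" "s1 ''y'' 0 = 0"
      "s1 ''d'' = s ''d''" "s1 ''M'' = s ''M''" "s1 ''Z'' = s ''Z''" "s1 ''X'' = s ''X''" for s1 f
    apply (rule wp_For_const[where l = 0 and h = ?l and T = 3 and I = "\<lambda>k s. hit_count (?h f) k s"])
    subgoal by simp
    subgoal by simp
    subgoal by simp
    subgoal using s1 by simp
    subgoal using s1 by (simp add: hit_count_def)
    subgoal premises p for g s'
    proof (cases "?h f g")
      case True
      have "hit_count (?h f) (Suc g) s2" if "s2 ''y'' 0 = Suc (s' ''y'' 0)" "s2 ''w'' 0 = g" for s2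
        using p(2) that True unfolding hit_count_def card_less_Suc by simp
      then show ?thesis using True by (simp add: p(3,4) s1 R[OF f p(1)])
    next
      case False
      have "hit_count (?h f) (Suc g) s2" if "s2 ''y'' = s' ''y''" "s2 ''w'' = s' ''w''" for s2
        by (rule hit_count_skip[OF p(2) False that])
      then show ?thesis using False R[OF f p(1)] by (simp add: p(3,4) s1)
    qed
    subgoal by simp
    done
  have main: "wp mem_bound (For ''f'' (Const 0) (var ''K'')
      (''y'' ::= Const 0 ;;
       For ''g'' (Const 0) (var ''l'')
        (ifonly (Lt (Get ''d'' (Add (Get ''M'' (Get ''Z'' (var ''f''))) (Get ''X'' (var ''g'')))) (Const 1))
          (incr ''y'' ;; ''w'' ::= var ''g'')) ;;
       ifonly (Lt (var ''y'') (Const 1)) (''r'' ::= Const 0) ;;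
       ifonly (Conj (Lt (Const 0) (var ''y'')) (Lt (var ''y'') (Const 2)))
         (Put ''P'' (var ''w'') (Const 1))))
      (\<lambda>t s'. s' ''r'' 0 = rv (length fs) \<and>
        (\<forall>g<?l. 0 < s' ''P'' g \<longleftrightarrow> ?priv (length fs) g) \<and> t \<le> 2 + length fs * (9 + 5 * ?l)) s1"
    if s1: "s1 ''l'' 0 = ?l" "s1 ''K'' 0 = length fs" "s1 ''r'' 0 = 1" "\<forall>g<?l. s1 ''P'' g = 0"
      "s1 ''d'' = s ''d''" "s1 ''M'' = s ''M''" "s1 ''Z'' = s ''Z''" "s1 ''X'' = s ''X''" for s1
    apply (rule wp_For_const[where l = 0 and h = "length fs" and T = "7 + 5 * ?l" and
        I = "\<lambda>k s. s ''r'' 0 = rv k \<and> (\<forall>g<?l. 0 < s ''P'' g \<longleftrightarrow> ?priv k g)"])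
    subgoal by simp
    subgoal by simp
    subgoal by simp
    subgoal using s1 by simp
    subgoal using s1 by (simp add: rv_def)
    subgoal premises p for f s'
    proof -
      have fr: "s' ''l'' 0 = ?l" "s' ''d'' = s ''d''" "s' ''M'' = s ''M''" "s' ''Z'' = s ''Z''"
        "s' ''X'' = s ''X''" using p(4) s1 by simp_all
      have hitS: "?hit (Suc f) \<longleftrightarrow> ?hit f \<and> (\<exists>g<?l. ?h f g)" by (auto simp: less_Suc_eq)
      have privS: "?priv (Suc f) g \<longleftrightarrow> ?priv f g \<or> uniq f g" for g
        by (auto simp: less_Suc_eq)
      show ?thesis
        apply (simp del: One_nat_def)
        apply (rule wp_frame[OF inner[OF p(1)]])
        subgoal using fr by simp
        subgoal using p(3) by simp
        subgoal by simp
        subgoal using fr by simp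
        subgoal using fr by simp
        subgoal using fr by simp
        subgoal using fr by simp
        subgoal premises q for t s2
        proof -
          have hc: "hit_count (?h f) ?l s2" and t: "t \<le> 2 + 5 * ?l" using q(1) by auto
          have rP: "s2 ''r'' 0 = rv f" "s2 ''P'' = s' ''P''"
            using q(2) p(2) by simp_all
          have r': "(if s2 ''y'' 0 < 1 then 0 else s2 ''r'' 0) = rv (Suc f)"
            unfolding rv_def hitS hit_count_0[OF hc] rP(1) by simp
          have P': "0 < (if 0 < s2 ''y'' 0 \<and> s2 ''y'' 0 < 2 then (s2 ''P'')(s2 ''w'' 0 := 1) else s2 ''P'') g
              \<longleftrightarrow> ?priv (Suc f) g" if g: "g < ?l" for g
          proof (cases "\<exists>j<?l. uniq f j")
            case True
            then obtain j where j: "j < ?l" "uniq f j" by blast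
            have w: "s2 ''w'' 0 = j" using hit_count_1(2)[OF hc j(1)] j(2) unfolding uniq_def by blast
            have c: "0 < s2 ''y'' 0 \<and> s2 ''y'' 0 < 2"
              using True hit_count_1(1)[OF hc] unfolding uniq_def by blast
            have "uniq f g \<longleftrightarrow> g = j" using j g unfolding uniq_def by blast
            then show ?thesis unfolding privS if_P[OF c] w rP(2) using p(2) g by simp
          next
            case False
            then have c: "\<not> (0 < s2 ''y'' 0 \<and> s2 ''y'' 0 < 2)"
              using hit_count_1(1)[OF hc] unfolding uniq_def by blast
            have "\<not> uniq f g" using False g by blast
            then show ?thesis unfolding privS if_not_P[OF c] rP(2) using p(2) g by simp
          qed
          show ?thesis
          proof (cases "0 < s2 ''y'' 0 \<and> s2 ''y'' 0 < 2")
            case True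
            have "?priv (Suc f) (s2 ''w'' 0)" if "s2 ''w'' 0 < ?l"
              using P'[OF that] True by simp
            moreover have "0 < s2 ''P'' g \<longleftrightarrow> ?priv (Suc f) g" if "g < ?l" "g \<noteq> s2 ''w'' 0" for g
              using P'[OF that(1)] that(2) True by simp
            ultimately show ?thesis using t r' True by simp
          next
            case False
            then show ?thesis using t r' P'[unfolded if_not_P[OF False]] by auto
          qed
        qed
        done
    qed
    subgoal premises p for t s'
    proof -
      have "7 + 5 * ?l + 2 = 9 + 5 * ?l" by simp
      then have "t \<le> 2 + length fs * (9 + 5 * ?l)" using p(4) by (simp only:)
      then show ?thesis using p(1) by blast
    qed
    done
  define res where "res = (if list_minimal R fs xs then 1 else 0 :: nat)"
  show ?thesis
    unfolding check_prog_def res_def[symmetric]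
    apply (simp del: One_nat_def)
    apply (rule wp_frame[OF init])
    subgoal using l by simp
    subgoal premises p for t1 s1
      apply (rule wp_frame[OF main])
      subgoal using p(2) l by simp
      subgoal using p(2) K by simp
      subgoal using p(2) by simp
      subgoal using p(1) by simp
      subgoal using p(2) by simp
      subgoal using p(2) by simp
      subgoal using p(2) by simp
      subgoal using p(2) by simp
      subgoal premises q for t2 s2
        apply (rule wp_frame[OF final[where b = "?hit (length fs)"]])
        subgoal using p(2) q(2) l by simp
        subgoal using q(1) by (simp add: rv_def)
        subgoal premises r for t3 s3
        proof -
          have "(\<forall>g<?l. 0 < s2 ''P'' g) \<longleftrightarrow> (\<forall>g<?l. ?priv (length fs) g)" using q(1) by simp
          then have "s3 ''r'' 0 = res"
            using r(1) unfolding res_def minimal by simp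
          then show ?thesis using p(1) q(1) r(1) by simp
        qed
        done
      done
    done
qed

section \<open>The program: enumerating minimal hitting sets\<close>

text \<open>By \<open>square_orthogonal\<close>, a class incoming into \<open>u\<close> is
  orthogonal to \<open>F\<close> iff it also comes into the upper end of the arc of
  \<open>F\<close>; so a single table lookup decides.\<close>

lemma hit_test:
  assumes ok: "static_ok s" and u: "u < n" "i < indeg u" and z: "arc F u z"
  shows "s ''d'' (s ''M'' z + label (inlist u ! i)) = 0 \<longleftrightarrow> \<not> orthogonal E (inlist u ! i) F"
proof -
  let ?X = "inlist u ! i"
  have zn: "z < n" using arcD(6)[OF z] V_eq by simp
  have X: "?X \<in> inc u" using inlist_arc[OF u] by (auto simp: inc_def)
  then have "?X \<noteq> F" using z arc_not_both by (auto simp: inc_def)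
  then have orth: "orthogonal E ?X F \<longleftrightarrow> ?X \<in> inc z" using square_orthogonal z X by blast
  show ?thesis
  proof (cases "?X \<in> inc z")
    case True
    then obtain y where "arc ?X y z" by (auto simp: inc_def)
    then have "s ''d'' (z * Suc n + label ?X) = Suc y" by (rule static_d[OF ok])
    then show ?thesis using True orth static_M[OF ok zn] by simp
  next
    case False
    then have "s ''d'' (z * Suc n + label ?X) = 0"
      using static_d_0[OF ok zn inlist_class[OF u]] by blast
    then show ?thesis using False orth static_M[OF ok zn] by simp
  qed
qed

definition index_labels :: "nat \<Rightarrow> nat list \<Rightarrow> nat list" where
  "index_labels u js = map (\<lambda>i. label (inlist u ! i)) js"

lemma length_index_labels [simp]: "length (index_labels u js) = length js"
  by (simp add: index_labels_def)

lemma decode_index_labels: "map label (decode u S) = index_labels u (bits (indeg u) S)"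
  by (simp add: index_labels_def decode_def)

definition misses :: "nat \<Rightarrow> nat \<Rightarrow> nat set set \<Rightarrow> bool" where
  "misses u i F \<longleftrightarrow> \<not> orthogonal E (inlist u ! i) F"

text \<open>Allows for candidates of length \<open>d + 1\<close>: an element may be appended to a
  full list before the check refuses it as a repetition.\<close>

definition check_time :: nat where
  "check_time = 14 + 21 * d + 5 * (d * d)"

lemma wp_check_masks:
  assumes ok: "static_ok s" and u: "u < n" and K: "s ''K'' 0 = length fs" "length fs \<le> d"
    and Z: "\<And>f. f < length fs \<Longrightarrow> arc (fs ! f) u (s ''Z'' f)"
    and js: "holds (index_labels u js) s" "set js \<subseteq> {..<indeg u}" "length js \<le> Suc d"
  shows "wp mem_bound check_prog (\<lambda>t s'.
    s' ''r'' 0 = (if list_minimal (misses u) fs js then 1 else 0) \<and> t \<le> check_time) s"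
proof (rule wp_frame[OF wp_check[of s js fs "misses u"]])
  show "s ''l'' 0 = length js" using js(1) by (simp add: holds_def)
  show "s ''K'' 0 = length fs" by fact
  show "s ''d'' (s ''M'' (s ''Z'' f) + s ''X'' g) = 0 \<longleftrightarrow> misses u (js ! g) (fs ! f)"
    if "f < length fs" "g < length js" for f g
  proof -
    have "s ''X'' g = label (inlist u ! (js ! g))"
      using js(1) that(2) by (simp add: holds_def index_labels_def)
    moreover have "js ! g < indeg u" using js(2) nth_mem[OF that(2)] by blast
    ultimately show ?thesis
      using hit_test[OF ok u _ Z[OF that(1)]] by (simp add: misses_def)
  qed
next
  fix t s'
  assume "s' ''r'' 0 = (if list_minimal (misses u) fs js then 1 else 0) \<and>
    t \<le> 7 + 7 * length js + length fs * (9 + 5 * length js)"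
  moreover have "length fs * (9 + 5 * length js) \<le> d * (9 + 5 * Suc d)"
    using K(2) js(3) by (intro mult_le_mono) auto
  ultimately show "s' ''r'' 0 = (if list_minimal (misses u) fs js then 1 else 0) \<and> t \<le> check_time"
    using js(3) by (auto simp: check_time_def algebra_simps)
qed

text \<open>The trial element is placed behind the current list and dropped again by resetting
  \<open>l\<close>, so a mask is decoded only once for all its extensions.\<close>

definition ext_prog :: com where
  "ext_prog =
     Put ''X'' (var ''l'') (Get ''G'' (Add (Get ''M'' (var ''a'')) (var ''e''))) ;; incr ''l'' ;;
     check_prog ;;
     ifonly (Lt (Const 0) (var ''r''))
       (Put ''L'' (var ''t'') (Add (Get ''L'' (var ''q'')) (Get ''p'' (var ''e''))) ;; incr ''t'') ;;
     ''l'' ::= Sub (var ''l'') (Const 1)"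

lemma mods_ext_prog [simp]:
  "mods ext_prog = {''X'', ''l'', ''r'', ''g'', ''P'', ''f'', ''y'', ''w'', ''L'', ''t''}"
  by (auto simp: ext_prog_def)

definition extend_prog :: com where
  "extend_prog = ''S'' ::= Get ''L'' (var ''q'') ;; decode_prog ;; check_prog ;;
     ifonly (Lt (Const 0) (var ''r'')) (Put ''L'' (var ''t'') (Get ''L'' (var ''q'')) ;; incr ''t'') ;;
     For ''e'' (Const 0) (Get ''m'' (var ''a'')) ext_prog"

lemma mods_extend_prog [simp]: "mods extend_prog =
    {''S'', ''l'', ''r'', ''i'', ''k'', ''X'', ''g'', ''P'', ''f'', ''y'', ''w'', ''L'', ''t'', ''e''}"
  by (auto simp: extend_prog_def)

text \<open>The first \<open>p\<close> cells keep the level that is being read, while the next level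
  grows behind them.\<close>

definition appended :: "(nat \<Rightarrow> nat) \<Rightarrow> nat \<Rightarrow> nat list \<Rightarrow> memory \<Rightarrow> bool" where
  "appended L0 p ys s \<longleftrightarrow> s ''t'' 0 = p + length ys \<and> (\<forall>i<p. s ''L'' i = L0 i) \<and>
     (\<forall>i<length ys. s ''L'' (p + i) = ys ! i)"

lemma appended_snoc:
  assumes "appended L0 p ys s" "s' ''L'' = (s ''L'')(s ''t'' 0 := y)" "s' ''t'' 0 = Suc (s ''t'' 0)"
  shows "appended L0 p (ys @ [y]) s'"
  using assms by (auto simp: appended_def nth_append less_Suc_eq)

lemma appended_cong:
  "appended L0 p ys s \<Longrightarrow> s' ''L'' = s ''L'' \<Longrightarrow> s' ''t'' 0 = s ''t'' 0 \<Longrightarrow> appended L0 p ys s'"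
  by (simp add: appended_def)

lemma wp_ext:
  assumes ok: "static_ok s" and u: "s ''a'' 0 = u" "u < n"
    and K: "s ''K'' 0 = length fs" "length fs \<le> d"
    and Z: "\<And>f. f < length fs \<Longrightarrow> arc (fs ! f) u (s ''Z'' f)"
    and h: "holds (index_labels u (bits (indeg u) T)) s" and T: "T < 2 ^ indeg u"
    and q: "s ''L'' (s ''q'' 0) = T"
    and x: "s ''e'' 0 = x" "x < indeg u" and app: "appended L0 p ys s"
  shows "wp mem_bound ext_prog (\<lambda>t s'. holds (index_labels u (bits (indeg u) T)) s' \<and>
      appended L0 p (ys @ (if list_minimal (misses u) fs (bits (indeg u) T @ [x]) then [T + 2 ^ x] else [])) s' \<and>
      t \<le> check_time + 6) s"
proof -
  let ?js = "bits (indeg u) T"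
  let ?min = "list_minimal (misses u) fs (?js @ [x])"
  have le: "length ?js \<le> d" using length_bits_le[of "indeg u" T] indeg_le[OF u(2)] by simp
  have l: "s ''l'' 0 = length ?js" and X: "\<And>j. j < length ?js \<Longrightarrow> s ''X'' j = index_labels u ?js ! j"
    using h by (simp_all add: holds_def)
  have M: "s ''M'' u = u * Suc n" using static_M[OF ok u(2)] .
  have G: "s ''G'' (u * Suc n + x) = label (inlist u ! x)" using static_G[OF ok u(2) x(2)] .
  define s1 where "s1 = s(''X'' := (s ''X'')(length ?js := label (inlist u ! x)),
    ''l'' := (s ''l'')(0 := Suc (length ?js)))"
  have s1: "s1 Y = s Y" if "Y \<notin> {''X'', ''l''}" for Y using that by (simp add: s1_def)
  have h1: "holds (index_labels u (?js @ [x])) s1"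
    using X by (auto simp: holds_def s1_def nth_append less_Suc_eq index_labels_def)
  have ok1: "static_ok s1" using ok by (simp add: s1_def static_names_def)
  have check: "wp mem_bound check_prog (\<lambda>t s'.
    s' ''r'' 0 = (if ?min then 1 else 0) \<and> t \<le> check_time) s1"
  proof (rule wp_check_masks[OF ok1 u(2) _ K(2) _ h1])
    show "s1 ''K'' 0 = length fs" using K(1) by (simp add: s1_def)
    show "arc (fs ! f) u (s1 ''Z'' f)" if "f < length fs" for f using Z[OF that] by (simp add: s1_def)
    show "set (?js @ [x]) \<subseteq> {..<indeg u}" using set_bits_subset x(2) by auto
    show "length (?js @ [x]) \<le> Suc d" using le by simp
  qed
  define post where "post t s' \<longleftrightarrow> holds (index_labels u ?js) s' \<and>
      appended L0 p (ys @ (if ?min then [T + 2 ^ x] else [])) s' \<and> t \<le> check_time + 6" for t s'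
  have px: "s ''p'' x = 2 ^ x" using static_p[OF ok u(2)] x(2) by simp
  have "wp mem_bound check_prog (\<lambda>t. wp mem_bound
     (ifonly (Lt (Const 0) (var ''r''))
       (Put ''L'' (var ''t'') (Add (Get ''L'' (var ''q'')) (Get ''p'' (var ''e''))) ;; incr ''t'') ;;
     ''l'' ::= Sub (var ''l'') (Const 1)) (\<lambda>t'. post (2 + t + t'))) s1"
  proof (rule wp_frame[OF check])
    fix t s2
    assume 1: "s2 ''r'' 0 = (if ?min then 1 else 0) \<and> t \<le> check_time"
      and fr: "\<And>Y. Y \<notin> mods check_prog \<Longrightarrow> s2 Y = s1 Y"
    have s2: "s2 Y = s1 Y" if "Y \<notin> {''r'', ''g'', ''P'', ''f'', ''y'', ''w''}" for Y
      using fr[of Y] that by simp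
    have e: "s2 ''e'' 0 = x" "s2 ''q'' 0 = s ''q'' 0" "s2 ''L'' = s ''L''" "s2 ''p'' = s ''p''"
      "s2 ''t'' = s ''t''" "s2 ''l'' 0 = Suc (length ?js)" "s2 ''X'' = s1 ''X''"
      using x(1) by (simp_all add: s2 s1_def)
    have hold: "holds (index_labels u ?js) s3"
      if "s3 ''l'' 0 = length ?js" "s3 ''X'' = s2 ''X''" for s3
      using X that e(7) by (simp add: holds_def s1_def)
    show "wp mem_bound
       (ifonly (Lt (Const 0) (var ''r''))
         (Put ''L'' (var ''t'') (Add (Get ''L'' (var ''q'')) (Get ''p'' (var ''e''))) ;; incr ''t'') ;;
       ''l'' ::= Sub (var ''l'') (Const 1)) (\<lambda>t'. post (2 + t + t')) s2"
    proof (cases ?min)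
      case True
      then have "x \<notin> set ?js" by (simp add: list_minimal_iff)
      then have "T + 2 ^ x \<le> mem_bound"
        using mask_insert(1)[OF T x(2)] two_power_indeg[OF u(2)] n_le_mem_bound by simp
      moreover have "appended L0 p (ys @ [T + 2 ^ x]) s3"
        if "s3 ''L'' = (s ''L'')(s ''t'' 0 := T + 2 ^ x)" "s3 ''t'' 0 = Suc (s ''t'' 0)" for s3
        using appended_snoc[OF app that] .
      ultimately show ?thesis
        using True 1 by (simp add: e q px post_def hold)
    next
      case False
      moreover have "appended L0 p ys s3" if "s3 ''L'' = s ''L''" "s3 ''t'' 0 = s ''t'' 0" for s3
        using appended_cong[OF app that] .
      ultimately show ?thesis
        using 1 by (simp add: e post_def hold)
    qed
  qed
  note main = this[unfolded s1_def]
  show ?thesis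
    unfolding ext_prog_def post_def[symmetric]
    apply (simp add: u(1) x(1) l M G del: mult_Suc_right)
    apply (rule wp_frame[OF main])
    apply (auto simp: post_def)
    done
qed

definition extend_time :: nat where
  "extend_time = 10 + 15 * d + check_time + d * check_time"

lemma wp_extend:
  assumes ok: "static_ok s" and u: "s ''a'' 0 = u" "u < n"
    and K: "s ''K'' 0 = length fs" "length fs \<le> d"
    and Z: "\<And>f. f < length fs \<Longrightarrow> arc (fs ! f) u (s ''Z'' f)"
    and q: "s ''q'' 0 = q" "q < p" "L0 q = T" and T: "T < 2 ^ indeg u"
    and app: "appended L0 p ys s"
  shows "wp mem_bound extend_prog (\<lambda>t s'.
      appended L0 p (ys @ berge_step (indeg u) (list_minimal (misses u) fs) T) s' \<and> t \<le> extend_time) s"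
proof -
  let ?js = "bits (indeg u) T"
  let ?ok = "list_minimal (misses u) fs"
  define out where "out = (if ?ok ?js then [T] else [])"
  define post where "post t s' \<longleftrightarrow>
    appended L0 p (ys @ berge_step (indeg u) ?ok T) s' \<and> t \<le> extend_time" for t s'
  have Lq: "s' ''L'' q = T" if "appended L0 p zs s'" for zs s'
    using that q(2,3) by (simp add: appended_def)
  have le: "indeg u \<le> d" using indeg_le[OF u(2)] .
  have loop: "wp mem_bound (For ''e'' (Const 0) (Get ''m'' (var ''a'')) ext_prog)
      (\<lambda>t s'. appended L0 p (ys @ berge_step (indeg u) ?ok T) s' \<and> t \<le> 2 + d * (check_time + 8)) s1"
    if s1: "static_ok s1" "s1 ''a'' 0 = u" "s1 ''K'' 0 = length fs" "s1 ''Z'' = s ''Z''" "s1 ''q'' 0 = q"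
      "holds (index_labels u ?js) s1" "appended L0 p (ys @ out) s1" for s1
    apply (rule wp_For_const[where l = 0 and h = "indeg u" and T = "check_time + 6" and
        I = "\<lambda>k s. holds (index_labels u ?js) s \<and>
          appended L0 p (ys @ out @ map (\<lambda>x. T + 2 ^ x) (filter (\<lambda>x. ?ok (?js @ [x])) [0..<k])) s"])
    subgoal by simp
    subgoal by simp
    subgoal by simp
    subgoal using static_m[OF s1(1) u(2)] s1(2) by simp
    subgoal using s1(6,7) by (simp add: holds_def appended_def)
    subgoal premises r for x s'
    proof -
      have fr: "s' Y = s1 Y" if "Y \<notin> insert ''e'' (mods ext_prog)" for Y using r(4)[OF that] .
      let ?ys = "ys @ out @ map (\<lambda>x. T + 2 ^ x) (filter (\<lambda>x. ?ok (?js @ [x])) [0..<x])"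
      have eq: "ys @ out @ map (\<lambda>x. T + 2 ^ x) (filter (\<lambda>x. ?ok (?js @ [x])) [0..<Suc x]) =
        ?ys @ (if ?ok (?js @ [x]) then [T + 2 ^ x] else [])" by simp
      have hx: "holds (index_labels u ?js) s'" and ax: "appended L0 p ?ys s'" using r(2) by auto
      have w: "wp mem_bound ext_prog (\<lambda>t s'. holds (index_labels u ?js) s' \<and>
        appended L0 p (?ys @ (if ?ok (?js @ [x]) then [T + 2 ^ x] else [])) s' \<and> t \<le> check_time + 6) s'"
      proof (rule wp_ext[OF _ _ u(2) _ K(2) _ hx T _ _ r(1) ax])
        show "static_ok s'"
          by (rule static_frame[OF s1(1)], rule fr) (auto simp: static_names_def)
        show "s' ''a'' 0 = u" "s' ''K'' 0 = length fs" using fr s1 by simp_all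
        show "arc (fs ! f) u (s' ''Z'' f)" if "f < length fs" for f using fr s1(4) Z[OF that] by simp
        show "s' ''L'' (s' ''q'' 0) = T" using fr s1(5) Lq[OF ax] by simp
        show "s' ''e'' 0 = x" using r(3) by simp
      qed
      show ?thesis
        unfolding eq
        by (rule wp_frame[OF w]) (auto simp: holds_def appended_def)
    qed
    subgoal premises r for t s'
    proof -
      have "indeg u * (check_time + 6 + 2) \<le> d * (check_time + 8)" using le by (intro mult_le_mono) auto
      then have "t \<le> 2 + d * (check_time + 8)" using r(4) by linarith
      then show ?thesis using r(1) by (simp add: berge_step_def out_def)
    qed
    done
  have rest: "wp mem_bound
     (ifonly (Lt (Const 0) (var ''r'')) (Put ''L'' (var ''t'') (Get ''L'' (var ''q'')) ;; incr ''t'') ;;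
      For ''e'' (Const 0) (Get ''m'' (var ''a'')) ext_prog) (\<lambda>t'. post (t + t')) s1"
    if s1: "static_ok s1" "s1 ''a'' 0 = u" "s1 ''K'' 0 = length fs" "s1 ''Z'' = s ''Z''" "s1 ''q'' 0 = q"
      "holds (index_labels u ?js) s1" "appended L0 p ys s1" "s1 ''r'' 0 = (if ?ok ?js then 1 else 0)"
      and t: "t \<le> 5 + 7 * d + check_time" for s1 t
  proof (cases "?ok ?js")
    case True
    let ?s = "s1(''L'' := (s1 ''L'')(s1 ''t'' 0 := T), ''t'' := (s1 ''t'')(0 := Suc (s1 ''t'' 0)))"
    have "appended L0 p (ys @ out) ?s"
      using appended_snoc[OF s1(7), of ?s T] True by (simp add: out_def)
    then have "wp mem_bound (For ''e'' (Const 0) (Get ''m'' (var ''a'')) ext_prog)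
        (\<lambda>t'. post (t + (3 + t'))) ?s"
      using s1 t
      by (intro wp_frame[OF loop])
        (auto simp: static_names_def holds_def post_def extend_time_def algebra_simps)
    note main = this
    show ?thesis
      apply (simp add: s1(5,8) True Lq[OF s1(7)])
      apply (rule wp_frame[OF main])
      apply (simp add: post_def)
      done
  next
    case False
    have "appended L0 p (ys @ out) s1" using s1(7) False by (simp add: out_def)
    then have "wp mem_bound (For ''e'' (Const 0) (Get ''m'' (var ''a'')) ext_prog)
        (\<lambda>t'. post (t + (2 + t'))) s1"
      using s1 t
      by (intro wp_frame[OF loop])
        (auto simp: post_def extend_time_def algebra_simps)
    note main = this
    show ?thesis
      apply (simp add: s1(8) False)
      apply (rule wp_frame[OF main])
      apply (simp add: post_def)
      done
  qed
  let ?s1 = "s(''S'' := (s ''S'')(0 := T))"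
  have ok1: "static_ok ?s1" using ok by (simp add: static_names_def)
  have "wp mem_bound decode_prog (\<lambda>t. wp mem_bound (check_prog ;;
     ifonly (Lt (Const 0) (var ''r'')) (Put ''L'' (var ''t'') (Get ''L'' (var ''q'')) ;; incr ''t'') ;;
      For ''e'' (Const 0) (Get ''m'' (var ''a'')) ext_prog) (\<lambda>t'. post (1 + t + t'))) ?s1"
  proof (rule wp_frame[OF wp_decode[OF ok1 _ u(2) _ T]])
    show "?s1 ''a'' 0 = u" "?s1 ''S'' 0 = T" using u by simp_all
    fix t s2
    assume 2: "holds (map label (decode u T)) s2 \<and> t \<le> 4 + 7 * d"
      and fr2: "\<And>X. X \<notin> mods decode_prog \<Longrightarrow> s2 X = ?s1 X"
    have ok2: "static_ok s2"
      by (rule static_frame[OF ok1], rule fr2) (auto simp: static_names_def)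
    have h2: "holds (index_labels u ?js) s2" using 2 by (simp add: decode_index_labels)
    have e2: "s2 ''a'' 0 = u" "s2 ''K'' 0 = length fs" "s2 ''Z'' = s ''Z''" "s2 ''q'' 0 = q"
      "s2 ''L'' = s ''L''" "s2 ''t'' = s ''t''"
      using u K q by (simp_all add: fr2)
    have "wp mem_bound check_prog (\<lambda>t'. wp mem_bound (
       ifonly (Lt (Const 0) (var ''r'')) (Put ''L'' (var ''t'') (Get ''L'' (var ''q'')) ;; incr ''t'') ;;
       For ''e'' (Const 0) (Get ''m'' (var ''a'')) ext_prog) (\<lambda>t''. post (1 + t + t' + t''))) s2"
    proof (rule wp_frame[OF wp_check_masks[OF ok2 u(2) e2(2) K(2) _ h2]])
      show "arc (fs ! f) u (s2 ''Z'' f)" if "f < length fs" for f using Z[OF that] e2(3) by simp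
      show "set ?js \<subseteq> {..<indeg u}" by (rule set_bits_subset)
      show "length ?js \<le> Suc d" using length_bits_le[of "indeg u" T] le by simp
      fix t' s3
      assume 3: "s3 ''r'' 0 = (if ?ok ?js then 1 else 0) \<and> t' \<le> check_time"
        and fr3: "\<And>X. X \<notin> mods check_prog \<Longrightarrow> s3 X = s2 X"
      show "wp mem_bound (
         ifonly (Lt (Const 0) (var ''r'')) (Put ''L'' (var ''t'') (Get ''L'' (var ''q'')) ;; incr ''t'') ;;
         For ''e'' (Const 0) (Get ''m'' (var ''a'')) ext_prog) (\<lambda>t''. post (1 + t + t' + t'')) s3"
      proof (rule rest)
        show "static_ok s3" by (rule static_frame[OF ok2], rule fr3) (auto simp: static_names_def)
        show "s3 ''a'' 0 = u" "s3 ''K'' 0 = length fs" "s3 ''Z'' = s ''Z''" "s3 ''q'' 0 = q"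
          using e2 by (simp_all add: fr3)
        show "holds (index_labels u ?js) s3" using h2 by (simp add: holds_def fr3)
        show "appended L0 p ys s3" using app e2 by (simp add: appended_def fr3)
        show "s3 ''r'' 0 = (if ?ok ?js then 1 else 0)" using 3 by blast
        show "1 + t + t' \<le> 5 + 7 * d + check_time" using 2 3 by simp
      qed
    qed
    then show "wp mem_bound (check_prog ;;
     ifonly (Lt (Const 0) (var ''r'')) (Put ''L'' (var ''t'') (Get ''L'' (var ''q'')) ;; incr ''t'') ;;
      For ''e'' (Const 0) (Get ''m'' (var ''a'')) ext_prog) (\<lambda>t'. post (1 + t + t')) s2"
      by (subst wp_Seq) (simp only: add.assoc)
  qed
  then show ?thesis
    unfolding extend_prog_def post_def[symmetric]
    using q(1) Lq[OF app] by (subst wp_Seq, subst wp_Put, subst wp_Seq) (simp add: add.assoc)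
qed

definition level_prog :: com where
  "level_prog = ''K'' ::= Add (var ''h'') (Const 1) ;;
     For ''q'' (var ''x'') (var ''z'') extend_prog ;; ''x'' ::= var ''z'' ;; ''z'' ::= var ''t''"

lemma mods_level_prog [simp]: "mods level_prog = {''K'', ''q'', ''x'', ''z'', ''S'', ''l'', ''r'',
    ''i'', ''k'', ''X'', ''g'', ''P'', ''f'', ''y'', ''w'', ''L'', ''t'', ''e''}"
  by (auto simp: level_prog_def)

text \<open>The current level occupies the cells of \<open>L\<close> from \<open>x\<close> up to
  \<open>z\<close>; older levels stay in front of it, so nothing has to be moved.\<close>

definition work :: "nat list \<Rightarrow> memory \<Rightarrow> bool" where
  "work ys s \<longleftrightarrow> s ''z'' 0 = s ''x'' 0 + length ys \<and> s ''t'' 0 = s ''z'' 0 \<and>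
     (\<forall>i<length ys. s ''L'' (s ''x'' 0 + i) = ys ! i)"

lemma wp_level:
  assumes ok: "static_ok s" and u: "s ''a'' 0 = u" "u < n"
    and h: "Suc (s ''h'' 0) = length fs" "length fs \<le> d"
    and Z: "\<And>f. f < length fs \<Longrightarrow> arc (fs ! f) u (s ''Z'' f)"
    and ys: "work ys s" "\<And>T. T \<in> set ys \<Longrightarrow> T < 2 ^ indeg u"
  shows "wp mem_bound level_prog (\<lambda>t s'.
      work (concat (map (berge_step (indeg u) (list_minimal (misses u) fs)) ys)) s' \<and>
      t \<le> 5 + length ys * (extend_time + 2)) s"
proof -
  let ?step = "berge_step (indeg u) (list_minimal (misses u) fs)"
  define post where "post t s' \<longleftrightarrow> work (concat (map ?step ys)) s' \<and> t \<le> 5 + length ys * (extend_time + 2)" for t s'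
  define s1 where "s1 = s(''K'' := (s ''K'')(0 := length fs))"
  define x where "x = s ''x'' 0"
  let ?z = "x + length ys"
  have s1: "s1 ''x'' 0 = x" "s1 ''z'' 0 = ?z" "s1 ''t'' 0 = ?z" "s1 ''L'' = s ''L''"
    "\<And>i. i < length ys \<Longrightarrow> s1 ''L'' (x + i) = ys ! i"
    using ys(1) by (simp_all add: s1_def x_def work_def)
  have "wp mem_bound (For ''q'' (var ''x'') (var ''z'') extend_prog)
    (\<lambda>t s'. wp mem_bound (''x'' ::= var ''z'' ;; ''z'' ::= var ''t'') (\<lambda>t'. post (1 + t + t')) s') s1"
    apply (rule wp_For_const[where l = x and h = "length ys" and T = extend_time and
        I = "\<lambda>k s'. appended (s1 ''L'') ?z (concat (map ?step (take k ys))) s'"])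
    subgoal by simp
    subgoal using s1 by simp
    subgoal by simp
    subgoal using s1 by simp
    subgoal using s1 by (simp add: appended_def)
    subgoal premises p for k s'
    proof -
      have fr: "s' Y = s1 Y" if "Y \<notin> insert ''q'' (mods extend_prog)" for Y using p(4)[OF that] .
      have eq: "concat (map ?step (take (Suc k) ys)) = concat (map ?step (take k ys)) @ ?step (ys ! k)"
        using p(1) by (simp add: take_Suc_conv_app_nth)
      have "wp mem_bound extend_prog (\<lambda>t s'.
        appended (s1 ''L'') ?z (concat (map ?step (take k ys)) @ ?step (ys ! k)) s' \<and> t \<le> extend_time) s'"
      proof (rule wp_extend[OF _ _ u(2) _ h(2) _ p(3) _ _ _ p(2)])
        show "static_ok s'"
        proof (rule static_frame[OF ok])
          fix X assume "X \<in> static_names"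
          then show "s' X = s X" using fr[of X] by (auto simp: static_names_def s1_def)
        qed
        show "s' ''a'' 0 = u" "s' ''K'' 0 = length fs" using fr u by (simp_all add: s1_def)
        show "arc (fs ! f) u (s' ''Z'' f)" if "f < length fs" for f
          using fr Z[OF that] by (simp add: s1_def)
        show "x + k < ?z" using p(1) by simp
        show "s1 ''L'' (x + k) = ys ! k" using s1(5) p(1) by blast
        show "ys ! k < 2 ^ indeg u" using ys(2) p(1) by simp
      qed
      then show ?thesis
        unfolding eq by (rule wp_frame) (auto simp: appended_def)
    qed
    subgoal premises p for t s'
    proof -
      have z: "s' ''z'' 0 = ?z" using p(3) s1 by simp
      have "work (concat (map ?step ys)) (s'(''x'' := (s' ''x'')(0 := ?z), ''z'' := (s' ''z'')(0 := s' ''t'' 0)))"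
        using p(1) by (simp add: work_def appended_def)
      then show ?thesis using p(4) z by (simp add: post_def)
    qed
    done
  then show ?thesis
    unfolding level_prog_def post_def[symmetric]
    using h(1) by (simp add: s1_def)
qed

section \<open>The program: processing all cubes\<close>

definition walk_prog :: com where
  "walk_prog = For ''i'' (Const 0) (var ''J'')
     (''b'' ::= Sub (Get ''d'' (Add (Get ''M'' (var ''b'')) (Get ''X'' (var ''i'')))) (Const 1))"

lemma mods_walk_prog [simp]: "mods walk_prog = {''i'', ''b''}"
  by (auto simp: walk_prog_def)

lemma wp_walk:
  assumes ok: "static_ok s" and X: "holds (map label Fs) s" and J: "s ''J'' 0 = length Fs"
    and b: "s ''b'' 0 = v" "v < n" and down: "down v Fs u"
  shows "wp mem_bound walk_prog (\<lambda>t s'. s' ''b'' 0 = u \<and> t \<le> 2 + 3 * length Fs) s"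
  unfolding walk_prog_def
  apply (rule wp_For_const[where l = 0 and h = "length Fs" and T = 1 and
      I = "\<lambda>k s. s ''b'' 0 < n \<and> down (s ''b'' 0) (drop k Fs) u"])
  subgoal by simp
  subgoal by simp
  subgoal by simp
  subgoal using J by simp
  subgoal using b down by simp
  subgoal premises p for k s'
  proof -
    let ?F = "Fs ! k"
    have "drop k Fs = ?F # drop (Suc k) Fs" using p(1) by (simp add: Cons_nth_drop_Suc)
    then obtain w where w: "arc ?F w (s' ''b'' 0)" "down w (drop (Suc k) Fs) u" using p(2) by auto
    have wn: "w < n" using arcD(5)[OF w(1)] V_eq by simp
    have fr: "s' Y = s Y" if "Y \<notin> {''i'', ''b''}" for Y using p(4)[of Y] that by simp
    have "s ''X'' k = label ?F" using X p(1) by (simp add: holds_def)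
    moreover have "s ''M'' (s' ''b'' 0) = s' ''b'' 0 * Suc n" using static_M[OF ok] p(2) by blast
    moreover note static_d[OF ok w(1)]
    ultimately show ?thesis using w wn p(3) by (simp add: fr del: mult_Suc_right)
  qed
  subgoal by simp
  done

definition tops_prog :: com where
  "tops_prog = For ''i'' (Const 0) (var ''J'')
     (Put ''Z'' (var ''i'') (Sub (Get ''u'' (Add (Get ''M'' (var ''b'')) (Get ''X'' (var ''i'')))) (Const 1)))"

lemma mods_tops_prog [simp]: "mods tops_prog = {''i'', ''Z''}"
  by (auto simp: tops_prog_def)

lemma wp_tops:
  assumes ok: "static_ok s" and X: "holds (map label Fs) s" and J: "s ''J'' 0 = length Fs"
    and b: "s ''b'' 0 = u" "u < n" and out: "set Fs \<subseteq> outc u"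
  shows "wp mem_bound tops_prog
    (\<lambda>t s'. (\<forall>f<length Fs. arc (Fs ! f) u (s' ''Z'' f)) \<and> t \<le> 2 + 3 * length Fs) s"
  unfolding tops_prog_def
  apply (rule wp_For_const[where l = 0 and h = "length Fs" and T = 1 and
      I = "\<lambda>k s. \<forall>f<k. arc (Fs ! f) u (s ''Z'' f)"])
  subgoal by simp
  subgoal by simp
  subgoal by simp
  subgoal using J by simp
  subgoal by simp
  subgoal premises p for k s'
  proof -
    let ?F = "Fs ! k"
    have "?F \<in> outc u" using out nth_mem[OF p(1)] by blast
    then obtain z where z: "arc ?F u z" by (auto simp: outc_def)
    have fr: "s' Y = s Y" if "Y \<notin> {''i'', ''Z''}" for Y using p(4)[of Y] that by simp
    have "s ''X'' k = label ?F" using X p(1) by (simp add: holds_def)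
    moreover have "s ''M'' u = u * Suc n" using static_M[OF ok b(2)] .
    moreover note static_u[OF ok z]
    ultimately show ?thesis using z p(2,3) b by (simp add: fr less_Suc_eq del: mult_Suc_right)
  qed
  subgoal by simp
  done

definition levels_prog :: com where
  "levels_prog = For ''h'' (Const 0) (var ''J'') level_prog"

lemma mods_levels_prog [simp]: "mods levels_prog = {''h'', ''K'', ''q'', ''x'', ''z'', ''S'', ''l'', ''r'',
    ''i'', ''k'', ''X'', ''g'', ''P'', ''f'', ''y'', ''w'', ''L'', ''t'', ''e''}"
  by (auto simp: levels_prog_def)

lemma wp_levels:
  assumes ok: "static_ok s" and u: "s ''a'' 0 = u" "u < n" and J: "s ''J'' 0 = length Fs" "length Fs \<le> d"
    and Z: "\<And>f. f < length Fs \<Longrightarrow> arc (Fs ! f) u (s ''Z'' f)" and work: "work [0] s"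
    and le: "\<And>k. k \<le> length Fs \<Longrightarrow> length (berge (indeg u) (misses u) Fs k) \<le> b"
  shows "wp mem_bound levels_prog (\<lambda>t s'. work (berge (indeg u) (misses u) Fs (length Fs)) s' \<and>
    t \<le> 2 + d * (7 + b * (extend_time + 2))) s"
  unfolding levels_prog_def
  apply (rule wp_For_const[where l = 0 and h = "length Fs" and T = "5 + b * (extend_time + 2)" and
      I = "\<lambda>k s. work (berge (indeg u) (misses u) Fs k) s"])
  subgoal by simp
  subgoal by simp
  subgoal by simp
  subgoal using J by simp
  subgoal using work by (simp add: work_def)
  subgoal premises p for k s'
  proof -
    have fr: "s' Y = s Y" if "Y \<notin> insert ''h'' (mods level_prog)" for Y using p(4)[OF that] .
    let ?ys = "berge (indeg u) (misses u) Fs k"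
    have w: "wp mem_bound level_prog (\<lambda>t s'.
        work (concat (map (berge_step (indeg u) (list_minimal (misses u) (take (Suc k) Fs))) ?ys)) s' \<and>
        t \<le> 5 + length ?ys * (extend_time + 2)) s'"
    proof (rule wp_level[OF _ _ u(2) _ _ _ p(2)])
      show "static_ok s'" by (rule static_frame[OF ok], rule fr) (auto simp: static_names_def)
      show "s' ''a'' 0 = u" using fr u by simp
      show "Suc (s' ''h'' 0) = length (take (Suc k) Fs)" using p(1,3) by simp
      show "length (take (Suc k) Fs) \<le> d" using J by simp
      show "arc (take (Suc k) Fs ! f) u (s' ''Z'' f)" if "f < length (take (Suc k) Fs)" for f
        using that Z[of f] fr by simp
      show "T < 2 ^ indeg u" if "T \<in> set ?ys" for T
        using that berge_correct[of k Fs "indeg u" "misses u"] p(1) by simp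
    qed
    have "length ?ys * (extend_time + 2) \<le> b * (extend_time + 2)"
      using le[of k] p(1) by (intro mult_le_mono1) simp
    then show ?thesis
      by (intro wp_frame[OF w]) (auto simp: work_def)
  qed
  subgoal premises p for t s'
  proof -
    have "length Fs * (5 + b * (extend_time + 2) + 2) \<le> d * (7 + b * (extend_time + 2))"
      using J(2) by (intro mult_le_mono) auto
    then have "t \<le> 2 + d * (7 + b * (extend_time + 2))" using p(4) by linarith
    then show ?thesis using p(1) by blast
  qed
  done

text \<open>The records belonging to a pair \<open>(u, L)\<close> form a linked list (\<open>W\<close>) starting in \<open>H\<close>; \<open>R\<close> and
  \<open>T\<close> hold their components, \<open>C\<close> the lengths of the lists, \<open>B\<close> the number of all records.\<close>

fun linked :: "memory \<Rightarrow> nat \<Rightarrow> nat \<Rightarrow> (nat \<times> nat) list \<Rightarrow> bool" where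
  "linked s b i [] \<longleftrightarrow> i = 0"
| "linked s b i (r # rs) \<longleftrightarrow> 0 < i \<and> i \<le> b \<and> s ''R'' i = fst r \<and> s ''T'' i = snd r \<and>
     linked s b (s ''W'' i) rs"

lemma linked_mono:
  "linked s b i rs \<Longrightarrow> b \<le> b' \<Longrightarrow>
    (\<And>j. j \<le> b \<Longrightarrow> s' ''R'' j = s ''R'' j \<and> s' ''T'' j = s ''T'' j \<and> s' ''W'' j = s ''W'' j) \<Longrightarrow>
    linked s' b' i rs"
  by (induction rs arbitrary: i) auto

definition recs_ok :: "(nat \<Rightarrow> nat \<Rightarrow> (nat \<times> nat) list) \<Rightarrow> memory \<Rightarrow> bool" where
  "recs_ok rec s \<longleftrightarrow> (\<forall>u<n. \<forall>L\<le>n. linked s (s ''B'' 0) (s ''H'' (row u L)) (rec u L) \<and>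
     s ''C'' (row u L) = length (rec u L))"

lemma recs_ok_frame:
  assumes "recs_ok rec s" "\<And>X. X \<in> {''B'', ''H'', ''C'', ''R'', ''T'', ''W''} \<Longrightarrow> s' X = s X"
  shows "recs_ok rec s'"
proof -
  have eq: "s' ''B'' = s ''B''" "s' ''H'' = s ''H''" "s' ''C'' = s ''C''"
    "s' ''R'' = s ''R''" "s' ''T'' = s ''T''" "s' ''W'' = s ''W''"
    by (rule assms(2), simp)+
  have "linked s' b i rs" if "linked s b i rs" for b i rs
    by (rule linked_mono[OF that]) (simp_all add: eq)
  then show ?thesis using assms(1) unfolding recs_ok_def eq by blast
qed

lemma recs_ok_update [simp]:
  "X \<notin> {''B'', ''H'', ''C'', ''R'', ''T'', ''W''} \<Longrightarrow> recs_ok rec (s(X := f)) \<longleftrightarrow> recs_ok rec s"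
  by (rule iffI; erule recs_ok_frame) auto

text \<open>\<open>B\<close> is increased before it is used, so record 0 does not exist and pointer
  0 can end a list. New records are put in front, which is the reason for the reversal in
  \<open>records\<close>.\<close>

definition register_body :: com where
  "register_body = incr ''B'' ;; ''y'' ::= Add (Get ''M'' (var ''a'')) (Get ''L'' (var ''q'')) ;;
     Put ''R'' (var ''B'') (var ''v'') ;; Put ''T'' (var ''B'') (var ''s'') ;;
     Put ''W'' (var ''B'') (Get ''H'' (var ''y'')) ;; Put ''H'' (var ''y'') (var ''B'') ;;
     Put ''C'' (var ''y'') (Add (Get ''C'' (var ''y'')) (Const 1))"

lemma mods_register_body [simp]: "mods register_body = {''B'', ''y'', ''R'', ''T'', ''W'', ''H'', ''C''}"
  by (auto simp: register_body_def)

lemma wp_register_body: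
  assumes ok: "static_ok s" and u: "s ''a'' 0 = u" "u < n" and T: "s ''L'' (s ''q'' 0) = T" "T \<le> n"
    and recs: "recs_ok rec s"
  shows "wp mem_bound register_body (\<lambda>t s'. recs_ok (\<lambda>u' L. if u' = u \<and> L = T
      then (s ''v'' 0, s ''s'' 0) # rec u' L else rec u' L) s' \<and> t \<le> 7) s"
proof -
  have M: "s ''M'' u = u * Suc n" using static_M[OF ok u(2)] .
  have bound: "u * Suc n + T \<le> mem_bound"
  proof -
    have "u * Suc n + T \<le> u * Suc n + Suc n" using T(2) by simp
    also have "\<dots> = Suc u * Suc n" by simp
    also have "\<dots> \<le> mem_bound" unfolding mem_bound_def using u(2) by (intro mult_le_mono1) simp
    finally show ?thesis .
  qed
  let ?y = "u * Suc n + T" and ?B = "Suc (s ''B'' 0)"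
  let ?rec = "\<lambda>u' L. if u' = u \<and> L = T then (s ''v'' 0, s ''s'' 0) # rec u' L else rec u' L"
  have upd: "recs_ok ?rec s'"
    if s': "s' ''B'' 0 = ?B" "s' ''R'' = (s ''R'')(?B := s ''v'' 0)" "s' ''T'' = (s ''T'')(?B := s ''s'' 0)"
      "s' ''W'' = (s ''W'')(?B := s ''H'' ?y)" "s' ''H'' = (s ''H'')(?y := ?B)"
      "s' ''C'' = (s ''C'')(?y := Suc (s ''C'' ?y))" for s'
    unfolding recs_ok_def
  proof (intro allI impI)
    fix u' L assume uL: "u' < n" "L \<le> n"
    have old: "linked s (s ''B'' 0) (s ''H'' (row u' L)) (rec u' L)" "s ''C'' (row u' L) = length (rec u' L)"
      using recs uL unfolding recs_ok_def by blast+
    have new: "linked s' ?B (s ''H'' (row u' L)) (rec u' L)"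
      by (rule linked_mono[OF old(1)]) (simp_all add: s')
    have y: "?y = row u T" by (simp add: row_def)
    show "linked s' (s' ''B'' 0) (s' ''H'' (row u' L)) (?rec u' L) \<and>
      s' ''C'' (row u' L) = length (?rec u' L)"
    proof (cases "u' = u \<and> L = T")
      case True
      then have "row u' L = ?y" using y by simp
      then show ?thesis using True new old(2) by (simp add: s')
    next
      case False
      then have "row u' L \<noteq> ?y" unfolding y using row_eq_iff[OF uL(2) T(2), of u' u] by blast
      then show ?thesis unfolding if_not_P[OF False] using new old(2) by (simp add: s')
    qed
  qed
  show ?thesis
    unfolding register_body_def
    by (simp add: u T M bound del: mult_Suc_right) (rule upd, simp_all del: mult_Suc_right)
qed

definition register_prog :: com where
  "register_prog = For ''q'' (var ''x'') (var ''z'') register_body"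

lemma mods_register_prog [simp]:
  "mods register_prog = {''q'', ''B'', ''y'', ''R'', ''T'', ''W'', ''H'', ''C''}"
  by (auto simp: register_prog_def)

lemma wp_register:
  assumes ok: "static_ok s" and u: "s ''a'' 0 = u" "u < n"
    and work: "work ys s" "\<And>T. T \<in> set ys \<Longrightarrow> T \<le> n" "distinct ys"
    and recs: "recs_ok rec s"
  shows "wp mem_bound register_prog (\<lambda>t s'. recs_ok (\<lambda>u' L. if u' = u \<and> L \<in> set ys
      then (s ''v'' 0, s ''s'' 0) # rec u' L else rec u' L) s' \<and> t \<le> 2 + 9 * length ys) s"
proof -
  let ?rec = "\<lambda>k u' L. if u' = u \<and> L \<in> set (take k ys)
      then (s ''v'' 0, s ''s'' 0) # rec u' L else rec u' L"
  show ?thesis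
    unfolding register_prog_def
    apply (rule wp_For_const[where l = "s ''x'' 0" and h = "length ys" and T = 7 and
        I = "\<lambda>k s. recs_ok (?rec k) s"])
    subgoal by simp
    subgoal by simp
    subgoal by simp
    subgoal using work(1) by (simp add: work_def)
    subgoal using recs by simp
    subgoal premises p for k s'
    proof -
      have fr: "s' Y = s Y" if "Y \<notin> insert ''q'' (mods register_body)" for Y using p(4)[OF that] .
      let ?T = "ys ! k"
      have T: "?T \<in> set ys" "?T \<notin> set (take k ys)"
        using p(1) work(3) by (auto simp: in_set_conv_nth nth_eq_iff_index_eq)
      have w: "wp mem_bound register_body (\<lambda>t s''. recs_ok (\<lambda>u' L. if u' = u \<and> L = ?T
          then (s' ''v'' 0, s' ''s'' 0) # ?rec k u' L else ?rec k u' L) s'' \<and> t \<le> 7) s'"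
      proof (rule wp_register_body[OF _ _ u(2) _ work(2)[OF T(1)] p(2)])
        show "static_ok s'" by (rule static_frame[OF ok], rule fr) (auto simp: static_names_def)
        show "s' ''a'' 0 = u" using fr u by simp
        show "s' ''L'' (s' ''q'' 0) = ?T" using fr p(1,3) work(1) by (simp add: work_def)
      qed
      have eq: "(\<lambda>u' L. if u' = u \<and> L = ?T
          then (s' ''v'' 0, s' ''s'' 0) # ?rec k u' L else ?rec k u' L) = ?rec (Suc k)"
        using T(2) p(1) by (intro ext) (auto simp: fr take_Suc_conv_app_nth)
      show ?thesis
      proof (rule wp_frame[OF w])
        fix t s''
        assume a: "recs_ok (\<lambda>u' L. if u' = u \<and> L = ?T
          then (s' ''v'' 0, s' ''s'' 0) # ?rec k u' L else ?rec k u' L) s'' \<and> t \<le> 7"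
        then have "recs_ok (?rec (Suc k)) s''" unfolding eq by blast
        then have "recs_ok (?rec (Suc k)) (s''(''q'' := (s'' ''q'')(0 := Suc (s ''x'' 0 + k))))"
          by (rule recs_ok_frame) auto
        then show "t \<le> 7 \<and> recs_ok (?rec (Suc k)) (s''(''q'' := (s'' ''q'')(0 := Suc (s ''x'' 0 + k))))"
          using a by blast
      qed
    qed
    subgoal premises p for t s'
      using p(1,4) by simp
    done
qed

text \<open>\<open>J\<close> and \<open>Z\<close> save the size of \<open>S\<close> and the upper
  ends of its arcs at the bottom, because \<open>l\<close> and \<open>X\<close> are reused for the
  candidates. The levels start from mask 0: the empty set is the only minimal hitting set of the
  empty family.\<close>

definition cube_prog :: com where
  "cube_prog = ''a'' ::= var ''v'' ;; ''S'' ::= var ''s'' ;; decode_prog ;;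
     ''J'' ::= var ''l'' ;; ''b'' ::= var ''v'' ;; walk_prog ;; tops_prog ;;
     Put ''L'' (Const 0) (Const 0) ;; ''x'' ::= Const 0 ;; ''z'' ::= Const 1 ;; ''t'' ::= Const 1 ;;
     ''a'' ::= var ''b'' ;; levels_prog ;; register_prog"

lemma mods_cube_prog [simp]: "mods cube_prog =
    {''a'', ''S'', ''l'', ''r'', ''i'', ''k'', ''X'', ''J'', ''b'', ''Z'', ''L'', ''x'', ''z'', ''t'', ''h'',
     ''K'', ''q'', ''g'', ''P'', ''f'', ''y'', ''w'', ''e'', ''B'', ''R'', ''T'', ''W'', ''H'', ''C''}"
  by (auto simp: cube_prog_def)

definition cube_time :: "nat \<Rightarrow> nat" where
  "cube_time b = 22 + 13 * d + d * (7 + b * (extend_time + 2)) + 9 * b"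

lemma misses_levels: "levels v S k = berge (indeg (bottom v S)) (misses (bottom v S)) (decode v S) k"
  unfolding levels_def Let_def misses_def by (rule refl)

lemma wp_cube:
  assumes ok: "static_ok s" and v: "s ''v'' 0 = v" "v < n" and S: "s ''s'' 0 = S" "S < 2 ^ indeg v"
    and recs: "recs_ok (records ps) s"
  shows "wp mem_bound cube_prog
    (\<lambda>t s'. recs_ok (records (ps @ [(v, S)])) s' \<and> t \<le> cube_time (bound v S)) s"
proof -
  let ?Fs = "decode v S" and ?u = "bottom v S"
  let ?b = "bound v S"
  have u: "?u < n" using bottom_less[OF v(2)] .
  have J: "length ?Fs \<le> d" using length_decode_le[of v S] indeg_le[OF v(2)] by simp
  define post where "post t s' \<longleftrightarrow>
    recs_ok (records (ps @ [(v, S)])) s' \<and> t \<le> cube_time ?b" for t s'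
  have sol: "solutions v S = berge (indeg ?u) (misses ?u) ?Fs (length ?Fs)"
    by (simp add: solutions_def misses_levels)
  have rec: "(\<lambda>u' L. if u' = ?u \<and> L \<in> set (solutions v S) then (v, S) # records ps u' L
      else records ps u' L) = records (ps @ [(v, S)])"
    by (intro ext) (auto simp: records_def)
  have sol_le: "T \<le> n" if "T \<in> set (solutions v S)" for T
    using that solutions_iff[OF v(2), of T S] two_power_indeg[OF u] by simp
  have fin: "wp mem_bound register_prog (\<lambda>t'. post (t + t')) s5"
    if s5: "static_ok s5" "s5 ''a'' 0 = ?u" "work (solutions v S) s5" "recs_ok (records ps) s5"
      "s5 ''v'' 0 = v" "s5 ''s'' 0 = S"
      and t: "t \<le> 20 + 13 * d + d * (7 + ?b * (extend_time + 2))" for s5 t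
  proof (rule wp_frame[OF wp_register[OF s5(1,2) u s5(3) sol_le distinct_solutions s5(4)]])
    fix t' s'
    assume "recs_ok (\<lambda>u' L. if u' = ?u \<and> L \<in> set (solutions v S)
      then (s5 ''v'' 0, s5 ''s'' 0) # records ps u' L else records ps u' L) s' \<and>
      t' \<le> 2 + 9 * length (solutions v S)"
    moreover have "length (solutions v S) \<le> ?b"
      unfolding solutions_def by (rule length_levels_le[OF v(2)]) simp
    ultimately show "post (t + t') s'"
      using t unfolding s5(5,6) rec post_def cube_time_def by simp
  qed
  have mid: "wp mem_bound (levels_prog ;; register_prog) (\<lambda>t'. post (t + t')) s4"
    if s4: "static_ok s4" "s4 ''a'' 0 = ?u" "work [0] s4" "recs_ok (records ps) s4"
      "s4 ''v'' 0 = v" "s4 ''s'' 0 = S" "s4 ''J'' 0 = length ?Fs"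
      "\<And>f. f < length ?Fs \<Longrightarrow> arc (?Fs ! f) ?u (s4 ''Z'' f)"
      and t: "t \<le> 18 + 13 * d" for s4 t
    unfolding wp_Seq
  proof (rule wp_frame[OF wp_levels[OF s4(1,2) u s4(7) J s4(8,3)]])
    show "length (berge (indeg ?u) (misses ?u) ?Fs k) \<le> ?b" if "k \<le> length ?Fs" for k
      using length_levels_le[OF v(2) that] by (simp add: misses_levels)
    fix t' s5
    assume 5: "work (berge (indeg ?u) (misses ?u) ?Fs (length ?Fs)) s5 \<and>
      t' \<le> 2 + d * (7 + ?b * (extend_time + 2))"
      and fr: "\<And>X. X \<notin> mods levels_prog \<Longrightarrow> s5 X = s4 X"
    have "wp mem_bound register_prog (\<lambda>t''. post (t + t' + t'')) s5"
    proof (rule fin)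
      show "static_ok s5" by (rule static_frame[OF s4(1)], rule fr) (auto simp: static_names_def)
      show "s5 ''a'' 0 = ?u" "s5 ''v'' 0 = v" "s5 ''s'' 0 = S" using s4 by (simp_all add: fr)
      show "work (solutions v S) s5" using 5 by (simp add: sol)
      show "recs_ok (records ps) s5" by (rule recs_ok_frame[OF s4(4)], rule fr) auto
      show "t + t' \<le> 20 + 13 * d + d * (7 + ?b * (extend_time + 2))" using t 5 by simp
    qed
    then show "wp mem_bound register_prog (\<lambda>t''. post (t + (t' + t''))) s5"
      by (simp only: add.assoc)
  qed
  let ?rest2 = "Put ''L'' (Const 0) (Const 0) ;; ''x'' ::= Const 0 ;; ''z'' ::= Const 1 ;; ''t'' ::= Const 1 ;;
     ''a'' ::= var ''b'' ;; levels_prog ;; register_prog"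
  have tops: "wp mem_bound (tops_prog ;; ?rest2) (\<lambda>t'. post (t + t')) s3"
    if s3: "static_ok s3" "holds (map label ?Fs) s3" "s3 ''J'' 0 = length ?Fs" "s3 ''b'' 0 = ?u"
      "recs_ok (records ps) s3" "s3 ''v'' 0 = v" "s3 ''s'' 0 = S" and t: "t \<le> 10 + 10 * d" for s3 t
  proof -
    have "wp mem_bound tops_prog (\<lambda>t'. wp mem_bound ?rest2 (\<lambda>t''. post (t + (t' + t'')))) s3"
    proof (rule wp_frame[OF wp_tops[OF s3(1-4) u decode_out[OF v(2)]]])
      fix t' s4
      assume 4: "(\<forall>f<length ?Fs. arc (?Fs ! f) ?u (s4 ''Z'' f)) \<and> t' \<le> 2 + 3 * length ?Fs"
        and fr: "\<And>X. X \<notin> mods tops_prog \<Longrightarrow> s4 X = s3 X"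
      let ?s = "s4(''L'' := (s4 ''L'')(0 := 0), ''x'' := (s4 ''x'')(0 := 0), ''z'' := (s4 ''z'')(0 := 1),
        ''t'' := (s4 ''t'')(0 := 1), ''a'' := (s4 ''a'')(0 := ?u))"
      have ok4: "static_ok s4" by (rule static_frame[OF s3(1)], rule fr) (auto simp: static_names_def)
      have w: "wp mem_bound (levels_prog ;; register_prog) (\<lambda>t''. post (t + t' + 5 + t'')) ?s"
      proof (rule mid)
        show "static_ok ?s" using ok4 by (simp add: static_names_def)
        show "work [0] ?s" by (simp add: work_def)
        have "recs_ok (records ps) s4" by (rule recs_ok_frame[OF s3(5)], rule fr) auto
        then show "recs_ok (records ps) ?s" by simp
        show "arc (?Fs ! f) ?u (?s ''Z'' f)" if "f < length ?Fs" for f using 4 that by simp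
        show "t + t' + 5 \<le> 18 + 13 * d" using t 4 J by simp
      qed (use s3 in \<open>simp_all add: fr\<close>)
      have b4: "s4 ''b'' 0 = ?u" using s3(4) by (simp add: fr)
      show "wp mem_bound ?rest2 (\<lambda>t''. post (t + (t' + t''))) s4"
        unfolding wp_Put wp_Seq[of _ "_ ::= _"] wp_Seq[of _ "Put _ _ _"]
        apply (simp add: b4 del: wp_Seq)
        apply (rule wp_frame[OF w[unfolded One_nat_def]])
        apply (simp add: post_def)
        done
    qed
    then show ?thesis by (subst wp_Seq)
  qed
  let ?rest1 = "''J'' ::= var ''l'' ;; ''b'' ::= var ''v'' ;; walk_prog ;; tops_prog ;; ?rest2"
  have walk: "wp mem_bound ?rest1 (\<lambda>t'. post (t + t')) s2"
    if s2: "static_ok s2" "holds (map label ?Fs) s2"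
      "recs_ok (records ps) s2" "s2 ''v'' 0 = v" "s2 ''s'' 0 = S" and t: "t \<le> 6 + 7 * d" for s2 t
  proof -
    let ?s = "s2(''J'' := (s2 ''J'')(0 := length ?Fs), ''b'' := (s2 ''b'')(0 := v))"
    have l: "s2 ''l'' 0 = length ?Fs" using s2(2) by (simp add: holds_def)
    have ok': "static_ok ?s" using s2(1) by (simp add: static_names_def)
    have h': "holds (map label ?Fs) ?s" using s2(2) by (simp add: holds_def)
    have w: "wp mem_bound walk_prog (\<lambda>t'. wp mem_bound (tops_prog ;; ?rest2) (\<lambda>t''. post (t + 2 + t' + t''))) ?s"
    proof (rule wp_frame[OF wp_walk[OF ok' h' _ _ v(2) down_bottom[OF v(2)]]])
      show "?s ''J'' 0 = length ?Fs" "?s ''b'' 0 = v" by simp_all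
      fix t' s3
      assume 3: "s3 ''b'' 0 = ?u \<and> t' \<le> 2 + 3 * length ?Fs"
        and fr: "\<And>X. X \<notin> mods walk_prog \<Longrightarrow> s3 X = ?s X"
      show "wp mem_bound (tops_prog ;; ?rest2) (\<lambda>t''. post (t + 2 + t' + t'')) s3"
      proof (rule tops)
        show "static_ok s3" by (rule static_frame[OF ok'], rule fr) (auto simp: static_names_def)
        show "holds (map label ?Fs) s3" using h' by (simp add: holds_def fr)
        show "s3 ''J'' 0 = length ?Fs" "s3 ''v'' 0 = v" "s3 ''s'' 0 = S" using s2 by (simp_all add: fr)
        show "s3 ''b'' 0 = ?u" using 3 by blast
        have "recs_ok (records ps) ?s" using s2(3) by simp
        then show "recs_ok (records ps) s3" by (rule recs_ok_frame, intro fr) auto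
        show "t + 2 + t' \<le> 10 + 10 * d" using t 3 J by simp
      qed
    qed
    show ?thesis
      unfolding wp_Put wp_Seq[of _ "_ ::= _"] wp_Seq[of _ walk_prog]
      apply (simp add: l s2(4) del: wp_Seq One_nat_def)
      apply (rule wp_frame[OF w])
      apply (erule wp_frame)
      apply (simp add: post_def)
      done
  qed
  let ?s = "s(''a'' := (s ''a'')(0 := v), ''S'' := (s ''S'')(0 := S))"
  have ok': "static_ok ?s" using ok by (simp add: static_names_def)
  have w: "wp mem_bound decode_prog (\<lambda>t. wp mem_bound ?rest1 (\<lambda>t'. post (2 + t + t'))) ?s"
  proof (rule wp_frame[OF wp_decode[OF ok' _ v(2) _ S(2)]])
    show "?s ''a'' 0 = v" "?s ''S'' 0 = S" by simp_all
    fix t s2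
    assume 2: "holds (map label ?Fs) s2 \<and> t \<le> 4 + 7 * d"
      and fr: "\<And>X. X \<notin> mods decode_prog \<Longrightarrow> s2 X = ?s X"
    show "wp mem_bound ?rest1 (\<lambda>t'. post (2 + t + t')) s2"
    proof (rule walk)
      show "static_ok s2" by (rule static_frame[OF ok'], rule fr) (auto simp: static_names_def)
      have "recs_ok (records ps) ?s" using recs by simp
      then show "recs_ok (records ps) s2" by (rule recs_ok_frame, intro fr) auto
    qed (use 2 v S in \<open>simp_all add: fr\<close>)
  qed
  show ?thesis
    unfolding cube_prog_def post_def[symmetric]
    apply (subst wp_Seq, subst wp_Put, subst wp_Seq, subst wp_Put, subst wp_Seq)
    apply (simp add: v(1) S(1) del: wp_Seq One_nat_def)
    apply (rule wp_frame[OF w])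
    apply (erule wp_frame)
    apply (simp add: post_def)
    done
qed

definition main_prog :: com where
  "main_prog = For ''v'' (Const 0) (var ''n'')
     (For ''s'' (Const 0) (Get ''p'' (Get ''m'' (var ''v''))) cube_prog)"

lemma mods_main_prog [simp]: "mods main_prog = {''v'', ''s''} \<union> mods cube_prog"
  by (auto simp: main_prog_def)

definition main_time :: nat where
  "main_time = 2 + (\<Sum>v<n. 4 + (\<Sum>S<2 ^ indeg v. cube_time (bound v S) + 2))"

lemma wp_main:
  assumes ok: "static_ok s" and zero: "s ''B'' 0 = 0" "\<And>i. s ''H'' i = 0" "\<And>i. s ''C'' i = 0"
  shows "wp mem_bound main_prog (\<lambda>t s'. recs_ok (records cubes) s' \<and> t \<le> main_time) s"
proof -
  have n: "s ''n'' 0 = n" using ok by (simp add: static_ok_def)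
  let ?ps = "\<lambda>v. concat (map masks [0..<v])"
  show ?thesis
    unfolding main_prog_def
    apply (rule wp_For[where l = 0 and h = n and
        T = "\<lambda>v. 2 + (\<Sum>S<2 ^ indeg v. cube_time (bound v S) + 2)" and
        I = "\<lambda>v s. recs_ok (records (?ps v)) s"])
    subgoal by simp
    subgoal by simp
    subgoal by simp
    subgoal using n by simp
    subgoal using zero by (simp add: recs_ok_def records_def)
    subgoal premises p for v s'
      apply (rule wp_For[where l = 0 and h = "2 ^ indeg v" and T = "\<lambda>S. cube_time (bound v S)" and
          I = "\<lambda>S s. recs_ok (records (?ps v @ map (Pair v) [0..<S])) s"])
      subgoal by simp
      subgoal by simp
      subgoal by simp
      subgoal premises q for s2
      proof -
        have "s2 ''m'' = s ''m''" "s2 ''p'' = s ''p''" "s2 ''v'' 0 = v"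
          using q[of "''m''"] q[of "''p''"] q[of "''v''"] p(3) p(4)[of "''m''"] p(4)[of "''p''"] by simp_all
        then show ?thesis using static_m[OF ok p(1)] static_p[OF ok p(1), of "indeg v"] by simp
      qed
      subgoal using p(2) by simp
      subgoal premises q for S s2
      proof -
        have fr: "s2 X = s X" if "X \<notin> insert ''v'' (insert ''s'' (mods cube_prog))" for X
          using q(4)[of X] p(4)[of X] that by simp
        have "wp mem_bound cube_prog (\<lambda>t s'.
          recs_ok (records ((?ps v @ map (Pair v) [0..<S]) @ [(v, S)])) s' \<and> t \<le> cube_time (bound v S)) s2"
        proof (rule wp_cube[OF _ _ p(1) _ q(1,2)])
          show "static_ok s2" by (rule static_frame[OF ok], rule fr) (auto simp: static_names_def)
          show "s2 ''v'' 0 = v" using q(4)[of "''v''"] p(3) by simp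
          show "s2 ''s'' 0 = S" using q(3) by simp
        qed
        then show ?thesis
        proof (rule wp_frame)
          fix t s3
          assume a: "recs_ok (records ((?ps v @ map (Pair v) [0..<S]) @ [(v, S)])) s3 \<and> t \<le> cube_time (bound v S)"
          then have "recs_ok (records (?ps v @ map (Pair v) [0..<Suc S])) s3" by simp
          then have "recs_ok (records (?ps v @ map (Pair v) [0..<Suc S])) (s3(''s'' := (s3 ''s'')(0 := Suc (0 + S))))"
            by (rule recs_ok_frame) auto
          then show "t \<le> cube_time (bound v S) \<and>
            recs_ok (records (?ps v @ map (Pair v) [0..<Suc S])) (s3(''s'' := (s3 ''s'')(0 := Suc (0 + S))))"
            using a by blast
        qed
      qed
      subgoal premises q for t s2
      proof -
        have "?ps v @ map (Pair v) [0..<2 ^ indeg v] = ?ps (Suc v)" by (simp add: masks_def)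
        then have "recs_ok (records (?ps (Suc v))) s2" using q(1) by simp
        then have "recs_ok (records (?ps (Suc v))) (s2(''v'' := (s2 ''v'')(0 := Suc (0 + v))))"
          by (rule recs_ok_frame) auto
        then show ?thesis using q(4) by blast
      qed
      done
    subgoal premises p for t s'
    proof -
      have "(\<Sum>v<n. 2 + (\<Sum>S<2 ^ indeg v. cube_time (bound v S) + 2) + 2) =
        (\<Sum>v<n. 4 + (\<Sum>S<2 ^ indeg v. cube_time (bound v S) + 2))"
        by (intro sum.cong) auto
      then show ?thesis using p(1,4) unfolding main_time_def cubes_def by linarith
    qed
    done
qed

section \<open>The program: output\<close>

text \<open>Cell 0 is left for the number of entries, which is counted in \<open>E\<close> and
  stored last.\<close>

definition written :: "nat list \<Rightarrow> memory \<Rightarrow> bool" where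
  "written ys s \<longleftrightarrow> s ''o'' 0 = Suc (length ys) \<and> (\<forall>i<length ys. s ''out'' (Suc i) = ys ! i)"

lemma written_snoc:
  assumes "written ys s" "s' ''out'' = (s ''out'')(s ''o'' 0 := y)" "s' ''o'' 0 = Suc (s ''o'' 0)"
  shows "written (ys @ [y]) s'"
  using assms by (auto simp: written_def nth_append less_Suc_eq)

lemma written_cong:
  "written ys s \<Longrightarrow> s' ''out'' = s ''out'' \<Longrightarrow> s' ''o'' 0 = s ''o'' 0 \<Longrightarrow> written ys s'"
  by (simp add: written_def)

lemma written_update [simp]:
  "X \<notin> {''out'', ''o''} \<Longrightarrow> written ys (s(X := f)) \<longleftrightarrow> written ys s"
  by (rule iffI; erule written_cong) auto

definition emit_prog :: com where
  "emit_prog = Put ''out'' (var ''o'') (var ''l'') ;; incr ''o'' ;;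
     For ''i'' (Const 0) (var ''l'') (Put ''out'' (var ''o'') (Get ''X'' (var ''i'')) ;; incr ''o'')"

lemma mods_emit_prog [simp]: "mods emit_prog = {''out'', ''o'', ''i''}"
  by (auto simp: emit_prog_def)

lemma wp_emit:
  assumes X: "holds xs s" and w: "written ys s"
  shows "wp mem_bound emit_prog (\<lambda>t s'. written (ys @ encode_list xs) s' \<and> t \<le> 4 + 4 * length xs) s"
proof -
  have l: "s ''l'' 0 = length xs" "\<And>j. j < length xs \<Longrightarrow> s ''X'' j = xs ! j"
    using X by (simp_all add: holds_def)
  define post where "post t s' \<longleftrightarrow> written (ys @ encode_list xs) s' \<and> t \<le> 4 + 4 * length xs" for t s'
  let ?s = "s(''out'' := (s ''out'')(s ''o'' 0 := length xs), ''o'' := (s ''o'')(0 := Suc (s ''o'' 0)))"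
  have w1: "written (ys @ [length xs]) ?s" by (rule written_snoc[OF w]) simp_all
  show ?thesis
    unfolding emit_prog_def post_def[symmetric]
    apply (simp add: l(1))
    apply (rule wp_For_const[where l = 0 and h = "length xs" and T = 2 and
        I = "\<lambda>k s. written (ys @ [length xs] @ take k xs) s"])
    subgoal by simp
    subgoal by simp
    subgoal by simp
    subgoal by (simp add: l(1))
    subgoal using w1 by simp
    subgoal premises p for k s'
    proof -
      have X: "s' ''X'' k = xs ! k" using p(4)[of "''X''"] l(2)[OF p(1)] by simp
      have eq: "ys @ [length xs] @ take (Suc k) xs = (ys @ [length xs] @ take k xs) @ [xs ! k]"
        using p(1) by (simp add: take_Suc_conv_app_nth)
      have "written (ys @ [length xs] @ take (Suc k) xs) s2"
        if "s2 ''out'' = (s' ''out'')(s' ''o'' 0 := xs ! k)" "s2 ''o'' 0 = Suc (s' ''o'' 0)" for s2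
        unfolding eq by (rule written_snoc[OF p(2) that])
      then show ?thesis using p(3) X by simp
    qed
    subgoal premises p for t s'
      using p(1,4) by (simp add: post_def encode_list_def)
    done
qed

definition labels :: "nat \<Rightarrow> nat \<Rightarrow> nat list" where
  "labels v S = map label (decode v S)"

lemma length_labels_le: "v < n \<Longrightarrow> length (labels v S) \<le> d"
  using length_decode_le[of v S] indeg_le[of v] by (simp add: labels_def)

definition item_prog :: com where
  "item_prog = decode_prog ;; emit_prog"

lemma mods_item_prog [simp]: "mods item_prog = {''l'', ''r'', ''i'', ''k'', ''X'', ''out'', ''o''}"
  by (auto simp: item_prog_def)

lemma wp_item:
  assumes ok: "static_ok s" and a: "s ''a'' 0 = v" "v < n" and S: "s ''S'' 0 = S" "S < 2 ^ indeg v"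
    and w: "written ys s"
  shows "wp mem_bound item_prog
    (\<lambda>t s'. written (ys @ encode_list (labels v S)) s' \<and> t \<le> 8 + 11 * d) s"
proof -
  have "wp mem_bound decode_prog (\<lambda>t. wp mem_bound emit_prog (\<lambda>t' s'.
      written (ys @ encode_list (labels v S)) s' \<and> t + t' \<le> 8 + 11 * d)) s"
  proof (rule wp_frame[OF wp_decode[OF ok a S]])
    fix t s1
    assume 1: "holds (map label (decode v S)) s1 \<and> t \<le> 4 + 7 * d"
      and fr: "\<And>X. X \<notin> mods decode_prog \<Longrightarrow> s1 X = s X"
    have h: "holds (labels v S) s1" using 1 by (simp add: labels_def)
    have w1: "written ys s1" by (rule written_cong[OF w]) (simp_all add: fr)
    show "wp mem_bound emit_prog (\<lambda>t' s'.
      written (ys @ encode_list (labels v S)) s' \<and> t + t' \<le> 8 + 11 * d) s1"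
      by (rule wp_frame[OF wp_emit[OF h w1]]) (use 1 length_labels_le[OF a(2), of S] in simp)
  qed
  then show ?thesis by (simp add: item_prog_def)
qed

definition record_prog :: com where
  "record_prog = ''a'' ::= Get ''R'' (var ''b'') ;; ''S'' ::= Get ''T'' (var ''b'') ;; item_prog ;;
     ''b'' ::= Get ''W'' (var ''b'')"

lemma mods_record_prog [simp]: "mods record_prog =
    {''a'', ''S'', ''l'', ''r'', ''i'', ''k'', ''X'', ''out'', ''o'', ''b''}"
  by (auto simp: record_prog_def)

lemma linked_cong:
  "linked s b i rs \<Longrightarrow> s' ''R'' = s ''R'' \<Longrightarrow> s' ''T'' = s ''T'' \<Longrightarrow> s' ''W'' = s ''W'' \<Longrightarrow> linked s' b i rs"
  by (erule linked_mono) simp_all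

lemma wp_record:
  assumes ok: "static_ok s" and link: "linked s m (s ''b'' 0) ((v, S) # rs)" and v: "v < n"
    and S: "S < 2 ^ indeg v" and w: "written ys s"
  shows "wp mem_bound record_prog (\<lambda>t s'. linked s' m (s' ''b'' 0) rs \<and>
    written (ys @ encode_list (labels v S)) s' \<and> t \<le> 11 + 11 * d) s"
proof -
  have RT: "s ''R'' (s ''b'' 0) = v" "s ''T'' (s ''b'' 0) = S" "linked s m (s ''W'' (s ''b'' 0)) rs"
    using link by simp_all
  let ?s = "s(''a'' := (s ''a'')(0 := v), ''S'' := (s ''S'')(0 := S))"
  define post where "post t s' \<longleftrightarrow> linked s' m (s' ''b'' 0) rs \<and>
    written (ys @ encode_list (labels v S)) s' \<and> t \<le> 11 + 11 * d" for t s'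
  have ok1: "static_ok ?s" using ok by (simp add: static_names_def)
  have w1: "written ys ?s" using w by (simp add: written_def)
  have item: "wp mem_bound item_prog (\<lambda>t s'. written (ys @ encode_list (labels v S)) s' \<and> t \<le> 8 + 11 * d) ?s"
    by (rule wp_item[OF ok1 _ v _ S w1]) simp_all
  show ?thesis
    unfolding record_prog_def post_def[symmetric]
    apply (simp add: RT)
    apply (rule wp_frame[OF item])
    subgoal premises p for t s2
    proof -
      have b: "s2 ''W'' (s2 ''b'' 0) = s ''W'' (s ''b'' 0)" using p(2) by simp
      have "linked (s2(''b'' := (s2 ''b'')(0 := s ''W'' (s ''b'' 0)))) m (s ''W'' (s ''b'' 0)) rs"
        using p(2) by (intro linked_cong[OF RT(3)]) simp_all
      moreover have "written (ys @ encode_list (labels v S)) (s2(''b'' := (s2 ''b'')(0 := s ''W'' (s ''b'' 0))))"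
        using p(1) by (simp add: written_def)
      ultimately show ?thesis using p(1) b by (simp add: post_def)
    qed
    done
qed

definition entry_prog :: com where
  "entry_prog = Put ''out'' (var ''o'') (var ''v'') ;; incr ''o'' ;;
     ''a'' ::= var ''v'' ;; ''S'' ::= var ''s'' ;; item_prog ;;
     ''y'' ::= Add (Get ''M'' (var ''v'')) (var ''s'') ;;
     Put ''out'' (var ''o'') (Get ''C'' (var ''y'')) ;; incr ''o'' ;; ''b'' ::= Get ''H'' (var ''y'') ;;
     For ''q'' (Const 0) (Get ''C'' (var ''y'')) record_prog ;; incr ''E''"

lemma mods_entry_prog [simp]: "mods entry_prog = {''out'', ''o'', ''a'', ''S'', ''l'', ''r'', ''i'',
    ''k'', ''X'', ''y'', ''b'', ''q'', ''E''}"
  by (auto simp: entry_prog_def)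

lemma row_le_mem_bound:
  assumes "u < n" "T \<le> n"
  shows "u * Suc n + T \<le> mem_bound"
proof -
  have "u * Suc n + T \<le> Suc u * Suc n" using assms(2) by simp
  also have "\<dots> \<le> mem_bound" unfolding mem_bound_def using assms(1) by (intro mult_le_mono1) simp
  finally show ?thesis .
qed

definition entry :: "(nat \<Rightarrow> nat \<Rightarrow> (nat \<times> nat) list) \<Rightarrow> nat \<times> nat \<Rightarrow> entry" where
  "entry rec = (\<lambda>(v, S). (v, labels v S, map (\<lambda>(v', S'). labels v' S') (rec v S)))"

lemma wp_entry:
  assumes ok: "static_ok s" and v: "s ''v'' 0 = v" "v < n" and S: "s ''s'' 0 = S" "S < 2 ^ indeg v"
    and recs: "recs_ok rec s" and rec: "\<And>v' S'. (v', S') \<in> set (rec v S) \<Longrightarrow> v' < n \<and> S' < 2 ^ indeg v'"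
    and w: "written ys s"
  shows "wp mem_bound entry_prog (\<lambda>t s'. written (ys @ encode_entry (entry rec (v, S))) s' \<and>
    s' ''E'' 0 = Suc (s ''E'' 0) \<and> t \<le> 19 + 11 * d + length (rec v S) * (13 + 11 * d)) s"
proof -
  let ?rs = "rec v S"
  define post where "post t s' \<longleftrightarrow> written (ys @ encode_entry (entry rec (v, S))) s' \<and>
    s' ''E'' 0 = Suc (s ''E'' 0) \<and> t \<le> 19 + 11 * d + length ?rs * (13 + 11 * d)" for t s'
  have Sn: "S \<le> n" using S(2) two_power_indeg[OF v(2)] by simp
  have y: "v * Suc n + S = row v S" by (simp add: row_def)
  have M: "s ''M'' v = v * Suc n" using static_M[OF ok v(2)] .
  have link: "linked s (s ''B'' 0) (s ''H'' (row v S)) ?rs" "s ''C'' (row v S) = length ?rs"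
    using recs v(2) Sn unfolding recs_ok_def by blast+
  let ?ys1 = "ys @ [v]"
  let ?ys2 = "?ys1 @ encode_list (labels v S)"
  let ?ys3 = "?ys2 @ [length ?rs]"
  let ?items = "\<lambda>k. concat (map encode_list (map (\<lambda>(v', S'). labels v' S') (take k ?rs)))"
  have enc: "?ys3 @ ?items (length ?rs) = ys @ encode_entry (entry rec (v, S))"
    by (simp add: entry_def)
  have loop: "wp mem_bound (For ''q'' (Const 0) (Get ''C'' (var ''y'')) record_prog)
     (\<lambda>t s'. written (ys @ encode_entry (entry rec (v, S))) s' \<and> t \<le> 2 + length ?rs * (13 + 11 * d)) s2"
    if s2: "static_ok s2" "linked s2 (s ''B'' 0) (s2 ''b'' 0) ?rs" "s2 ''C'' (s2 ''y'' 0) = length ?rs"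
      "written ?ys3 s2" for s2
    apply (rule wp_For_const[where l = 0 and h = "length ?rs" and T = "11 + 11 * d" and
        I = "\<lambda>k s'. linked s' (s ''B'' 0) (s' ''b'' 0) (drop k ?rs) \<and> written (?ys3 @ ?items k) s'"])
    subgoal by simp
    subgoal by simp
    subgoal by simp
    subgoal using s2(3) by simp
    subgoal
    proof -
      have "linked (s2(''q'' := (s2 ''q'')(0 := 0))) (s ''B'' 0) (s2 ''b'' 0) ?rs"
        by (rule linked_cong[OF s2(2)]) simp_all
      then show ?thesis using s2(4) by (simp add: written_def)
    qed
    subgoal premises p for k s'
    proof -
      have fr: "s' Y = s2 Y" if "Y \<notin> insert ''q'' (mods record_prog)" for Y using p(4)[OF that] .
      obtain v' S' where r: "?rs ! k = (v', S')" by (cases "?rs ! k")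
      have rin: "(v', S') \<in> set ?rs" using r p(1) by (metis nth_mem)
      have dr: "drop k ?rs = (v', S') # drop (Suc k) ?rs" using p(1) r by (metis Cons_nth_drop_Suc)
      have items: "?ys3 @ ?items (Suc k) = (?ys3 @ ?items k) @ encode_list (labels v' S')"
        using p(1) r by (simp add: take_Suc_conv_app_nth)
      have ok': "static_ok s'" by (rule static_frame[OF s2(1)], rule fr) (auto simp: static_names_def)
      have l': "linked s' (s ''B'' 0) (s' ''b'' 0) ((v', S') # drop (Suc k) ?rs)" using p(2) dr by simp
      have wr: "written (?ys3 @ ?items k) s'" using p(2) by blast
      show ?thesis
      proof (rule wp_frame[OF wp_record[OF ok' l' _ _ wr]])
        show "v' < n" "S' < 2 ^ indeg v'" using rec[OF rin] by blast+
        fix t s3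
        assume 3: "linked s3 (s ''B'' 0) (s3 ''b'' 0) (drop (Suc k) ?rs) \<and>
          written ((?ys3 @ ?items k) @ encode_list (labels v' S')) s3 \<and> t \<le> 11 + 11 * d"
        let ?s3 = "s3(''q'' := (s3 ''q'')(0 := Suc (0 + k)))"
        from 3 have l3: "linked s3 (s ''B'' 0) (s3 ''b'' 0) (drop (Suc k) ?rs)"
          and w3: "written (?ys3 @ ?items (Suc k)) s3"
          unfolding items by blast+
        have "linked ?s3 (s ''B'' 0) (?s3 ''b'' 0) (drop (Suc k) ?rs)"
          by (rule linked_cong[of s3]) (use l3 in simp_all)
        moreover have "written (?ys3 @ ?items (Suc k)) ?s3"
          by (rule written_cong[OF w3]) simp_all
        ultimately show "t \<le> 11 + 11 * d \<and> linked ?s3 (s ''B'' 0) (?s3 ''b'' 0) (drop (Suc k) ?rs) \<and>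
          written (?ys3 @ ?items (Suc k)) ?s3" using 3 by blast
      qed
    qed
    subgoal premises p for t s'
    proof -
      have "written (ys @ encode_entry (entry rec (v, S))) s'" using p(1) enc by metis
      moreover have "t \<le> 2 + length ?rs * (13 + 11 * d)" using p(4) by (simp add: algebra_simps)
      ultimately show ?thesis by blast
    qed
    done
  let ?s1 = "s(''out'' := (s ''out'')(s ''o'' 0 := v), ''o'' := (s ''o'')(0 := Suc (s ''o'' 0)),
    ''a'' := (s ''a'')(0 := v), ''S'' := (s ''S'')(0 := S))"
  have w1: "written ?ys1 ?s1" by (rule written_snoc[OF w]) simp_all
  have ok1: "static_ok ?s1" using ok by (simp add: static_names_def)
  have item: "wp mem_bound item_prog (\<lambda>t s'. written ?ys2 s' \<and> t \<le> 8 + 11 * d) ?s1"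
    by (rule wp_item[OF ok1 _ v(2) _ S(2) w1]) simp_all
  show ?thesis
    unfolding entry_prog_def post_def[symmetric]
    apply (simp add: v(1) S(1) del: mult_Suc_right)
    apply (rule wp_frame[OF item])
    subgoal premises p for t s2
    proof -
      have fr: "s2 X = ?s1 X" if "X \<notin> mods item_prog" for X using p(2)[OF that] .
      have e: "s2 ''M'' = s ''M''" "s2 ''v'' = s ''v''" "s2 ''s'' = s ''s''" "s2 ''C'' = s ''C''" "s2 ''H'' = s ''H''"
        "s2 ''E'' = s ''E''" by (simp_all add: fr)
      let ?s3 = "s2(''y'' := (s2 ''y'')(0 := v * Suc n + S),
        ''out'' := (s2 ''out'')(s2 ''o'' 0 := length ?rs), ''o'' := (s2 ''o'')(0 := Suc (s2 ''o'' 0)),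
        ''b'' := (s2 ''b'')(0 := s ''H'' (row v S)))"
      have w2: "written ?ys2 s2" using p(1) by blast
      have ok2: "static_ok s2" by (rule static_frame[OF ok1], rule fr) (auto simp: static_names_def)
      have "wp mem_bound (For ''q'' (Const 0) (Get ''C'' (var ''y'')) record_prog)
        (\<lambda>t s'. written (ys @ encode_entry (entry rec (v, S))) s' \<and> t \<le> 2 + length ?rs * (13 + 11 * d)) ?s3"
      proof (rule loop)
        show "static_ok ?s3" using ok2 by (simp add: static_names_def)
        show "linked ?s3 (s ''B'' 0) (?s3 ''b'' 0) ?rs"
          using link(1) by (auto intro!: linked_cong[of s] simp: fr)
        show "?s3 ''C'' (?s3 ''y'' 0) = length ?rs" using link(2) y e by simp
        show "written ?ys3 ?s3" by (rule written_snoc[OF w2]) simp_all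
      qed
      note main = this
      show ?thesis
        apply (simp add: e M v(1) S(1) row_le_mem_bound[OF v(2) Sn, unfolded y] link(2) y
            del: mult_Suc_right)
        apply (rule wp_frame[OF main[unfolded y]])
        subgoal premises q for t' s4
        proof -
          have "s4 ''E'' = s ''E''" using q(2) e by simp
          then show ?thesis using p(1) q(1) by (auto simp: post_def written_def)
        qed
        done
    qed
    done
qed

definition output_prog :: com where
  "output_prog = ''o'' ::= Const 1 ;;
     For ''v'' (Const 0) (var ''n'') (For ''s'' (Const 0) (Get ''p'' (Get ''m'' (var ''v''))) entry_prog) ;;
     Put ''out'' (Const 0) (var ''E'')"

lemma mods_output_prog [simp]: "mods output_prog = {''v'', ''s''} \<union> mods entry_prog"
  by (auto simp: output_prog_def)

definition entry_time :: "nat \<Rightarrow> nat \<Rightarrow> nat" where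
  "entry_time v S = 19 + 11 * d + length (records cubes v S) * (13 + 11 * d)"

definition output_time :: nat where
  "output_time = 4 + (\<Sum>v<n. 4 + (\<Sum>S<2 ^ indeg v. entry_time v S + 2))"

text \<open>The list of vertices and masks that enumerates the cubes by their tops serves a second
  time here, as an enumeration of the pairs \<open>(L, u)\<close>.\<close>

definition entries :: "entry list" where
  "entries = map (entry (records cubes)) cubes"

lemma wp_output:
  assumes ok: "static_ok s" and recs: "recs_ok (records cubes) s" and zero: "s ''E'' 0 = 0"
  shows "wp mem_bound output_prog (\<lambda>t s'.
    (\<forall>i<length (encode_output entries). s' ''out'' i = encode_output entries ! i) \<and> t \<le> output_time) s"
proof -
  have n: "s ''n'' 0 = n" using ok by (simp add: static_ok_def)
  let ?entry = "entry (records cubes)"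
  define code where "code ps = concat (map encode_entry (map ?entry ps))" for ps
  let ?ps = "\<lambda>v. concat (map masks [0..<v])"
  define inv where "inv ps s' \<longleftrightarrow> written (code ps) s' \<and> s' ''E'' 0 = length ps" for ps s'
  have inv_update: "inv ps (s'(X := f)) \<longleftrightarrow> inv ps s'" if "X \<notin> {''o'', ''out'', ''E''}" for ps s' X f
    using that by (auto simp: inv_def written_def)
  define post where "post t s' \<longleftrightarrow>
    (\<forall>i<length (encode_output entries). s' ''out'' i = encode_output entries ! i) \<and> t \<le> output_time" for t s'
  have rec: "v' < n \<and> S' < 2 ^ indeg v'" if "(v', S') \<in> set (records cubes v S)" for v S v' S'
    using that set_cubes by (auto simp: records_def)
  show ?thesis
    unfolding output_prog_def post_def[symmetric]
    apply (simp add: n)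
    apply (rule wp_For[where l = 0 and h = n and
        T = "\<lambda>v. 2 + (\<Sum>S<2 ^ indeg v. entry_time v S + 2)" and I = "\<lambda>v s. inv (?ps v) s"])
    subgoal by simp
    subgoal by simp
    subgoal by simp
    subgoal using n by simp
    subgoal using zero by (simp add: inv_def written_def code_def)
    subgoal premises p for v s'
      apply (rule wp_For[where l = 0 and h = "2 ^ indeg v" and T = "\<lambda>S. entry_time v S" and
          I = "\<lambda>S s. inv (?ps v @ map (Pair v) [0..<S]) s"])
      subgoal by simp
      subgoal by simp
      subgoal by simp
      subgoal premises q for s2
      proof -
        have "s2 ''m'' = s ''m''" "s2 ''p'' = s ''p''" "s2 ''v'' 0 = v"
          using q[of "''m''"] q[of "''p''"] q[of "''v''"] p(3) p(4)[of "''m''"] p(4)[of "''p''"] by simp_all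
        then show ?thesis using static_m[OF ok p(1)] static_p[OF ok p(1), of "indeg v"] by simp
      qed
      subgoal using p(2) by (simp add: inv_update)
      subgoal premises q for S s2
      proof -
        let ?qs = "?ps v @ map (Pair v) [0..<S]"
        have fr: "s2 X = s X" if "X \<notin> insert ''v'' (insert ''s'' (mods entry_prog))" for X
          using q(4)[of X] p(4)[of X] that by simp
        have wr: "written (code ?qs) s2" "s2 ''E'' 0 = length ?qs" using q(2) by (simp_all add: inv_def)
        have "wp mem_bound entry_prog (\<lambda>t s'. written (code ?qs @ encode_entry (?entry (v, S))) s' \<and>
          s' ''E'' 0 = Suc (s2 ''E'' 0) \<and> t \<le> 19 + 11 * d + length (records cubes v S) * (13 + 11 * d)) s2"
        proof (rule wp_entry[OF _ _ p(1) _ q(1) _ rec wr(1)])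
          show "static_ok s2" by (rule static_frame[OF ok], rule fr) (auto simp: static_names_def)
          show "recs_ok (records cubes) s2" by (rule recs_ok_frame[OF recs], rule fr) auto
          show "s2 ''v'' 0 = v" using q(4)[of "''v''"] p(3) by simp
          show "s2 ''s'' 0 = S" using q(3) by simp
        qed
        then show ?thesis
        proof (rule wp_frame)
          fix t s3
          assume a: "written (code ?qs @ encode_entry (?entry (v, S))) s3 \<and>
            s3 ''E'' 0 = Suc (s2 ''E'' 0) \<and> t \<le> 19 + 11 * d + length (records cubes v S) * (13 + 11 * d)"
          have "code (?ps v @ map (Pair v) [0..<Suc S]) = code ?qs @ encode_entry (?entry (v, S))"
            by (simp add: code_def)
          then have "inv (?ps v @ map (Pair v) [0..<Suc S]) s3"
            using a wr(2) by (simp add: inv_def)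
          then show "t \<le> entry_time v S \<and>
            inv (?ps v @ map (Pair v) [0..<Suc S]) (s3(''s'' := (s3 ''s'')(0 := Suc (0 + S))))"
            using a unfolding entry_time_def by (subst inv_update) auto
        qed
      qed
      subgoal premises q for t s2
      proof -
        have "?ps v @ map (Pair v) [0..<2 ^ indeg v] = ?ps (Suc v)" by (simp add: masks_def)
        then have "inv (?ps (Suc v)) s2" using q(1) by simp
        then show ?thesis using q(4) by (subst inv_update) auto
      qed
      done
    subgoal premises p for t s'
    proof -
      have i: "written (code cubes) s'" "s' ''E'' 0 = length cubes"
        using p(1) by (simp_all add: inv_def cubes_def)
      have enc: "encode_output entries = length cubes # code cubes"
        by (simp add: encode_output_def entries_def code_def)
      have "(s'(''out'' := (s' ''out'')(0 := s' ''E'' 0))) ''out'' i = encode_output entries ! i"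
        if "i < length (encode_output entries)" for i
        using that i unfolding enc by (cases i) (auto simp: written_def)
      moreover have "(\<Sum>v<n. 2 + (\<Sum>S<2 ^ indeg v. entry_time v S + 2) + 2) =
        (\<Sum>v<n. 4 + (\<Sum>S<2 ^ indeg v. entry_time v S + 2))"
        by (intro sum.cong) auto
      then have "Suc (Suc t) \<le> output_time" using p(4) unfolding output_time_def by linarith
      ultimately show ?thesis using i(2) by (simp add: post_def)
    qed
    done
qed

section \<open>The whole program\<close>

definition whole_prog :: com where
  "whole_prog = rows_prog ;; bfs_prog ;; indeg_prog ;; label_prog ;; powers_prog ;; cls_prog ;;
     main_prog ;; output_prog"

lemma wp_obtain:
  "wp B c Q s \<Longrightarrow> \<exists>t s'. uexec B c s t s' \<and> Q t s' \<and> (\<forall>X. X \<notin> mods c \<longrightarrow> s' X = s X)"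
  unfolding wp_def using uexec_frame by blast

lemma input_frame:
  assumes "input_ok s" "\<And>X. X \<in> {''n'', ''root'', ''off'', ''nbr''} \<Longrightarrow> s' X = s X"
  shows "input_ok s'"
proof -
  have "s' ''n'' = s ''n''" "s' ''root'' = s ''root''" "s' ''off'' = s ''off''" "s' ''nbr'' = s ''nbr''"
    by (rule assms(2), simp)+
  then show ?thesis using assms(1) unfolding input_ok_def by simp
qed

definition total_time :: nat where
  "total_time = (3 + 3 * n) + (5 + 5 * n + 14 * (n * d)) + (2 + 4 * n + 12 * (n * d)) +
     (2 + n * (5 + d * (15 + 6 * d))) + (3 + n * (4 + 3 * d)) + (2 + 4 * n + 8 * (n * d)) +
     main_time + output_time"

lemma whole_prog_correct:
  "\<exists>t s. uexec mem_bound whole_prog (input_memory A v0) t s \<and> t \<le> total_time \<and> cls_ok s \<and>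
     (\<forall>i<length (encode_output entries). s ''out'' i = encode_output entries ! i)"
proof -
  define s0 where "s0 = input_memory A v0"
  have zero: "s0 X i = 0" if "X \<notin> {''n'', ''root'', ''off'', ''nbr''}" for X i
    using that by (auto simp: s0_def input_memory_def)
  have in0: "input_ok s0" using input_ok_initial by (simp add: s0_def)
  obtain t1 s1 where 1: "uexec mem_bound rows_prog s0 t1 s1" "rows_ok s1" "t1 \<le> 3 + 3 * n"
    and f1: "\<And>X. X \<notin> mods rows_prog \<Longrightarrow> s1 X = s0 X"
    using wp_obtain[OF wp_rows[OF in0]] zero by auto
  have in1: "input_ok s1" by (rule input_frame[OF in0], rule f1) auto
  have "s1 ''D'' v = 0" for v by (simp add: f1 zero)
  then obtain t2 s2 qs where 2: "uexec mem_bound bfs_prog s1 t2 s2" "order_ok qs" "queue_ok qs s2"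
    "t2 \<le> 5 + 5 * n + 14 * (n * d)"
    and f2: "\<And>X. X \<notin> mods bfs_prog \<Longrightarrow> s2 X = s1 X"
    using wp_obtain[OF wp_bfs[OF in1]] by auto
  have in2: "input_ok s2" by (rule input_frame[OF in1], rule f2) auto
  have rows2: "rows_ok s2" using 1(2) by (simp add: rows_ok_def f2)
  have "s2 ''m'' v = 0" for v by (simp add: f1 f2 zero)
  then obtain t3 s3 where 3: "uexec mem_bound indeg_prog s2 t3 s3" "ins_ok s3"
    "t3 \<le> 2 + 4 * n + 12 * (n * d)"
    and f3: "\<And>X. X \<notin> mods indeg_prog \<Longrightarrow> s3 X = s2 X"
    using wp_obtain[OF wp_indeg[OF in2 rows2 queue_depth[OF 2(2,3)]]] by auto
  have in3: "input_ok s3" by (rule input_frame[OF in2], rule f3) auto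
  have rows3: "rows_ok s3" using rows2 by (simp add: rows_ok_def f3)
  have len: "length qs = n" using 2(2) unfolding order_ok_def by blast
  have Q3: "\<forall>i<n. s3 ''Q'' i = qs ! i" using 2(3) len by (simp add: queue_ok_def f3)
  have "s3 ''A'' i = 0" "s3 ''d'' i = 0" for i by (simp_all add: f1 f2 f3 zero)
  then obtain t4 s4 where 4: "uexec mem_bound label_prog s3 t4 s4" "tables arcs s4"
    "t4 \<le> 2 + n * (5 + d * (15 + 6 * d))"
    and f4: "\<And>X. X \<notin> mods label_prog \<Longrightarrow> s4 X = s3 X"
    using wp_obtain[OF wp_label[OF in3 rows3 3(2) 2(2) Q3]] by blast
  have in4: "input_ok s4" by (rule input_frame[OF in3], rule f4) auto
  have rows4: "rows_ok s4" using rows3 by (simp add: rows_ok_def f4)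
  have ins4: "ins_ok s4" using 3(2) by (simp add: ins_ok_def f4)
  obtain t5 s5 where 5: "uexec mem_bound powers_prog s4 t5 s5" "powers_ok s5" "t5 \<le> 3 + n * (4 + 3 * d)"
    and f5: "\<And>X. X \<notin> mods powers_prog \<Longrightarrow> s5 X = s4 X"
    using wp_obtain[OF wp_powers[OF in4 ins4]] by blast
  have in5: "input_ok s5" by (rule input_frame[OF in4], rule f5) auto
  have rows5: "rows_ok s5" using rows4 by (simp add: rows_ok_def f5)
  have ins5: "ins_ok s5" using ins4 by (simp add: ins_ok_def f5)
  have tables5: "tables arcs s5"
  proof -
    have "tables arcs s5 \<longleftrightarrow> tables arcs s4" by (rule tables_cong) (simp_all add: f5)
    then show ?thesis using 4(2) by simp
  qed
  obtain t6 s6 where 6: "uexec mem_bound cls_prog s5 t6 s6" "cls_ok s6" "t6 \<le> 2 + 4 * n + 8 * (n * d)"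
    and f6: "\<And>X. X \<notin> mods cls_prog \<Longrightarrow> s6 X = s5 X"
    using wp_obtain[OF wp_cls[OF in5 rows5 tables5]] by blast
  have "s5 ''n'' 0 = n" using in5 by (simp add: input_ok_def)
  then have "static_ok s5" using rows5 ins5 tables5 5(2) by (simp add: static_ok_def)
  then have st6: "static_ok s6"
    by (rule static_frame) (rule f6, auto simp: static_names_def)
  have z6: "s6 ''B'' 0 = 0" "s6 ''H'' i = 0" "s6 ''C'' i = 0" "s6 ''E'' i = 0" for i
    by (simp_all add: f1 f2 f3 f4 f5 f6 zero)
  obtain t7 s7 where 7: "uexec mem_bound main_prog s6 t7 s7" "recs_ok (records cubes) s7" "t7 \<le> main_time"
    and f7: "\<And>X. X \<notin> mods main_prog \<Longrightarrow> s7 X = s6 X"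
    using wp_obtain[OF wp_main[OF st6 z6(1-3)]] by blast
  have st7: "static_ok s7"
    by (rule static_frame[OF st6]) (rule f7, auto simp: static_names_def)
  have "s7 ''E'' 0 = 0" using z6(4) by (simp add: f7)
  then obtain t8 s8 where 8: "uexec mem_bound output_prog s7 t8 s8"
    "\<forall>i<length (encode_output entries). s8 ''out'' i = encode_output entries ! i" "t8 \<le> output_time"
    and f8: "\<And>X. X \<notin> mods output_prog \<Longrightarrow> s8 X = s7 X"
    using wp_obtain[OF wp_output[OF st7 7(2)]] by blast
  have "cls_ok s8" using 6(2) by (simp add: cls_ok_def f7 f8)
  moreover have "uexec mem_bound whole_prog s0 (t1 + (t2 + (t3 + (t4 + (t5 + (t6 + (t7 + t8))))))) s8"
    unfolding whole_prog_def
    by (rule uexec.Seq[OF 1(1) uexec.Seq[OF 2(1) uexec.Seq[OF 3(1) uexec.Seq[OF 4(1)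
      uexec.Seq[OF 5(1) uexec.Seq[OF 6(1) uexec.Seq[OF 7(1) 8(1)]]]]]]])
  moreover have "t1 + (t2 + (t3 + (t4 + (t5 + (t6 + (t7 + t8)))))) \<le> total_time"
    using 1(3) 2(4) 3(3) 4(3) 5(3) 6(3) 7(3) 8(3) unfolding total_time_def by linarith
  ultimately show ?thesis using 8(2) unfolding s0_def by blast
qed

lemma output_correct:
  assumes "cls_ok s" "\<forall>i<length (encode_output entries). s ''out'' i = encode_output entries ! i"
  shows "correct_output V E A v0 s"
proof -
  have lists: "lists_classes label (labels v S) (set (decode v S))" if "v < n" for v S
    unfolding lists_classes_def enumerates_def labels_def
    using distinct_decode[OF that] by (intro exI[of _ "decode v S"]) (auto simp: list_all2_conv_all_nth)
  have entry: "entry_for E v0 label (entry (records cubes) (v, S)) (set (decode v S), v)"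
    if v: "v < n" and S: "S < 2 ^ indeg v" for v S
  proof -
    let ?rs = "records cubes v S"
    have "lists_classes label (case r of (v', S') \<Rightarrow> labels v' S') (case r of (v', S') \<Rightarrow> set (decode v' S'))"
      if "r \<in> set ?rs" for r
    proof (cases r)
      case (Pair v' S')
      then have "v' < n" using that set_cubes by (auto simp: records_def)
      then show ?thesis using lists Pair by simp
    qed
    then have "list_all2 (lists_classes label) (map (\<lambda>(v', S'). labels v' S') ?rs)
      (map (\<lambda>(v', S'). set (decode v' S')) ?rs)"
      unfolding list_all2_map1 list_all2_map2 by (intro list.rel_refl_strong)
    then have "enumerates (lists_classes label) (map (\<lambda>(v', S'). labels v' S') ?rs)
      (min_parallel E v0 (set (decode v S)) v)"
      unfolding enumerates_def using min_parallel_records[OF v S] by blast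
    then show ?thesis using lists[OF v] by (simp add: entry_def)
  qed
  have "u \<in> V \<longleftrightarrow> u < n" for u by (simp add: V_eq)
  then have pairs: "incoming_pairs V E v0 = {(L, u). u < n \<and> L \<subseteq> inc u}"
    unfolding incoming_pairs_eq by simp
  let ?pair = "\<lambda>(v, S). (set (decode v S), v)"
  have "distinct (map ?pair cubes)"
    unfolding distinct_map
  proof (intro conjI distinct_cubes inj_onI)
    fix p q assume "p \<in> set cubes" "q \<in> set cubes" "?pair p = ?pair q"
    then show "p = q" using decode_inj by (auto simp: set_cubes)
  qed
  moreover have "set (map ?pair cubes) = incoming_pairs V E v0"
  proof (intro set_eqI iffI)
    fix x assume "x \<in> set (map ?pair cubes)"
    then show "x \<in> incoming_pairs V E v0"
      unfolding pairs using set_decode_subset by (auto simp: set_cubes)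
  next
    fix x assume "x \<in> incoming_pairs V E v0"
    then obtain L u where x: "x = (L, u)" "u < n" "L \<subseteq> inc u"
      unfolding pairs by auto
    then obtain S where "S < 2 ^ indeg u" "set (decode u S) = L" using decode_exists by blast
    then have "x = ?pair (u, S)" "(u, S) \<in> set cubes" using x by (auto simp: set_cubes)
    then show "x \<in> set (map ?pair cubes)" unfolding set_map by (rule image_eqI)
  qed
  moreover have "list_all2 (entry_for E v0 label) entries (map ?pair cubes)"
  proof -
    have "entry_for E v0 label (entry (records cubes) p) (?pair p)" if "p \<in> set cubes" for p
    proof (cases p)
      case (Pair v S)
      then have "v < n" "S < 2 ^ indeg v" using that unfolding set_cubes by auto
      from entry[OF this] show ?thesis by (simp add: Pair)
    qed
    then show ?thesis
      unfolding entries_def list_all2_map1 list_all2_map2 by (intro list.rel_refl_strong)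
  qed
  ultimately have "enumerates (entry_for E v0 label) entries (incoming_pairs V E v0)"
    unfolding enumerates_def by blast
  moreover have "s ''cls'' (offset A u + i) = label F"
    if "u < n" "i < length (A ! u)" "F \<in> theta_classes E" "{u, A ! u ! i} \<in> F" for u i F
    using assms(1) that class_eq_cls[OF that(3,4)] by (simp add: cls_ok_def)
  ultimately show ?thesis
    unfolding correct_output_def using label_inj assms(2) by blast
qed

section \<open>Running time\<close>

text \<open>The measure to which all running times are compared. It is at least the number of cubes,
  since every \<open>bound\<close> is positive.\<close>

definition size_sum :: nat where
  "size_sum = (\<Sum>v<n. \<Sum>S<2 ^ indeg v. bound v S)"

lemma masks_le_size_sum: "(\<Sum>v<n. \<Sum>S<(2::nat) ^ indeg v. 1) \<le> size_sum"
  unfolding size_sum_def by (intro sum_mono bound_pos)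

lemma n_le_size_sum: "n \<le> size_sum"
proof -
  have "n = (\<Sum>v<n. 1)" by simp
  also have "\<dots> \<le> (\<Sum>v<n. \<Sum>S<(2::nat) ^ indeg v. 1)" by (intro sum_mono) simp
  finally show ?thesis using masks_le_size_sum by linarith
qed

lemma sum_list_cubes: "(\<Sum>p\<leftarrow>cubes. f p) = (\<Sum>v<n. \<Sum>S<2 ^ indeg v. f (v, S))" for f :: "_ \<Rightarrow> nat"
proof -
  have "(\<Sum>p\<leftarrow>concat (map masks [0..<k]). f p) = (\<Sum>v<k. \<Sum>S<2 ^ indeg v. f (v, S))" for k
    by (induction k)
      (simp_all add: masks_def comp_def interv_sum_list_conv_sum_set_nat atLeast0LessThan)
  then show ?thesis by (simp add: cubes_def)
qed

text \<open>A cube adds at most one record for each of its solutions, and all of them are attached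
  to the single vertex \<open>bottom v S\<close>.\<close>

lemma sum_records_le:
  "(\<Sum>u<n. \<Sum>L<2 ^ indeg u. length (records ps u L)) \<le> (\<Sum>(v, S)\<leftarrow>ps. length (solutions v S))"
proof (induction ps rule: rev_induct)
  case Nil
  then show ?case by (simp add: records_def)
next
  case (snoc p ps)
  obtain v S where p: "p = (v, S)" by (cases p)
  let ?X = "set (solutions v S)"
  have rec: "length (records (ps @ [p]) u L) =
    length (records ps u L) + (if bottom v S = u then of_bool (L \<in> ?X) else 0)" for u L
    by (simp add: records_def p)
  have "(\<Sum>u<n. \<Sum>L<2 ^ indeg u. if bottom v S = u then of_bool (L \<in> ?X) else 0 :: nat) =
    (\<Sum>u<n. if bottom v S = u then \<Sum>L<2 ^ indeg u. of_bool (L \<in> ?X) else 0)"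
    by (intro sum.cong) auto
  also have "\<dots> \<le> (\<Sum>L<2 ^ indeg (bottom v S). of_bool (L \<in> ?X))"
    by (simp add: sum.delta)
  also have "\<dots> = card ({..<2 ^ indeg (bottom v S)} \<inter> ?X)"
    by (simp add: sum.If_cases of_bool_def)
  also have "\<dots> \<le> card ?X" by (intro card_mono) auto
  also have "\<dots> \<le> length (solutions v S)" by (rule card_length)
  finally have "(\<Sum>u<n. \<Sum>L<2 ^ indeg u. if bottom v S = u then of_bool (L \<in> ?X) else 0 :: nat) \<le>
    length (solutions v S)" .
  then show ?case using snoc by (simp only: rec sum.distrib) (simp add: p)
qed

lemma sum_all_records_le:
  "(\<Sum>u<n. \<Sum>L<2 ^ indeg u. length (records cubes u L)) \<le> size_sum"
proof -
  have "length (solutions v S) \<le> bound v S" if "v < n" for v S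
    unfolding solutions_def by (rule length_levels_le[OF that]) simp
  then have "(\<Sum>v<n. \<Sum>S<2 ^ indeg v. length (solutions v S)) \<le> size_sum"
    unfolding size_sum_def by (intro sum_mono) auto
  then show ?thesis
    using sum_records_le[of cubes] sum_list_cubes[of "\<lambda>(v, S). length (solutions v S)"] by simp
qed

text \<open>The fourth power collects one factor for the levels, one for the elements tried, and two
  for checking a candidate.\<close>

lemma cube_time_le:
  assumes "1 \<le> b"
  shows "cube_time b + 2 \<le> 160 * Suc d ^ 4 * b"
proof -
  let ?D = "Suc d ^ 4"
  have D: "d ^ k \<le> ?D" if "k \<le> 4" for k
  proof -
    have "d ^ k \<le> Suc d ^ k" by (intro power_mono) auto
    also have "\<dots> \<le> ?D" using that by (intro power_increasing) auto
    finally show ?thesis .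
  qed
  have "cube_time b + 2 = 24 + 20 * d + (d * (extend_time + 2) + 9) * b"
    by (simp add: cube_time_def algebra_simps)
  also have "\<dots> \<le> (24 + 20 * d) * b + (d * (extend_time + 2) + 9) * b"
    using mult_le_mono2[OF assms, of "24 + 20 * d"] by simp
  \<comment> \<open>The coefficients of this polynomial add up to 160.\<close>
  also have "\<dots> = (33 * d ^ 0 + 46 * d ^ 1 + 50 * d ^ 2 + 26 * d ^ 3 + 5 * d ^ 4) * b"
    by (simp add: extend_time_def check_time_def algebra_simps power2_eq_square power3_eq_cube
        power4_eq_xxxx)
  also have "\<dots> \<le> (33 * ?D + 46 * ?D + 50 * ?D + 26 * ?D + 5 * ?D) * b"
    using D[of 0] D[of 1] D[of 2] D[of 3] D[of 4] by (intro mult_le_mono1 add_mono mult_le_mono2) auto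
  finally show ?thesis by simp
qed

lemma total_time_le: "total_time \<le> 1000 * (Suc d ^ 4 * size_sum)"
proof -
  let ?D = "Suc d ^ 4"
  let ?P = "?D * size_sum"
  have D: "d ^ k \<le> ?D" if "k \<le> 4" for k
  proof -
    have "d ^ k \<le> Suc d ^ k" by (intro power_mono) auto
    also have "\<dots> \<le> ?D" using that by (intro power_increasing) auto
    finally show ?thesis .
  qed
  have n1: "1 \<le> n" using root_less by simp
  have P: "n * d ^ k \<le> ?P" if "k \<le> 4" for k
    using mult_le_mono[OF n_le_size_sum D[OF that]] by (simp add: mult.commute)
  have P0: "n \<le> ?P" "n * d \<le> ?P" "n * (d * d) \<le> ?P"
    using P[of 0] P[of 1] P[of 2] by (simp_all add: power2_eq_square)
  note P1 = order_trans[OF n1 P0(1)]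
  have D1: "1 \<le> ?D" "d \<le> ?D" using D[of 0] D[of 1] by simp_all
  have "(\<Sum>v<n. \<Sum>S<2 ^ indeg v. cube_time (bound v S) + 2) \<le>
    (\<Sum>v<n. \<Sum>S<2 ^ indeg v. 160 * ?D * bound v S)"
    by (intro sum_mono cube_time_le bound_pos)
  also have "\<dots> = 160 * ?P" by (simp add: size_sum_def sum_distrib_left mult.assoc)
  finally have main: "main_time \<le> 2 + 4 * n + 160 * ?P"
    by (simp add: main_time_def sum.distrib)
  have "(\<Sum>v<n. \<Sum>S<2 ^ indeg v. entry_time v S + 2) =
    (21 + 11 * d) * (\<Sum>v<n. \<Sum>S<(2::nat) ^ indeg v. 1) +
    (13 + 11 * d) * (\<Sum>v<n. \<Sum>S<2 ^ indeg v. length (records cubes v S))"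
    unfolding sum_distrib_left sum.distrib[symmetric]
    by (intro sum.cong refl) (simp add: entry_time_def)
  also have "\<dots> \<le> (21 + 11 * d) * size_sum + (13 + 11 * d) * size_sum"
    by (intro add_mono mult_le_mono2 masks_le_size_sum sum_all_records_le)
  also have "\<dots> = (34 + 22 * d) * size_sum" by (simp add: algebra_simps)
  also have "\<dots> \<le> (56 * ?D) * size_sum" using D1 by (intro mult_le_mono1) linarith
  finally have out: "output_time \<le> 4 + 4 * n + 56 * ?P"
    by (simp add: output_time_def sum.distrib)
  have "total_time = 17 + 25 * n + 52 * (n * d) + 6 * (n * (d * d)) + main_time + output_time"
    by (simp add: total_time_def algebra_simps)
  \<comment> \<open>The coefficients add up to 330; 1000 is a round bound.\<close>
  also have "\<dots> \<le> 1000 * ?P" using main out P0 P1 by linarith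
  finally show ?thesis .
qed

lemma initial_bounded: "input_memory A v0 X i \<le> mem_bound"
proof -
  have "length (concat A) = (\<Sum>v<n. length (A ! v))"
    by (simp add: length_concat sum_list_sum_nth atLeast0LessThan)
  also have "\<dots> \<le> (\<Sum>v<n. n)" by (intro sum_mono length_neighbours_le) simp
  finally have len: "length (concat A) \<le> mem_bound" by (simp add: mem_bound_def)
  have "offset A u \<le> mem_bound" if "u \<le> n" for u
    using offset_le[OF that] len by simp
  moreover have "concat A ! i \<le> mem_bound" if "i < length (concat A)" for i
  proof -
    have "concat A ! i \<in> set (concat A)" using that by (rule nth_mem)
    then obtain xs where xs: "xs \<in> set A" "concat A ! i \<in> set xs" by auto
    then obtain u where "u < n" "xs = A ! u" by (auto simp: in_set_conv_nth)
    then have "concat A ! i < n" using xs(2) neighbours edge_less by auto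
    then show ?thesis using n_le_mem_bound by simp
  qed
  moreover have "n \<le> mem_bound" "v0 \<le> mem_bound" using n_le_mem_bound root_less by simp_all
  ultimately show ?thesis
    by (auto simp: input_memory_def cells_def simp del: upt_Suc)
qed

text \<open>Two bounds on \<open>t\<close> are used: the sharp one as a factor, and a polynomial one
  inside the logarithm. Four powers of the logarithm come from \<open>d + 1\<close>, the fifth from
  the cost of a single step.\<close>

lemma running_time:
  fixes W :: nat
  assumes t: "t \<le> total_time" and W: "1 \<le> W"
  shows "real (t * (W * size_cost (W * Suc (mem_bound + t)))) \<le>
    16000 * real W * (9 + log 2 (1002 * real W)) * (3.5394 ^ d * real n) * log 2 (real n + 1) ^ 5"
proof -
  let ?lg = "log 2 (real n + 1)" and ?N = "real n + 1"
  let ?c = "log 2 (1002 * real W)"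
  have n1: "1 \<le> real n" using root_less by simp
  \<comment> \<open>The argument \<open>n + 1\<close> instead of \<open>n\<close> keeps the
    logarithm at least 1 even for a single vertex, so that \<open>d + 1\<close> is at most twice the
    logarithm.\<close>
  have lg1: "1 \<le> ?lg" using n1 by (simp add: le_log_iff)
  have pow: "2 ^ d \<le> n" using two_power_dimension card_V by simp
  then have pow': "(2::real) ^ d \<le> real n" by (metis of_nat_le_iff of_nat_numeral of_nat_power)
  have pow2: "(2::real) ^ d \<le> ?N" using pow' by linarith
  have "real d \<le> ?lg"
  proof -
    have "real d = log 2 (2 ^ d)" by simp
    also have "\<dots> \<le> ?lg"
      by (rule log_mono) (use pow2 in auto)
    finally show ?thesis .
  qed
  moreover have "real (Suc d) = real d + 1" by simp
  ultimately have D: "real (Suc d) \<le> 2 * ?lg" using lg1 by linarith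
  have "real t \<le> real (1000 * (Suc d ^ 4 * size_sum))"
    using t total_time_le by (simp only: of_nat_le_iff)
  also have "\<dots> = 1000 * (real (Suc d) ^ 4 * real size_sum)" by simp
  finally have t1: "real t \<le> 1000 * (real (Suc d) ^ 4 * real size_sum)" .
  have sum: "real size_sum \<le> real n * (1415 / 400) ^ d"
    unfolding size_sum_def by (rule sum_bound_le)
  also have "\<dots> \<le> 3.5394 ^ d * real n"
    by (subst mult.commute, intro mult_right_mono power_mono) auto
  finally have sum1: "real size_sum \<le> 3.5394 ^ d * real n" .
  have "real (Suc d) ^ 4 \<le> (2 * ?lg) ^ 4" using D by (intro power_mono) auto
  also have "\<dots> = 16 * ?lg ^ 4" by (simp add: power_mult_distrib)
  finally have "real (Suc d) ^ 4 * real size_sum \<le> 16 * ?lg ^ 4 * (3.5394 ^ d * real n)"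
    using sum1 lg1 by (intro mult_mono) auto
  then have T: "real t \<le> 16000 * ?lg ^ 4 * (3.5394 ^ d * real n)" using t1 by simp
  \<comment> \<open>Here \<open>1415 / 400 \<le> 2 * 2\<close> and \<open>2 ^ d \<le> n\<close> turn
    the exponential factor into a polynomial one: degree 3 for \<open>size_sum\<close> and degree 4
    for the power of \<open>d + 1\<close>.\<close>
  have "real t \<le> 1000 * ?N ^ 7"
  proof -
    have "real size_sum \<le> real n * (2 ^ d * 2 ^ d)"
    proof -
      have "real n * (1415 / 400) ^ d \<le> real n * 4 ^ d"
        by (intro mult_left_mono power_mono) auto
      also have "(4::real) ^ d = 2 ^ d * 2 ^ d" by (simp flip: power_mult_distrib)
      finally show ?thesis using sum by simp
    qed
    also have "\<dots> \<le> ?N * (?N * ?N)" by (intro mult_mono pow2) auto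
    finally have "real size_sum \<le> ?N ^ 3" by (simp add: power3_eq_cube)
    moreover have "d \<le> n" using pow less_exp[of d] by linarith
    then have "real (Suc d) \<le> ?N" by simp
    then have "real (Suc d) ^ 4 \<le> ?N ^ 4" by (intro power_mono) auto
    ultimately have "real (Suc d) ^ 4 * real size_sum \<le> ?N ^ 4 * ?N ^ 3"
      by (intro mult_mono) auto
    then show ?thesis using t1 by (simp flip: power_add)
  qed
  moreover have "real (Suc mem_bound) \<le> 2 * ?N ^ 7"
  proof -
    have "real mem_bound = ?N ^ 2" by (simp add: mem_bound_def power2_eq_square algebra_simps)
    moreover have "?N ^ 2 \<le> ?N ^ 7" by (intro power_increasing) auto
    moreover have "1 \<le> ?N ^ 7" by (intro one_le_power) auto
    moreover have "real (Suc mem_bound) = real mem_bound + 1" by simp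
    ultimately show ?thesis by linarith
  qed
  ultimately have R: "real (Suc (mem_bound + t)) \<le> 1002 * ?N ^ 7" by simp
  define x where "x = W * Suc (mem_bound + t)"
  have x: "0 < x" using W by (simp add: x_def)
  have "real x \<le> real W * (1002 * ?N ^ 7)" unfolding x_def of_nat_mult using R by (intro mult_left_mono) auto
  then have "log 2 (real x) \<le> log 2 (1002 * real W * ?N ^ 7)"
    using x by (intro log_mono) (simp_all add: mult_ac)
  also have "\<dots> = ?c + 7 * ?lg" using W n1 by (simp add: log_mult log_nat_power)
  finally have lx: "log 2 (real x) \<le> ?c + 7 * ?lg" .
  have c: "0 \<le> ?c" using W by simp
  have "real (size_cost x) \<le> 2 + log 2 (real x)"
    using x by (simp add: size_cost_def floorlog_def)
  also have "\<dots> \<le> (9 + ?c) * ?lg"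
  proof -
    have "?c * 1 \<le> ?c * ?lg" using c lg1 by (rule mult_left_mono[rotated])
    moreover have "(9 + ?c) * ?lg = 9 * ?lg + ?c * ?lg" by (rule distrib_right)
    ultimately show ?thesis using lx lg1 by linarith
  qed
  finally have sc: "real (size_cost x) \<le> (9 + ?c) * ?lg" .
  have "real (t * (W * size_cost x)) = real t * (real W * real (size_cost x))" by simp
  also have "\<dots> \<le> (16000 * ?lg ^ 4 * (3.5394 ^ d * real n)) * (real W * ((9 + ?c) * ?lg))"
    using T sc lg1 by (intro mult_mono mult_left_mono) auto
  also have "\<dots> = 16000 * real W * (9 + ?c) * (3.5394 ^ d * real n) * ?lg ^ 5"
    by (simp add: power_numeral_reduce)
  finally show ?thesis unfolding x_def .
qed

end

theorem theorem18:
  "\<exists>(prog :: com) (C :: real) (k :: nat).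
     \<forall>(V :: nat set) (E :: nat set set) (A :: nat list list) (v0 :: nat) (n :: nat) (d :: nat).
       median_graph V E \<and> card V = n \<and> dimension V E = d \<and> v0 \<in> V \<and> adjacency_lists V E A \<longrightarrow>
       (\<exists>t s. exec prog (input_memory A v0) t s \<and>
          correct_output V E A v0 s \<and>
          real t \<le> C * (3.5394 ^ d * real n) * log 2 (real n + 1) ^ k)"
proof -
  \<comment> \<open>The text of the program does not depend on the graph, so \<open>W\<close> and
    the constant built from it are fixed before the input is given.\<close>
  define W where "W = Suc (csize graph_input.whole_prog)"
  show ?thesis
  proof (rule exI[of _ graph_input.whole_prog],
      rule exI[of _ "16000 * real W * (9 + log 2 (1002 * real W))"], rule exI[of _ 5], intro allI impI)
    fix V :: "nat set" and E :: "nat set set" and A :: "nat list list" and v0 n d :: nat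
    assume *: "median_graph V E \<and> card V = n \<and> dimension V E = d \<and> v0 \<in> V \<and> adjacency_lists V E A"
    then interpret G: graph_input V E v0 A by unfold_locales auto
    have n: "n = length A" and d: "d = dimension V E" using * G.card_V by auto
    obtain t s where s: "uexec G.mem_bound graph_input.whole_prog (input_memory A v0) t s"
      "t \<le> G.total_time" "G.cls_ok s"
      "\<forall>i<length (encode_output G.entries). s ''out'' i = encode_output G.entries ! i"
      using G.whole_prog_correct by blast
    obtain t' where t': "exec graph_input.whole_prog (input_memory A v0) t' s"
      "t' \<le> t * (W * size_cost (W * Suc (G.mem_bound + t)))"
      using uexec_exec[OF s(1) G.initial_bounded order_refl, of W "G.mem_bound + t"] by (auto simp: W_def)
    have W1: "1 \<le> W" by (simp add: W_def)
    have "real t' \<le> real (t * (W * size_cost (W * Suc (G.mem_bound + t))))"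
      using t'(2) by (simp only: of_nat_le_iff)
    also have "\<dots> \<le> 16000 * real W * (9 + log 2 (1002 * real W)) * (3.5394 ^ d * real n) *
        log 2 (real n + 1) ^ 5"
      unfolding n d by (rule G.running_time[OF s(2) W1])
    finally have t_le: "real t' \<le> 16000 * real W * (9 + log 2 (1002 * real W)) *
        (3.5394 ^ d * real n) * log 2 (real n + 1) ^ 5" .
    have "correct_output V E A v0 s" using G.output_correct s(3,4) by blast
    with t'(1) t_le show "\<exists>t s. exec graph_input.whole_prog (input_memory A v0) t s \<and>
        correct_output V E A v0 s \<and>
        real t \<le> 16000 * real W * (9 + log 2 (1002 * real W)) * (3.5394 ^ d * real n) *
          log 2 (real n + 1) ^ 5"
      by (intro exI[of _ t'] exI[of _ s] conjI)
  qed
qed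

end
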